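(* Let $\gamma\in[0,1)$ be fixed. Let $(p_1(\cdot),q_1(\cdot))\in\mathcal{E}^{\gamma}_{(1,\infty)}$ and $w_1\in\mathcal{A}^{\gamma}_{p_1(\cdot),q_1(\cdot)}$, and let $(p(\cdot),q(\cdot))\in\mathcal{E}^{\gamma}_{(1,\infty)}$ and $w\in\mathcal{A}^{\gamma}_{p(\cdot),q(\cdot)}$. For any $\theta\in(0,1)$ define the variable exponents $(p_0(\cdot),q_0(\cdot))$ and the weight $w_0$ (all depending on $\theta$) through $$\frac{1}{p(\cdot)}=\frac{1-\theta}{p_0(\cdot)}+\frac{\theta}{p_1(\cdot)},\qquad \frac{1}{q(\cdot)}=\frac{1-\theta}{q_0(\cdot)}+\frac{\theta}{q_1(\cdot)},\qquad w=w_0^{1-\theta}w_1^{\theta}.$$ Then there exists $\eta\in(0,1)$ such that for all $\theta\in(0,\eta)$ there holds that $$(p_0(\cdot),q_0(\cdot))\in\mathcal{E}^{\gamma}_{(1,\infty)}\quad\text{and}\quad w_0\in\mathcal{A}^{\gamma}_{p_0(\cdot),q_0(\cdot)}.$$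
   Context: Everything takes place on $\mathbb{R}^d$, $d\ge 1$, with Lebesgue measure; convention $1/\infty=0$. Variable exponents: $\mathcal{P}$ is the set of measurable functions $p(\cdot):\mathbb{R}^d\to[1,\infty]$. Write $p_-=\operatorname{ess\,inf}_{x}p(x)$ and $p_+=\operatorname{ess\,sup}_{x}p(x)$. The conjugate exponent $p'(\cdot)$ is given by $1/p(\cdot)+1/p'(\cdot)=1$. Variable Lebesgue norm: for $p(\cdot)\in\mathcal{P}$ and measurable $f$, $\|f\|_{p(\cdot)}:=\inf\{\lambda>0:\rho_{p(\cdot)}(f/\lambda)\le 1\}$, where $\rho_{p(\cdot)}(f):=\int_{\mathbb{R}^d\setminus\{p(\cdot)=\infty\}}|f(x)|^{p(x)}\,dx+\|f\|_{L^\infty(\{p(\cdot)=\infty\})}$. Log-Hölder classes: $p(\cdot)\in LH_0$ if there is $C_0>0$ such that $|p(x)-p(y)|\le \frac{C_0}{-\log(|x-y|)}$ whenever $|x-y|<\frac12$. $p(\cdot)\in LH_\infty$ if there are $p_\infty\in\mathbb{R}$ and $C_\infty>0$ such that $|p(x)-p_\infty|\le\frac{C_\infty}{\log(e+|x|)}$ for all $x$. $LH:=LH_0\cap LH_\infty$. Exponent classes: $\mathcal{E}^0_{(1,\infty)}:=\{p(\cdot)\in\mathcal{P}\cap LH: 1<p_-\le p_+<\infty\}$, and for $\gamma\in[0,1)$, $\mathcal{E}^\gamma_{(1,\infty)}:=\{(p(\cdot),q(\cdot))\in\mathcal{E}^0_{(1,\infty)}\times\mathcal{E}^0_{(1,\infty)}: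 1/p(\cdot)-1/q(\cdot)=\gamma\}$. (For $\gamma=0$, $p(\cdot)\in\mathcal{E}^0_{(1,\infty)}$ is identified with $(p(\cdot),p(\cdot))\in\mathcal{E}^0_{(1,\infty)}$.) Weights: a weight is a measurable, almost everywhere positive (real-valued) function on $\mathbb{R}^d$. For $\gamma\in[0,1)$ and $p(\cdot),q(\cdot)\in\mathcal{P}$ with $1/p(\cdot)-1/q(\cdot)=\gamma$, a weight $w$ belongs to $\mathcal{A}^\gamma_{p(\cdot),q(\cdot)}$ if $$[w]_{\mathcal{A}^\gamma_{p(\cdot),q(\cdot)}}:=\sup_Q|Q|^{\gamma-1}\|w\chi_Q\|_{q(\cdot)}\|w^{-1}\chi_Q\|_{p'(\cdot)}<\infty,$$ the supremum being over all cubes $Q\subset\mathbb{R}^d$. *)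

theory Defs
  imports "HOL-Analysis.Analysis" "HOL-Probability.Essential_Supremum"
begin

text \<open>
  Exponents are extended-real-valued, so that \<open>1 / \<infinity> = 0\<close> holds literally;
  norms and moduli live in \<^typ>\<open>ennreal\<close>.  ``Measurable'' means Lebesgue measurable.
\<close>

definition exponents :: "('a::euclidean_space \<Rightarrow> ereal) set" where
  "exponents = {p \<in> borel_measurable lebesgue. \<forall>x. 1 \<le> p x}"

definition p_minus :: "('a::euclidean_space \<Rightarrow> ereal) \<Rightarrow> ereal" where
  "p_minus p = Sup {c. AE x in lebesgue. c \<le> p x}"

definition p_plus :: "('a::euclidean_space \<Rightarrow> ereal) \<Rightarrow> ereal" where
  "p_plus p = esssup lebesgue p"

definition conj_exponent :: "('a::euclidean_space \<Rightarrow> ereal) \<Rightarrow> 'a \<Rightarrow> ereal" where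
  "conj_exponent p = (\<lambda>x. 1 / (1 - 1 / p x))"

lemma conj_exponent_eq:
  assumes "1 \<le> p x"
  shows "1 / p x + 1 / conj_exponent p x = 1"
proof (cases "p x")
  case (real r)
  with assms have "1 \<le> r" by simp
  then show ?thesis
    by (cases "r = 1") (simp_all add: conj_exponent_def real one_ereal_def divide_ereal_def field_simps)
qed (use assms in \<open>auto simp: conj_exponent_def\<close>)

definition modular :: "('a::euclidean_space \<Rightarrow> ereal) \<Rightarrow> ('a \<Rightarrow> real) \<Rightarrow> ennreal" where
  "modular p f =
     (\<integral>\<^sup>+ x \<in> - {x. p x = \<infinity>}. ennreal (\<bar>f x\<bar> powr real_of_ereal (p x)) \<partial>lebesgue)
     + esssup (restrict_space lebesgue {x. p x = \<infinity>}) (\<lambda>x. ennreal \<bar>f x\<bar>)"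

definition Lp_norm :: "('a::euclidean_space \<Rightarrow> ereal) \<Rightarrow> ('a \<Rightarrow> real) \<Rightarrow> ennreal" where
  "Lp_norm p f = Inf {ennreal l | l. 0 < l \<and> modular p (\<lambda>x. f x / l) \<le> 1}"

text \<open>
  For \<open>x = y\<close> the bound below reads \<open>\<bar>p x - p x\<bar> \<le> 0\<close>, since \<^prop>\<open>ln 0 = (0::real)\<close>; this
  only says that \<open>p x\<close> is finite.
\<close>

definition LH0 :: "('a::euclidean_space \<Rightarrow> ereal) set" where
  "LH0 = {p. \<exists>C>0. \<forall>x y. norm (x - y) < 1 / 2 \<longrightarrow>
            \<bar>p x - p y\<bar> \<le> ereal (C / - ln (norm (x - y)))}"

definition LH_infty :: "('a::euclidean_space \<Rightarrow> ereal) set" where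
  "LH_infty = {p. \<exists>p_infty::real. \<exists>C>0. \<forall>x.
            \<bar>p x - ereal p_infty\<bar> \<le> ereal (C / ln (exp 1 + norm x))}"

definition LH :: "('a::euclidean_space \<Rightarrow> ereal) set" where
  "LH = LH0 \<inter> LH_infty"

definition E0_class :: "('a::euclidean_space \<Rightarrow> ereal) set" where
  "E0_class = {p \<in> exponents \<inter> LH. 1 < p_minus p \<and> p_minus p \<le> p_plus p \<and> p_plus p < \<infinity>}"

definition E_class ::
  "real \<Rightarrow> (('a::euclidean_space \<Rightarrow> ereal) \<times> ('a \<Rightarrow> ereal)) set" where
  "E_class \<gamma> = {(p, q) \<in> E0_class \<times> E0_class. \<forall>x. 1 / p x - 1 / q x = ereal \<gamma>}"

definition weight :: "('a::euclidean_space \<Rightarrow> real) \<Rightarrow> bool" where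
  "weight w \<longleftrightarrow> w \<in> borel_measurable lebesgue \<and> (AE x in lebesgue. 0 < w x)"

text \<open>Cubes are nondegenerate, closed and have sides parallel to the coordinate axes.\<close>

definition cubes :: "'a::euclidean_space set set" where
  "cubes = {cbox a (a + l *\<^sub>R One) | a l. 0 < l}"

definition A_const ::
  "real \<Rightarrow> ('a::euclidean_space \<Rightarrow> ereal) \<Rightarrow> ('a \<Rightarrow> ereal) \<Rightarrow> ('a \<Rightarrow> real) \<Rightarrow> ennreal" where
  "A_const \<gamma> p q w =
     (SUP Q \<in> cubes. ennreal (measure lebesgue Q powr (\<gamma> - 1))
        * Lp_norm q (\<lambda>x. w x * indicator Q x)
        * Lp_norm (conj_exponent p) (\<lambda>x. inverse (w x) * indicator Q x))"

definition A_class ::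
  "real \<Rightarrow> ('a::euclidean_space \<Rightarrow> ereal) \<Rightarrow> ('a \<Rightarrow> ereal) \<Rightarrow> ('a \<Rightarrow> real) set" where
  "A_class \<gamma> p q = {w. weight w \<and> A_const \<gamma> p q w < \<infinity>}"

text \<open>
  The implicit relations that define \<open>p\<^sub>0\<close>, \<open>q\<^sub>0\<close> and \<open>w\<^sub>0\<close> from the remaining data.
  Weights are only positive almost everywhere, so the identity between them is one
  almost everywhere; it determines the weight \<open>w\<^sub>0\<close> up to a null set.
\<close>

definition endpoint_data ::
  "real \<Rightarrow> ('a::euclidean_space \<Rightarrow> ereal) \<Rightarrow> ('a \<Rightarrow> ereal) \<Rightarrow> ('a \<Rightarrow> real)
    \<Rightarrow> ('a \<Rightarrow> ereal) \<Rightarrow> ('a \<Rightarrow> ereal) \<Rightarrow> ('a \<Rightarrow> real)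
    \<Rightarrow> ('a \<Rightarrow> ereal) \<Rightarrow> ('a \<Rightarrow> ereal) \<Rightarrow> ('a \<Rightarrow> real) \<Rightarrow> bool" where
  "endpoint_data \<theta> p q w p\<^sub>1 q\<^sub>1 w\<^sub>1 p\<^sub>0 q\<^sub>0 w\<^sub>0 \<longleftrightarrow>
     (\<forall>x. 1 / p x = ereal (1 - \<theta>) / p\<^sub>0 x + ereal \<theta> / p\<^sub>1 x) \<and>
     (\<forall>x. 1 / q x = ereal (1 - \<theta>) / q\<^sub>0 x + ereal \<theta> / q\<^sub>1 x) \<and>
     weight w\<^sub>0 \<and>
     (AE x in lebesgue. w x = w\<^sub>0 x powr (1 - \<theta>) * w\<^sub>1 x powr \<theta>)"

end

(*
  Put s = p' and al = 1 - gamma, so that 1/q + 1/s = al. Write w_0 as w^(1/(1-theta)) times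
  (1/w_1)^(theta/(1-theta)); then (1-theta)/q_0 = 1/u + theta/s_1 with 1/u = 1/q - theta al, and
  Hoelder's inequality together with the condition on w_1 reduces the claim to the scale-invariant
  reverse Hoelder estimate |Q|^(theta al) |w 1_Q|_u <= C |w 1_Q|_q and to its dual for 1/w. In terms
  of V_Q = (w / |w 1_Q|_q)^q, which has integral at most 1 over Q, this says that the average over Q
  of (|Q| V_Q)^(1+eps) is bounded for some eps > 0.

  On cubes of side at most 1 or far from the origin, log-Hoelder continuity makes V_Q comparable to
  a multiple of V_R on every subcube R, so subsets of at most half the measure of R carry at most a
  fixed fraction b < 1 of its mass and a Calderon-Zygmund stopping argument applies. A large cube
  near the origin sits in a comparable cube centred at 0 of side 3^k; these are handled by induction
  on k, since |w 1_R|_q contracts by a fixed factor on passing to the central third and the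
  remaining cubes of the ternary subdivision are far from the origin.
*)
theory Submission
  imports Defs
begin

section \<open>Densities and cubes\<close>

text \<open>The obstacle is that \<open>w powr q\<close> is not homogeneous: scaling
  \<open>w\<close> by a constant multiplies it by a power depending on the point, so no single
  doubling measure is at hand and each cube needs its own normalised density. For a subcube R of Q
  one has V_Q = \<tau>^q(x) V_R, where \<tau> is the quotient of the two norms. Duality bounds
  1/\<tau> by a power of l / r (the sides), so the discrepancy between two points of R is controlled
  by exp (const |q(x) - q(y)| log (l / r)). The local condition pays for small r and decay at
  infinity for large l; but in a large cube around the origin there are subcubes of fixed size on
  which q may vary by a fixed amount while l / r is unbounded. Hence the separate treatment of such
  cubes. The fixed fraction of mass comes from Young's inequality with a small parameter, applied to
  w and 1/w: on a set of half measure the dual mass cannot make up for too little mass of w. The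
  loss theta al in 1/q is forced by 1/s_1 = al - 1/q_1; with it all powers of |Q| cancel in the
  final product.\<close>

definition density_on :: "('a::euclidean_space \<Rightarrow> real) \<Rightarrow> 'a set \<Rightarrow> ennreal" where
  "density_on V E = (\<integral>\<^sup>+x\<in>E. ennreal (V x) \<partial>lebesgue)"

lemma density_on_emeasure:
  assumes "V \<in> borel_measurable lebesgue" "E \<in> sets lebesgue"
  shows "density_on V E = emeasure (density lebesgue (\<lambda>x. ennreal (V x))) E"
  using assms by (subst emeasure_density) (auto simp: density_on_def)

lemma density_on_mono: "E \<subseteq> F \<Longrightarrow> density_on V E \<le> density_on V F"
  unfolding density_on_def by (intro nn_integral_mono) (auto simp: indicator_def)

lemma density_on_mono_fun:
  assumes "\<And>x. x \<in> E \<Longrightarrow> V x \<le> W x"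
  shows "density_on V E \<le> density_on W E"
  unfolding density_on_def using assms by (intro nn_integral_mono) (auto simp: indicator_def ennreal_leI)

lemma density_on_Un:
  assumes "V \<in> borel_measurable lebesgue" "E \<in> sets lebesgue" "F \<in> sets lebesgue" "E \<inter> F = {}"
  shows "density_on V (E \<union> F) = density_on V E + density_on V F"
  using assms by (simp add: density_on_emeasure plus_emeasure)

lemma density_on_UN:
  assumes "V \<in> borel_measurable lebesgue" "countable I" "\<And>i. i \<in> I \<Longrightarrow> X i \<in> sets lebesgue"
    and "disjoint_family_on X I"
  shows "density_on V (\<Union>i\<in>I. X i) = (\<integral>\<^sup>+i. density_on V (X i) \<partial>count_space I)"
proof -
  have "density_on V (\<Union>i\<in>I. X i) = emeasure (density lebesgue (\<lambda>x. ennreal (V x))) (\<Union>i\<in>I. X i)"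
    using assms by (subst density_on_emeasure) (auto intro!: sets.countable_UN')
  also have "\<dots> = (\<integral>\<^sup>+i. emeasure (density lebesgue (\<lambda>x. ennreal (V x))) (X i) \<partial>count_space I)"
    using assms by (intro emeasure_UN_countable) auto
  also have "\<dots> = (\<integral>\<^sup>+i. density_on V (X i) \<partial>count_space I)"
    using assms by (intro nn_integral_cong) (auto simp: density_on_emeasure)
  finally show ?thesis .
qed

lemma density_on_Union:
  assumes "V \<in> borel_measurable lebesgue" "countable \<F>" "\<F> \<subseteq> sets lebesgue" "disjoint \<F>"
  shows "density_on V (\<Union>\<F>) = (\<integral>\<^sup>+R. density_on V R \<partial>count_space \<F>)"
  using density_on_UN[of V \<F> "\<lambda>R. R"] assms by (auto simp: disjoint_family_on_def disjoint_def)

lemma emeasure_Union_lebesgue: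
  assumes "countable \<F>" "\<F> \<subseteq> sets lebesgue" "disjoint \<F>"
  shows "emeasure lebesgue (\<Union>\<F>) = (\<integral>\<^sup>+R. emeasure lebesgue R \<partial>count_space \<F>)"
  using density_on_Union[OF _ assms, of "\<lambda>_. 1"] assms(1,2)
  by (auto simp: density_on_def sets.countable_Union subset_iff cong: nn_integral_cong_simp)

lemma density_on_null:
  assumes "F - E \<in> null_sets lebesgue" "E \<subseteq> F"
  shows "density_on V E = density_on V F"
  unfolding density_on_def
proof (rule nn_integral_cong_AE)
  show "AE x in lebesgue. ennreal (V x) * indicator E x = ennreal (V x) * indicator F x"
    using AE_not_in[OF assms(1)] by eventually_elim (use assms(2) in \<open>auto simp: indicator_def\<close>)
qed

lemma density_on_cmult:
  assumes [measurable]: "V \<in> borel_measurable lebesgue" "E \<in> sets lebesgue" and "0 \<le> c" "\<And>x. 0 \<le> V x"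
  shows "density_on (\<lambda>x. c * V x) E = ennreal c * density_on V E"
proof -
  have "density_on (\<lambda>x. c * V x) E = (\<integral>\<^sup>+x. ennreal c * (ennreal (V x) * indicator E x) \<partial>lebesgue)"
    unfolding density_on_def using assms(3,4)
    by (intro nn_integral_cong) (simp add: ennreal_mult mult.assoc)
  then show ?thesis
    unfolding density_on_def by (subst (asm) nn_integral_cmult) auto
qed

lemma density_on_add:
  assumes [measurable]: "V \<in> borel_measurable lebesgue" "W \<in> borel_measurable lebesgue" "E \<in> sets lebesgue"
    and "\<And>x. 0 \<le> V x" "\<And>x. 0 \<le> W x"
  shows "density_on (\<lambda>x. V x + W x) E = density_on V E + density_on W E"
proof -
  have "density_on (\<lambda>x. V x + W x) E
      = (\<integral>\<^sup>+x. ennreal (V x) * indicator E x + ennreal (W x) * indicator E x \<partial>lebesgue)"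
    unfolding density_on_def using assms(4,5)
    by (intro nn_integral_cong) (auto simp: indicator_def)
  then show ?thesis
    unfolding density_on_def by (subst (asm) nn_integral_add) auto
qed

lemma density_on_const:
  "E \<in> sets lebesgue \<Longrightarrow> density_on (\<lambda>_. c) E = ennreal c * emeasure lebesgue E"
  by (simp add: density_on_def nn_integral_cmult_indicator)

lemma density_on_UN_le:
  assumes "V \<in> borel_measurable lebesgue" "finite I" "\<And>i. i \<in> I \<Longrightarrow> X i \<in> sets lebesgue"
  shows "density_on V (\<Union>i\<in>I. X i) \<le> (\<Sum>i\<in>I. density_on V (X i))"
proof -
  have "density_on V (\<Union>i\<in>I. X i) = emeasure (density lebesgue (\<lambda>x. ennreal (V x))) (\<Union>i\<in>I. X i)"
    using assms by (subst density_on_emeasure) (auto intro!: sets.finite_UN)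
  also have "\<dots> \<le> (\<Sum>i\<in>I. emeasure (density lebesgue (\<lambda>x. ennreal (V x))) (X i))"
    using assms by (intro emeasure_subadditive_finite) auto
  also have "\<dots> = (\<Sum>i\<in>I. density_on V (X i))"
    using assms by (intro sum.cong) (auto simp: density_on_emeasure)
  finally show ?thesis .
qed

abbreviation cube :: "'a::euclidean_space \<Rightarrow> real \<Rightarrow> 'a set" where
  "cube c r \<equiv> cbox c (c + r *\<^sub>R One)"

lemma cube_measure:
  assumes "0 \<le> l"
  shows "measure lebesgue (cbox c (c + l *\<^sub>R One :: 'a::euclidean_space)) = l ^ DIM('a)"
  using assms by (simp add: measure_lborel_cbox_eq inner_add_left)

lemma mem_cube: "x \<in> cube c r \<longleftrightarrow> (\<forall>i\<in>Basis. c \<bullet> i \<le> x \<bullet> i \<and> x \<bullet> i \<le> c \<bullet> i + r)"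
  by (simp add: mem_box inner_add_left)

lemma emeasure_cube:
  "0 < r \<Longrightarrow> emeasure lebesgue (cube c r :: 'a::euclidean_space set) = ennreal (r ^ DIM('a))"
  by (simp add: emeasure_lborel_cbox_eq inner_add_left)

lemma cube_dist:
  fixes x y c :: "'a::euclidean_space" and r :: real
  assumes "x \<in> cube c r" "y \<in> cube c r"
  shows "norm (x - y) \<le> DIM('a) * r"
proof -
  have "\<bar>(x - y) \<bullet> i\<bar> \<le> r" if "i \<in> Basis" for i
  proof -
    have "c \<bullet> i \<le> x \<bullet> i" "x \<bullet> i \<le> c \<bullet> i + r" "c \<bullet> i \<le> y \<bullet> i" "y \<bullet> i \<le> c \<bullet> i + r"
      using assms that by (auto simp: mem_box inner_add_left dest!: bspec[of _ _ i])
    then show ?thesis by (simp add: inner_diff_left)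
  qed
  then have "norm (x - y) \<le> (\<Sum>i\<in>(Basis::'a set). r)"
    by (intro order_trans[OF norm_le_l1] sum_mono) auto
  then show ?thesis by simp
qed

lemma cube_subset_side:
  fixes a c :: "'a::euclidean_space" and r l :: real
  assumes "0 < r" "cube c r \<subseteq> cube a l"
  shows "r \<le> l"
proof -
  obtain i :: 'a where i: "i \<in> Basis" using nonempty_Basis by blast
  have "c \<in> cube c r" "c + r *\<^sub>R One \<in> cube c r"
    using assms(1) by (auto simp: mem_box inner_add_left)
  then have "c \<in> cube a l" "c + r *\<^sub>R One \<in> cube a l" using assms(2) by auto
  then have "a \<bullet> i \<le> c \<bullet> i" "(c + r *\<^sub>R One) \<bullet> i \<le> (a + l *\<^sub>R One) \<bullet> i"
    using i unfolding mem_box by blast+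
  then show ?thesis using i by (simp add: inner_add_left)
qed

lemma cube_complement_half:
  fixes a :: "'a::euclidean_space"
  assumes "0 < l" "E \<in> sets lebesgue" "E \<subseteq> cube a l" "2 * emeasure lebesgue E \<le> ennreal (l ^ DIM('a))"
  shows "ennreal (l ^ DIM('a)) \<le> 2 * emeasure lebesgue (cube a l - E)"
proof -
  have "emeasure lebesgue E + emeasure lebesgue (cube a l - E) = emeasure lebesgue (E \<union> (cube a l - E))"
    using assms(2) by (intro plus_emeasure) auto
  also have "E \<union> (cube a l - E) = cube a l"
    using assms(3) by blast
  also have "emeasure lebesgue (cube a l) = ennreal (l ^ DIM('a))"
    by (rule emeasure_cube[OF assms(1)])
  finally have "2 * ennreal (l ^ DIM('a)) = 2 * emeasure lebesgue E + 2 * emeasure lebesgue (cube a l - E)"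
    by (metis distrib_left)
  with assms(4) have "ennreal (l ^ DIM('a)) + ennreal (l ^ DIM('a))
      \<le> ennreal (l ^ DIM('a)) + 2 * emeasure lebesgue (cube a l - E)"
    by (metis add_right_mono mult_2)
  then show ?thesis
    by (simp add: ennreal_add_left_cancel_le)
qed

lemma null_set_diff_box:
  assumes "box c d \<subseteq> S" "S \<subseteq> cbox c (d::'a::euclidean_space)"
  shows "cbox c d - S \<in> null_sets lebesgue" "S \<in> sets lebesgue"
proof -
  have "negligible (cbox c d - box c d)"
    using negligible_frontier_interval by blast
  then have "negligible (cbox c d - S)"
    using assms by (elim negligible_subset) auto
  then show 1: "cbox c d - S \<in> null_sets lebesgue"
    using negligible_iff_null_sets by blast
  have "cbox c d - (cbox c d - S) \<in> sets lebesgue"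
    by (rule sets.Diff[OF _ null_setsD2[OF 1]]) simp
  moreover have "cbox c d - (cbox c d - S) = S"
    using assms by auto
  ultimately show "S \<in> sets lebesgue" by metis
qed

section \<open>Dyadic cells and a local reverse Hoelder inequality\<close>

text \<open>A cell is named by any of its points. Equality of floors makes cells half-open, so each
  generation partitions the whole space exactly; in return a cell is a closed cube only up to a null
  set.\<close>

definition dyadic_cell :: "'a::euclidean_space \<Rightarrow> real \<Rightarrow> nat \<Rightarrow> 'a \<Rightarrow> 'a set" where
  "dyadic_cell a l n x =
     {y. \<forall>i\<in>Basis. \<lfloor>2 ^ n * ((y - a) \<bullet> i / l)\<rfloor> = \<lfloor>2 ^ n * ((x - a) \<bullet> i / l)\<rfloor>}"

lemma dyadic_cell_self: "x \<in> dyadic_cell a l n x"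
  by (simp add: dyadic_cell_def)

lemma dyadic_cell_eq: "y \<in> dyadic_cell a l n x \<Longrightarrow> dyadic_cell a l n y = dyadic_cell a l n x"
  by (simp add: dyadic_cell_def)

text \<open>Integer division by 2 turns the index of generation \<open>Suc n\<close> into that of
  generation \<open>n\<close>, so the finer index determines the coarser one.\<close>

lemma dyadic_cell_Suc: "dyadic_cell a l (Suc n) x \<subseteq> dyadic_cell a l n x"
proof -
  have "\<lfloor>2 ^ n * t\<rfloor> = \<lfloor>2 ^ Suc n * t\<rfloor> div 2" for t :: real
    by (subst floor_divide_real_eq_div[symmetric]) auto
  then show ?thesis
    unfolding dyadic_cell_def by (simp only: subset_iff mem_Collect_eq) metis
qed

lemma dyadic_cell_antimono: "m \<le> n \<Longrightarrow> dyadic_cell a l n x \<subseteq> dyadic_cell a l m x"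
  by (induction n rule: dec_induct) (use dyadic_cell_Suc in blast)+

lemma dyadic_cell_eq_le:
  "m \<le> n \<Longrightarrow> y \<in> dyadic_cell a l n x \<Longrightarrow> dyadic_cell a l m y = dyadic_cell a l m x"
  using dyadic_cell_antimono dyadic_cell_eq by blast

lemma countable_dyadic_cells: "countable (range (dyadic_cell a l n))"
proof -
  let ?F = "\<lambda>k. {y. \<forall>i\<in>Basis. \<lfloor>2 ^ n * ((y - a) \<bullet> i / l)\<rfloor> = k i}"
  have "dyadic_cell a l n x
      = ?F (restrict (\<lambda>i. \<lfloor>2 ^ n * ((x - a) \<bullet> i / l)\<rfloor>) Basis)" for x
    by (simp add: dyadic_cell_def)
  moreover have "restrict (\<lambda>i. \<lfloor>2 ^ n * ((x - a) \<bullet> i / l)\<rfloor>) Basis \<in> PiE Basis (\<lambda>_. UNIV)" for x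
    by auto
  ultimately have "range (dyadic_cell a l n) \<subseteq> ?F ` PiE Basis (\<lambda>_. UNIV)"
    by blast
  moreover have "countable (?F ` PiE (Basis::'a set) (\<lambda>_. UNIV::int set))"
    by (intro countable_image countable_PiE) auto
  ultimately show ?thesis
    by (rule countable_subset)
qed

text \<open>The boundary of a box is negligible, so this sandwich yields both measurability and
  measure of a cell from those of a closed cube.\<close>

lemma dyadic_cell_between:
  fixes a :: "'a::euclidean_space"
  assumes "0 < l"
  obtains c where "box c (c + (l / 2 ^ n) *\<^sub>R One) \<subseteq> dyadic_cell a l n x"
    and "dyadic_cell a l n x \<subseteq> cube c (l / 2 ^ n)"
proof
  define k where "k i = \<lfloor>2 ^ n * ((x - a) \<bullet> i / l)\<rfloor>" for i
  define c where "c = a + (\<Sum>i\<in>Basis. (l / 2 ^ n * of_int (k i)) *\<^sub>R i)"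
  have c: "c \<bullet> i = a \<bullet> i + l / 2 ^ n * of_int (k i)" if "i \<in> Basis" for i
    using that by (simp add: c_def inner_add_left inner_sum_left inner_Basis if_distrib sum.If_cases)
  have iff: "\<lfloor>2 ^ n * ((y - a) \<bullet> i / l)\<rfloor> = k i \<longleftrightarrow>
      c \<bullet> i \<le> y \<bullet> i \<and> y \<bullet> i < (c + (l / 2 ^ n) *\<^sub>R One) \<bullet> i" if "i \<in> Basis" for y i
    using assms that by (simp add: c floor_eq_iff inner_diff_left inner_add_left field_simps)
  show "box c (c + (l / 2 ^ n) *\<^sub>R One) \<subseteq> dyadic_cell a l n x"
    unfolding dyadic_cell_def k_def[symmetric] using iff by (force simp: mem_box)
  show "dyadic_cell a l n x \<subseteq> cube c (l / 2 ^ n)"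
    unfolding dyadic_cell_def k_def[symmetric] using iff by (force simp: mem_box)
qed

lemma dyadic_cell_0:
  fixes a :: "'a::euclidean_space"
  assumes "0 < l"
  shows "box a (a + l *\<^sub>R One) \<subseteq> dyadic_cell a l 0 a"
    and "dyadic_cell a l 0 a \<subseteq> cube a l"
proof -
  have "\<lfloor>2 ^ 0 * ((y - a) \<bullet> i / l)\<rfloor> = \<lfloor>2 ^ 0 * ((a - a) \<bullet> i / l)\<rfloor> \<longleftrightarrow>
      a \<bullet> i \<le> y \<bullet> i \<and> y \<bullet> i < (a + l *\<^sub>R One) \<bullet> i" if "i \<in> Basis" for y i
    using assms that by (simp add: floor_eq_iff inner_diff_left inner_add_left field_simps)
  then have "dyadic_cell a l 0 a = {y. \<forall>i\<in>Basis. a \<bullet> i \<le> y \<bullet> i \<and> y \<bullet> i < (a + l *\<^sub>R One) \<bullet> i}"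
    unfolding dyadic_cell_def by blast
  then show "box a (a + l *\<^sub>R One) \<subseteq> dyadic_cell a l 0 a"
    and "dyadic_cell a l 0 a \<subseteq> cube a l"
    by (force simp: mem_box)+
qed

lemma dyadic_cell_cube:
  fixes a :: "'a::euclidean_space"
  assumes "0 < l"
  obtains c where "dyadic_cell a l n x \<subseteq> cube c (l / 2 ^ n)"
    "cube c (l / 2 ^ n) - dyadic_cell a l n x \<in> null_sets lebesgue"
    "box c (c + (l / 2 ^ n) *\<^sub>R One) \<subseteq> dyadic_cell a l n x"
  using dyadic_cell_between[OF assms] null_set_diff_box by metis

lemma dyadic_cell_sets: "0 < l \<Longrightarrow> dyadic_cell a l n x \<in> sets lebesgue"
  by (meson dyadic_cell_between null_set_diff_box)

lemma dyadic_cell_emeasure: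
  fixes a :: "'a::euclidean_space"
  assumes "0 < l"
  shows "emeasure lebesgue (dyadic_cell a l n x) = ennreal ((l / 2 ^ n) ^ DIM('a))"
proof -
  obtain c where c: "dyadic_cell a l n x \<subseteq> cube c (l / 2 ^ n)"
    "cube c (l / 2 ^ n) - dyadic_cell a l n x \<in> null_sets lebesgue"
    by (rule dyadic_cell_cube[OF assms])
  have "emeasure lebesgue (dyadic_cell a l n x) = density_on (\<lambda>_. 1) (dyadic_cell a l n x)"
    using dyadic_cell_sets[OF assms, of a n x] by (simp add: density_on_def)
  also have "\<dots> = density_on (\<lambda>_. 1) (cube c (l / 2 ^ n))"
    using c by (intro density_on_null)
  also have "\<dots> = emeasure lebesgue (cube c (l / 2 ^ n))"
    by (simp add: density_on_def)
  also have "\<dots> = ennreal ((l / 2 ^ n) ^ DIM('a))"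
    using assms by (simp add: emeasure_lborel_cbox_eq inner_add_left)
  finally show ?thesis .
qed

lemma dyadic_cell_fine:
  fixes a :: "'a::euclidean_space"
  assumes "0 < l" "open G" "x \<in> G"
  shows "\<exists>n. dyadic_cell a l n x \<subseteq> G"
proof -
  obtain e where e: "0 < e" "ball x e \<subseteq> G"
    using assms openE by blast
  obtain n where n: "l * DIM('a) / e < 2 ^ n"
    using real_arch_pow[of 2] by auto
  obtain c where c: "dyadic_cell a l n x \<subseteq> cube c (l / 2 ^ n)"
    by (rule dyadic_cell_cube[OF assms(1)])
  have "y \<in> ball x e" if y: "y \<in> dyadic_cell a l n x" for y
  proof -
    have xy: "x \<in> cube c (l / 2 ^ n)" "y \<in> cube c (l / 2 ^ n)"
      using c y dyadic_cell_self[of x a l n] by auto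
    have "\<bar>(x - y) \<bullet> i\<bar> \<le> l / 2 ^ n" if "i \<in> Basis" for i
    proof -
      have "c \<bullet> i \<le> x \<bullet> i" "x \<bullet> i \<le> c \<bullet> i + l / 2 ^ n" "c \<bullet> i \<le> y \<bullet> i" "y \<bullet> i \<le> c \<bullet> i + l / 2 ^ n"
        using xy that by (auto simp: mem_box inner_add_left dest!: bspec[of _ _ i])
      then show ?thesis by (simp add: inner_diff_left)
    qed
    then have "norm (x - y) \<le> (\<Sum>i\<in>(Basis::'a set). l / 2 ^ n)"
      by (intro order_trans[OF norm_le_l1] sum_mono) auto
    also have "\<dots> < e"
      using n e(1) by (simp add: field_simps)
    finally show ?thesis by (simp add: dist_norm)
  qed
  then show ?thesis using e by blast
qed

text \<open>The maximal cells inside the starting cell that satisfy \<open>P\<close>: minimality of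
  the generation is maximality of the cell. The Calderon-Zygmund cells and a covering of an open set
  are both of this form.\<close>

definition first_cells ::
  "'a::euclidean_space \<Rightarrow> real \<Rightarrow> ('a set \<Rightarrow> bool) \<Rightarrow> 'a set set" where
  "first_cells a l P =
     {dyadic_cell a l n x |n x. x \<in> dyadic_cell a l 0 a \<and> P (dyadic_cell a l n x)
        \<and> (\<forall>m<n. \<not> P (dyadic_cell a l m x))}"

text \<open>Every point of a selected cell can replace the point that named it, because all coarser
  cells through two points of one cell agree.\<close>

lemma first_cellsE:
  assumes "R \<in> first_cells a l P" "z \<in> R"
  obtains n where "R = dyadic_cell a l n z" "P R" "\<And>m. m < n \<Longrightarrow> \<not> P (dyadic_cell a l m z)"
    "z \<in> dyadic_cell a l 0 a"
proof -
  obtain n x where R: "R = dyadic_cell a l n x" "x \<in> dyadic_cell a l 0 a" "P R"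
    "\<And>m. m < n \<Longrightarrow> \<not> P (dyadic_cell a l m x)"
    using assms(1) unfolding first_cells_def by blast
  have eq: "dyadic_cell a l m z = dyadic_cell a l m x" if "m \<le> n" for m
    using that assms(2) R(1) by (intro dyadic_cell_eq_le[of m n]) auto
  have "z \<in> dyadic_cell a l 0 a"
    using eq[of 0] dyadic_cell_self[of z a l 0] dyadic_cell_eq[OF R(2)] by auto
  then show thesis
    using that[of n] R eq by simp
qed

lemma countable_first_cells: "countable (first_cells a l P)"
proof (rule countable_subset)
  show "first_cells a l P \<subseteq> (\<Union>n. range (dyadic_cell a l n))"
    unfolding first_cells_def by blast
qed (use countable_dyadic_cells in auto)

lemma first_cells_sets: "0 < l \<Longrightarrow> first_cells a l P \<subseteq> sets lebesgue"
  unfolding first_cells_def by (auto simp: dyadic_cell_sets)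

lemma disjoint_first_cells: "disjoint (first_cells a l P)"
proof (rule disjointI)
  fix R T assume RT: "R \<in> first_cells a l P" "T \<in> first_cells a l P" "R \<noteq> T"
  show "R \<inter> T = {}"
  proof (rule ccontr)
    assume "R \<inter> T \<noteq> {}"
    then obtain z where z: "z \<in> R" "z \<in> T" by blast
    obtain n where n: "R = dyadic_cell a l n z" "P R" "\<And>m. m < n \<Longrightarrow> \<not> P (dyadic_cell a l m z)"
      using first_cellsE[OF RT(1) z(1)] by metis
    obtain k where k: "T = dyadic_cell a l k z" "P T" "\<And>m. m < k \<Longrightarrow> \<not> P (dyadic_cell a l m z)"
      using first_cellsE[OF RT(2) z(2)] by metis
    have "n = k" using n k by (metis linorder_neqE_nat)
    then show False using n k RT(3) by simp
  qed
qed

lemma Union_first_cells: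
  "\<Union>(first_cells a l P) = {x \<in> dyadic_cell a l 0 a. \<exists>n. P (dyadic_cell a l n x)}"
proof (intro set_eqI iffI)
  fix z assume "z \<in> \<Union>(first_cells a l P)"
  then obtain R where R: "R \<in> first_cells a l P" "z \<in> R" by blast
  show "z \<in> {x \<in> dyadic_cell a l 0 a. \<exists>n. P (dyadic_cell a l n x)}"
    by (rule first_cellsE[OF R]) auto
next
  fix z assume z: "z \<in> {x \<in> dyadic_cell a l 0 a. \<exists>n. P (dyadic_cell a l n x)}"
  define n where "n = (LEAST n. P (dyadic_cell a l n z))"
  have "P (dyadic_cell a l n z)"
    unfolding n_def by (rule LeastI_ex) (use z in simp)
  moreover have "\<not> P (dyadic_cell a l m z)" if "m < n" for m
    using that not_less_Least n_def by blast
  ultimately have "dyadic_cell a l n z \<in> first_cells a l P"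
    using z unfolding first_cells_def by blast
  then show "z \<in> \<Union>(first_cells a l P)"
    using dyadic_cell_self by blast
qed

section \<open>Calderon-Zygmund stopping argument on one cube\<close>

text \<open>\<open>small_sets\<close> is an A-infinity condition, uniform over subcubes, with the
  fraction of measure fixed at one half. \<open>density_le\<close> normalises the average of
  \<open>V\<close> to at most 1, so that no cell is selected at generation 0 for heights from 1
  on.\<close>

locale small_sets_small_density =
  fixes a :: "'a::euclidean_space" and l :: real and V :: "'a \<Rightarrow> real" and b :: real
  assumes side_pos: "0 < l"
    and V_measurable [measurable]: "V \<in> borel_measurable lebesgue"
    and V_nonneg: "0 \<le> V x"
    and density_le: "density_on V (cube a l) \<le> ennreal (l ^ DIM('a))"
    and b_nonneg: "0 \<le> b"
    and small_sets: "\<lbrakk>0 < r; cube c r \<subseteq> cube a l;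
        E \<in> sets lebesgue; E \<subseteq> cube c r;
        2 * emeasure lebesgue E \<le> ennreal (r ^ DIM('a))\<rbrakk>
      \<Longrightarrow> density_on V E \<le> ennreal b * density_on V (cube c r)"
begin

abbreviation "cell \<equiv> dyadic_cell a l"

abbreviation "Q\<^sub>0 \<equiv> dyadic_cell a l 0 a"

definition "dense t R \<longleftrightarrow> ennreal t * emeasure lebesgue R < density_on V R"

text \<open>The Calderon-Zygmund cells at height \<open>t\<close>: the maximal cells on which the
  average of \<open>V\<close> exceeds \<open>t\<close>.\<close>

abbreviation "stop t \<equiv> first_cells a l (dense t)"

lemma cell_subset: "x \<in> Q\<^sub>0 \<Longrightarrow> cell n x \<subseteq> Q\<^sub>0"
  using dyadic_cell_antimono[of 0 n] dyadic_cell_eq[of x a l 0 a] by fastforce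

text \<open>\<open>small_sets\<close> speaks of closed cubes. A cell differs from its closed cube by
  a null set, and that cube stays inside \<open>cube a l\<close> because it is the closure of an
  open box contained in the cell.\<close>

lemma cell_small_sets:
  assumes "x \<in> Q\<^sub>0" "E \<in> sets lebesgue" "E \<subseteq> cell n x"
    and "2 * emeasure lebesgue E \<le> emeasure lebesgue (cell n x)"
  shows "density_on V E \<le> ennreal b * density_on V (cell n x)"
proof -
  define r where "r = l / 2 ^ n"
  have r: "0 < r" using side_pos by (simp add: r_def)
  obtain c where c: "cell n x \<subseteq> cube c r"
    "cube c r - cell n x \<in> null_sets lebesgue" "box c (c + r *\<^sub>R One) \<subseteq> cell n x"
    unfolding r_def by (rule dyadic_cell_cube[OF side_pos])
  have "box c (c + r *\<^sub>R One) \<subseteq> cube a l"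
    using c(3) cell_subset[OF assms(1)] dyadic_cell_0(2)[OF side_pos] by blast
  then have "closure (box c (c + r *\<^sub>R One)) \<subseteq> cube a l"
    by (intro closure_minimal) auto
  then have "cube c r \<subseteq> cube a l"
    using r by (subst (asm) closure_box) (auto simp: box_ne_empty inner_add_left)
  then have "density_on V E \<le> ennreal b * density_on V (cube c r)"
    using assms c r by (intro small_sets) (auto simp: dyadic_cell_emeasure[OF side_pos] r_def)
  then show ?thesis
    by (simp add: density_on_null[OF c(2,1)])
qed

lemma stop_sets: "stop t \<subseteq> sets lebesgue" "\<Union>(stop t) \<in> sets lebesgue"
  using first_cells_sets[OF side_pos] countable_first_cells by (blast intro: sets.countable_Union)+

lemma density_Union_cells:
  assumes "\<F> \<subseteq> first_cells a l P"
  shows "density_on V (\<Union>\<F>) = (\<integral>\<^sup>+R. density_on V R \<partial>count_space \<F>)"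
    and "emeasure lebesgue (\<Union>\<F>) = (\<integral>\<^sup>+R. emeasure lebesgue R \<partial>count_space \<F>)"
    and "\<Union>\<F> \<in> sets lebesgue"
proof -
  have *: "countable \<F>" "\<F> \<subseteq> sets lebesgue" "disjoint \<F>"
    using assms countable_first_cells first_cells_sets[OF side_pos, of a P] disjoint_first_cells
    by (meson countable_subset order_trans pairwise_subset)+
  show "density_on V (\<Union>\<F>) = (\<integral>\<^sup>+R. density_on V R \<partial>count_space \<F>)"
    by (rule density_on_Union[OF V_measurable *])
  show "emeasure lebesgue (\<Union>\<F>) = (\<integral>\<^sup>+R. emeasure lebesgue R \<partial>count_space \<F>)"
    by (rule emeasure_Union_lebesgue[OF *])
  show "\<Union>\<F> \<in> sets lebesgue"
    using * by (auto intro: sets.countable_Union)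
qed

lemma Q0_sets: "Q\<^sub>0 \<in> sets lebesgue"
  by (rule dyadic_cell_sets[OF side_pos])

text \<open>
  This replaces the Lebesgue differentiation theorem: the bad set is covered by cells inside a
  slightly larger open set, and none of these cells is dense.
\<close>

lemma density_off_stop:
  assumes "0 \<le> t"
  shows "AE x in lebesgue. x \<in> Q\<^sub>0 - \<Union>(stop t) \<longrightarrow> V x \<le> t"
proof -
  define E where "E = {x. t < V x} \<inter> Q\<^sub>0 - \<Union>(stop t)"
  have E: "E \<in> sets lebesgue"
  proof -
    have "{x \<in> space lebesgue. t < V x} \<in> sets lebesgue"
      by measurable
    then show ?thesis
      unfolding E_def using Q0_sets stop_sets(2) by auto
  qed
  have "emeasure lebesgue E \<le> emeasure lebesgue Q\<^sub>0"
    using Q0_sets by (intro emeasure_mono) (auto simp: E_def)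
  then have E_fin: "emeasure lebesgue E < \<infinity>"
    unfolding dyadic_cell_emeasure[OF side_pos] by (simp add: order.strict_trans1)
  have "density_on V E \<le> ennreal t * emeasure lebesgue E"
  proof (rule ennreal_le_epsilon)
    fix e :: real assume e: "0 < e"
    \<comment> \<open>The summand 1 covers the case \<open>t = 0\<close> and gives
      \<open>t * \<kappa> \<le> e\<close>.\<close>
    define \<kappa> where "\<kappa> = e / (t + 1)"
    have "0 < \<kappa>" using e assms by (simp add: \<kappa>_def)
    then obtain G where G: "open G" "E \<subseteq> G" "G - E \<in> lmeasurable" "emeasure lebesgue (G - E) < ennreal \<kappa>"
      using sets_lebesgue_outer_open[OF E] by metis
    define \<F> where "\<F> = {R \<in> first_cells a l (\<lambda>R. R \<subseteq> G). R \<inter> E \<noteq> {}}"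
    have \<F>: "\<F> \<subseteq> first_cells a l (\<lambda>R. R \<subseteq> G)"
      by (auto simp: \<F>_def)
    have cover: "E \<subseteq> \<Union>\<F>"
    proof
      fix x assume x: "x \<in> E"
      then have "x \<in> \<Union>(first_cells a l (\<lambda>R. R \<subseteq> G))"
        unfolding Union_first_cells using dyadic_cell_fine[OF side_pos G(1)] G(2)
        by (auto simp: E_def)
      then show "x \<in> \<Union>\<F>"
        using x by (auto simp: \<F>_def)
    qed
    have in_G: "\<Union>\<F> \<subseteq> G"
      by (auto simp: \<F>_def first_cells_def)
    have light: "density_on V R \<le> ennreal t * emeasure lebesgue R" if R: "R \<in> \<F>" for R
    proof -
      obtain z where z: "z \<in> R" "z \<in> E" using R by (auto simp: \<F>_def)
      have "R \<in> first_cells a l (\<lambda>R. R \<subseteq> G)" using R by (simp add: \<F>_def)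
      then obtain n where "R = cell n z" "z \<in> Q\<^sub>0"
        by (elim first_cellsE[OF _ z(1)])
      moreover have "z \<notin> \<Union>(stop t)" using z by (simp add: E_def)
      ultimately have "\<not> dense t R"
        unfolding Union_first_cells by blast
      then show ?thesis by (simp add: dense_def not_less)
    qed
    have "density_on V E \<le> density_on V (\<Union>\<F>)"
      by (rule density_on_mono[OF cover])
    also have "\<dots> = (\<integral>\<^sup>+R. density_on V R \<partial>count_space \<F>)"
      by (rule density_Union_cells[OF \<F>])
    also have "\<dots> \<le> (\<integral>\<^sup>+R. ennreal t * emeasure lebesgue R \<partial>count_space \<F>)"
      using light by (intro nn_integral_mono) auto
    also have "\<dots> = ennreal t * emeasure lebesgue (\<Union>\<F>)"
      by (simp add: nn_integral_cmult density_Union_cells[OF \<F>])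
    also have "\<dots> \<le> ennreal t * (emeasure lebesgue E + emeasure lebesgue (G - E))"
    proof (intro mult_left_mono)
      have "emeasure lebesgue (\<Union>\<F>) \<le> emeasure lebesgue (E \<union> (G - E))"
        using in_G E G(3) by (intro emeasure_mono sets.Un) auto
      also have "\<dots> = emeasure lebesgue E + emeasure lebesgue (G - E)"
        using E G(3) by (intro plus_emeasure[symmetric]) auto
      finally show "emeasure lebesgue (\<Union>\<F>) \<le> emeasure lebesgue E + emeasure lebesgue (G - E)" .
    qed simp
    also have "\<dots> \<le> ennreal t * emeasure lebesgue E + ennreal t * ennreal \<kappa>"
      unfolding distrib_left using G(4) by (intro add_left_mono mult_left_mono) auto
    also have "ennreal t * ennreal \<kappa> \<le> ennreal e"
      using e assms by (simp add: \<kappa>_def ennreal_mult[symmetric] field_simps ennreal_leI)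
    finally show "density_on V E \<le> ennreal t * emeasure lebesgue E + ennreal e"
      by (simp add: add_left_mono)
  qed
  moreover have "density_on V E
      = (\<integral>\<^sup>+x. ennreal t * indicator E x + ennreal (V x - t) * indicator E x \<partial>lebesgue)"
    unfolding density_on_def using assms V_nonneg
    by (intro nn_integral_cong) (auto simp: E_def indicator_def ennreal_plus[symmetric] simp del: ennreal_plus)
  then have "density_on V E
      = ennreal t * emeasure lebesgue E + (\<integral>\<^sup>+x. ennreal (V x - t) * indicator E x \<partial>lebesgue)"
    using E by (subst (asm) nn_integral_add) (auto simp: nn_integral_cmult_indicator)
  ultimately have "ennreal t * emeasure lebesgue E
      + (\<integral>\<^sup>+x. ennreal (V x - t) * indicator E x \<partial>lebesgue) \<le> ennreal t * emeasure lebesgue E + 0"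
    by simp
  moreover have "ennreal t * emeasure lebesgue E \<noteq> \<infinity>"
    using E_fin by (auto simp: ennreal_mult_eq_top_iff)
  ultimately have "(\<integral>\<^sup>+x. ennreal (V x - t) * indicator E x \<partial>lebesgue) = 0"
    unfolding ennreal_add_left_cancel_le by simp
  then have "AE x in lebesgue. ennreal (V x - t) * indicator E x = 0"
    using E by (subst (asm) nn_integral_0_iff_AE) auto
  then show ?thesis
    by eventually_elim (auto simp: E_def indicator_def split: if_splits)
qed

text \<open>The whole cube has average at most 1, hence at most \<open>t\<close>, so a selected cell
  has a parent. The parent was rejected and is \<open>2 ^ DIM('a)\<close> times as large.\<close>

lemma stop_parent_light:
  assumes "1 \<le> t" "R \<in> stop t"
  shows "density_on V R \<le> ennreal (2 ^ DIM('a) * t) * emeasure lebesgue R"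
proof -
  obtain n z where R: "R = cell n z" "dense t R" "\<And>m. m < n \<Longrightarrow> \<not> dense t (cell m z)" "z \<in> Q\<^sub>0"
    using assms(2) unfolding first_cells_def by blast
  have "density_on V Q\<^sub>0 \<le> density_on V (cube a l)"
    by (intro density_on_mono dyadic_cell_0 side_pos)
  also have "\<dots> \<le> emeasure lebesgue Q\<^sub>0"
    using density_le by (simp add: dyadic_cell_emeasure[OF side_pos])
  also have "\<dots> \<le> ennreal t * emeasure lebesgue Q\<^sub>0"
    using assms(1) by (metis ennreal_1 ennreal_leI mult.left_neutral mult_right_mono zero_le)
  finally have "\<not> dense t Q\<^sub>0" by (simp add: dense_def not_less)
  moreover have "cell 0 z = Q\<^sub>0" by (rule dyadic_cell_eq[OF R(4)])
  ultimately have "n \<noteq> 0" using R by metis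
  then obtain m where m: "n = Suc m" by (cases n) auto
  have "density_on V R \<le> density_on V (cell m z)"
    unfolding R(1) m by (intro density_on_mono dyadic_cell_Suc)
  also have "\<dots> \<le> ennreal t * emeasure lebesgue (cell m z)"
    using R(3)[of m] by (simp add: m dense_def not_less)
  also have "\<dots> = ennreal (2 ^ DIM('a) * t) * emeasure lebesgue R"
    using assms(1) side_pos
    by (simp add: R(1) m dyadic_cell_emeasure[OF side_pos] ennreal_mult[symmetric] power_divide power_mult_distrib)
  finally show ?thesis .
qed

text \<open>A cell that is dense at the larger height is dense at the smaller one, so through a
  common point the selection at height \<open>s\<close> happens no later.\<close>

lemma stop_subset:
  assumes "0 \<le> s" "s \<le> t" "T \<in> stop t" "R \<in> stop s" "T \<inter> R \<noteq> {}"
  shows "T \<subseteq> R"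
proof -
  obtain z where z: "z \<in> T" "z \<in> R" using assms(5) by blast
  obtain n where n: "T = cell n z" "dense t T"
    by (rule first_cellsE[OF assms(3) z(1)])
  obtain m where m: "R = cell m z" "\<And>k. k < m \<Longrightarrow> \<not> dense s (cell k z)"
    by (rule first_cellsE[OF assms(4) z(2)]) blast
  have "ennreal s * emeasure lebesgue T \<le> ennreal t * emeasure lebesgue T"
    using assms(2) by (intro mult_right_mono ennreal_leI) auto
  then have "dense s T" using n(2) by (auto simp: dense_def)
  then have "m \<le> n" using m(2)[of n] n(1) by (meson not_le)
  then show ?thesis unfolding n(1) m(1) by (rule dyadic_cell_antimono)
qed

lemma Union_stop_antimono:
  assumes "s \<le> t"
  shows "\<Union>(stop t) \<subseteq> \<Union>(stop s)"
proof -
  have "dense s R" if "dense t R" for R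
  proof -
    have "ennreal s * emeasure lebesgue R \<le> ennreal t * emeasure lebesgue R"
      using assms by (intro mult_right_mono ennreal_leI) auto
    then show ?thesis using that by (auto simp: dense_def)
  qed
  then show ?thesis unfolding Union_first_cells by blast
qed

text \<open>In the ratio of heights, \<open>2 ^ DIM('a)\<close> offsets the loss in
  \<open>stop_parent_light\<close>. The extra 2 leaves the new cells at most half the measure of
  each old cell, which is what \<open>small_sets\<close> asks for.\<close>

lemma density_stop_decay:
  assumes "1 \<le> t"
  shows "density_on V (\<Union>(stop (2 * 2 ^ DIM('a) * t))) \<le> ennreal b * density_on V (\<Union>(stop t))"
proof -
  define u where "u = 2 * 2 ^ DIM('a) * t"
  have tu: "t \<le> u"
  proof -
    have "1 * t \<le> 2 * 2 ^ DIM('a) * t"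
      using assms by (intro mult_right_mono) (auto intro: order_trans[OF _ mult_mono[of 1 2 1]])
    then show ?thesis by (simp add: u_def)
  qed
  have u0: "0 < u" using assms tu by linarith
  have small: "density_on V (\<Union>(stop u) \<inter> R) \<le> ennreal b * density_on V R" if R: "R \<in> stop t" for R
  proof -
    define \<F> where "\<F> = {T \<in> stop u. T \<subseteq> R}"
    have \<F>: "\<F> \<subseteq> stop u" by (auto simp: \<F>_def)
    have eq: "\<Union>(stop u) \<inter> R = \<Union>\<F>"
      using stop_subset[of t u _ R] R tu assms by (fastforce simp: \<F>_def)
    have "ennreal u * emeasure lebesgue (\<Union>\<F>) = (\<integral>\<^sup>+T. ennreal u * emeasure lebesgue T \<partial>count_space \<F>)"
      by (simp add: nn_integral_cmult density_Union_cells[OF \<F>])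
    also have "\<dots> \<le> (\<integral>\<^sup>+T. density_on V T \<partial>count_space \<F>)"
      by (intro nn_integral_mono) (auto simp: \<F>_def first_cells_def dense_def)
    also have "\<dots> = density_on V (\<Union>\<F>)"
      by (rule density_Union_cells(1)[OF \<F>, symmetric])
    also have "\<dots> \<le> density_on V R"
      by (intro density_on_mono) (auto simp: \<F>_def)
    also have "\<dots> \<le> ennreal (2 ^ DIM('a) * t) * emeasure lebesgue R"
      by (rule stop_parent_light[OF assms R])
    finally have "ennreal (2 ^ DIM('a) * t) * (2 * emeasure lebesgue (\<Union>\<F>))
        \<le> ennreal (2 ^ DIM('a) * t) * emeasure lebesgue R"
      using assms by (simp add: u_def ennreal_mult mult_ac)
    then have "2 * emeasure lebesgue (\<Union>\<F>) \<le> emeasure lebesgue R"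
      using assms by (subst (asm) ennreal_mult_le_mult_iff) auto
    moreover obtain n z where "R = cell n z" "z \<in> Q\<^sub>0"
      using R unfolding first_cells_def by blast
    ultimately show ?thesis
      unfolding eq using density_Union_cells(3)[OF \<F>]
      by (auto simp: \<F>_def intro!: cell_small_sets)
  qed
  have "density_on V (\<Union>(stop u)) = density_on V (\<Union>R\<in>stop t. \<Union>(stop u) \<inter> R)"
    using Union_stop_antimono[OF tu] by (intro arg_cong[of _ _ "density_on V"]) blast
  also have "\<dots> = (\<integral>\<^sup>+R. density_on V (\<Union>(stop u) \<inter> R) \<partial>count_space (stop t))"
    using disjoint_first_cells[of a l "dense t"] stop_sets(1)[of t] stop_sets(2)[of u]
    by (intro density_on_UN countable_first_cells)
      (auto simp: disjoint_family_on_def disjoint_def intro!: sets.Int)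
  also have "\<dots> \<le> (\<integral>\<^sup>+R. ennreal b * density_on V R \<partial>count_space (stop t))"
    using small by (intro nn_integral_mono) auto
  also have "\<dots> = ennreal b * density_on V (\<Union>(stop t))"
    by (simp add: nn_integral_cmult density_Union_cells[OF order_refl])
  finally show ?thesis by (simp add: u_def)
qed

lemma density_stop_power:
  "density_on V (\<Union>(stop ((2 * 2 ^ DIM('a)) ^ k))) \<le> ennreal (b ^ k) * ennreal (l ^ DIM('a))"
proof (induction k)
  case 0
  have "\<Union>(stop 1) \<subseteq> cube a l"
    unfolding Union_first_cells using dyadic_cell_0(2)[OF side_pos] by blast
  then have "density_on V (\<Union>(stop 1)) \<le> ennreal (l ^ DIM('a))"
    by (rule order_trans[OF density_on_mono density_le])
  then show ?case by simp
next
  case (Suc k)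
  have "density_on V (\<Union>(stop ((2 * 2 ^ DIM('a)) ^ Suc k)))
      \<le> ennreal b * density_on V (\<Union>(stop ((2 * 2 ^ DIM('a)) ^ k)))"
    unfolding power_Suc
    by (intro density_stop_decay one_le_power order_trans[OF _ mult_mono[of 1 2 1]]) auto
  also have "\<dots> \<le> ennreal b * (ennreal (b ^ k) * ennreal (l ^ DIM('a)))"
    by (intro mult_left_mono Suc.IH) auto
  finally show ?case
    using b_nonneg by (simp add: ennreal_mult mult.assoc)
qed

text \<open>Layers between successive powers of \<open>B\<close>: almost every point with
  \<open>V x > B ^ k\<close> lies in \<Omega> k, whose mass decays like \<open>b ^ k\<close>, while
  \<open>V powr \<epsilon>\<close> grows like \<open>(B powr \<epsilon>) ^ k\<close>. The resulting
  geometric series converges by \<open>small\<close>.\<close>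

lemma reverse_Hoelder:
  fixes \<epsilon> :: real
  defines "B \<equiv> (2 * 2 ^ DIM('a) :: real)"
  assumes eps: "0 < \<epsilon>" and small: "B powr \<epsilon> * b < 1"
  shows "density_on (\<lambda>x. V x powr (1 + \<epsilon>)) (cube a l)
           \<le> ennreal (1 + B powr \<epsilon> / (1 - B powr \<epsilon> * b)) * ennreal (l ^ DIM('a))"
proof -
  have B1: "1 < B"
    unfolding B_def by (rule less_le_trans[of _ 2]) auto
  define \<Omega> where "\<Omega> k = \<Union>(stop (B ^ k))" for k
  have \<Omega>_sets [measurable]: "\<Omega> k \<in> sets lebesgue" for k
    by (simp add: \<Omega>_def stop_sets)
  let ?f = "\<lambda>k x. ennreal (B powr \<epsilon> * (B powr \<epsilon>) ^ k) * (ennreal (V x) * indicator (\<Omega> k) x)"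
  have pw: "AE x in lebesgue. \<forall>k. x \<in> Q\<^sub>0 - \<Omega> k \<longrightarrow> V x \<le> B ^ k"
    unfolding AE_all_countable \<Omega>_def using B1 by (intro allI density_off_stop) simp
  have bound: "AE x in lebesgue. ennreal (V x powr (1 + \<epsilon>)) * indicator Q\<^sub>0 x
      \<le> indicator Q\<^sub>0 x + (\<Sum>k. ?f k x)"
    using pw
  proof eventually_elim
    fix x assume x: "\<forall>k. x \<in> Q\<^sub>0 - \<Omega> k \<longrightarrow> V x \<le> B ^ k"
    show "ennreal (V x powr (1 + \<epsilon>)) * indicator Q\<^sub>0 x \<le> indicator Q\<^sub>0 x + (\<Sum>k. ?f k x)"
    proof (cases "x \<in> Q\<^sub>0 \<and> 1 < V x")
      case False
      then have "V x powr (1 + \<epsilon>) \<le> 1" if "x \<in> Q\<^sub>0"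
        using that eps V_nonneg[of x] by (auto intro!: powr_le1)
      then have "ennreal (V x powr (1 + \<epsilon>)) * indicator Q\<^sub>0 x \<le> indicator Q\<^sub>0 x"
        by (auto simp: indicator_def)
      then show ?thesis by (rule order_trans) simp
    next
      case True
      \<comment> \<open>The layer of \<open>x\<close> is \<open>B ^ k < V x \<le> B ^ n\<close> with
        \<open>n = Suc k\<close>; \<open>n\<close> is positive because \<open>V x\<close> exceeds
        \<open>B ^ 0\<close>.\<close>
      define n where "n = (LEAST n. V x \<le> B ^ n)"
      have "\<exists>n. V x \<le> B ^ n"
        using real_arch_pow[OF B1, of "V x"] by (auto intro: less_imp_le)
      then have n: "V x \<le> B ^ n"
        unfolding n_def by (rule LeastI_ex)
      moreover have "n \<noteq> 0" using n True by (intro notI) simp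
      ultimately obtain k where k: "n = Suc k" by (cases n) auto
      have "\<not> V x \<le> B ^ k"
        using not_less_Least[of k "\<lambda>n. V x \<le> B ^ n"] k by (simp add: n_def)
      then have in_\<Omega>: "x \<in> \<Omega> k" using x True by blast
      have "V x powr (1 + \<epsilon>) = V x powr \<epsilon> * V x"
        using True by (simp add: powr_add)
      also have "V x powr \<epsilon> \<le> (B ^ n) powr \<epsilon>"
        using n True eps by (intro powr_mono2) auto
      also have "(B ^ n) powr \<epsilon> = (B powr \<epsilon>) ^ n"
        using B1 by (simp add: powr_realpow[symmetric] powr_powr mult.commute)
      finally have "V x powr (1 + \<epsilon>) \<le> B powr \<epsilon> * (B powr \<epsilon>) ^ k * V x"
        using True by (simp add: k)
      then have "ennreal (V x powr (1 + \<epsilon>)) * indicator Q\<^sub>0 x \<le> ?f k x"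
        using in_\<Omega> V_nonneg by (auto simp: indicator_def ennreal_mult[symmetric] ennreal_leI)
      also have "\<dots> \<le> (\<Sum>k. ?f k x)"
        using sum_le_suminf[of "\<lambda>k. ?f k x" "{k}"] by (simp add: summableI)
      finally show ?thesis by (simp add: add_increasing)
    qed
  qed
  let ?r = "B powr \<epsilon> * b"
  have Q: "density_on W Q\<^sub>0 = density_on W (cube a l)" for W
    using dyadic_cell_0[OF side_pos, of a] null_set_diff_box by (intro density_on_null) auto
  have "density_on (\<lambda>x. V x powr (1 + \<epsilon>)) Q\<^sub>0
      \<le> (\<integral>\<^sup>+x. indicator Q\<^sub>0 x + (\<Sum>k. ?f k x) \<partial>lebesgue)"
    unfolding density_on_def by (rule nn_integral_mono_AE[OF bound])
  also have "\<dots> = (\<integral>\<^sup>+x. indicator Q\<^sub>0 x \<partial>lebesgue) + (\<integral>\<^sup>+x. (\<Sum>k. ?f k x) \<partial>lebesgue)"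
    using Q0_sets by (intro nn_integral_add) auto
  also have "(\<integral>\<^sup>+x. (\<Sum>k. ?f k x) \<partial>lebesgue) = (\<Sum>k. \<integral>\<^sup>+x. ?f k x \<partial>lebesgue)"
    by (intro nn_integral_suminf) auto
  also have "\<dots> = (\<Sum>k. ennreal (B powr \<epsilon> * (B powr \<epsilon>) ^ k) * density_on V (\<Omega> k))"
    unfolding density_on_def by (intro suminf_cong nn_integral_cmult) auto
  also have "\<dots> \<le> (\<Sum>k. ennreal (B powr \<epsilon> * ?r ^ k) * ennreal (l ^ DIM('a)))"
  proof (intro suminf_le summableI)
    fix k
    have "ennreal (B powr \<epsilon> * (B powr \<epsilon>) ^ k) * density_on V (\<Omega> k)
        \<le> ennreal (B powr \<epsilon> * (B powr \<epsilon>) ^ k) * (ennreal (b ^ k) * ennreal (l ^ DIM('a)))"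
      using density_stop_power[of k] by (intro mult_left_mono) (auto simp: \<Omega>_def B_def)
    also have "\<dots> = ennreal (B powr \<epsilon> * ?r ^ k) * ennreal (l ^ DIM('a))"
      using b_nonneg by (simp add: ennreal_mult[symmetric] mult.assoc[symmetric] power_mult_distrib)
    finally show "ennreal (B powr \<epsilon> * (B powr \<epsilon>) ^ k) * density_on V (\<Omega> k)
        \<le> ennreal (B powr \<epsilon> * ?r ^ k) * ennreal (l ^ DIM('a))" .
  qed
  also have "\<dots> = ennreal (B powr \<epsilon> / (1 - ?r)) * ennreal (l ^ DIM('a))"
  proof -
    have "(\<lambda>k. B powr \<epsilon> * ?r ^ k) sums (B powr \<epsilon> * (1 / (1 - ?r)))"
      using b_nonneg small by (intro sums_mult geometric_sums) auto
    then have "(\<Sum>k. ennreal (B powr \<epsilon> * ?r ^ k)) = ennreal (B powr \<epsilon> / (1 - ?r))"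
      using b_nonneg by (intro suminf_ennreal_eq) auto
    then show ?thesis by simp
  qed
  also have "(\<integral>\<^sup>+x. indicator Q\<^sub>0 x \<partial>lebesgue) = ennreal (l ^ DIM('a))"
    using Q0_sets by (simp add: dyadic_cell_emeasure[OF side_pos])
  finally have "density_on (\<lambda>x. V x powr (1 + \<epsilon>)) Q\<^sub>0
     \<le> ennreal (l ^ DIM('a)) + ennreal (B powr \<epsilon> / (1 - ?r)) * ennreal (l ^ DIM('a))"
    by (simp add: add_left_mono)
  also have "\<dots> = ennreal (1 + B powr \<epsilon> / (1 - ?r)) * ennreal (l ^ DIM('a))"
    using small side_pos by (simp add: ennreal_mult[symmetric] ennreal_plus[symmetric] algebra_simps del: ennreal_plus)
  finally show ?thesis unfolding Q .
qed

end

section \<open>Self-improvement of a dual pair of weighted norms\<close>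

text \<open>With m the larger of the two terms on the right, A is at most m^(1/q) and C at most
  m^(1/s), so A C is at most m^\<alpha>. No sharp constant is sought.\<close>

lemma young_powr:
  fixes A C q s \<alpha> :: real
  assumes "0 < A" "0 < C" "1 \<le> q" "1 \<le> s" "1 / q + 1 / s = \<alpha>"
  shows "(A * C) powr (1 / \<alpha>) \<le> A powr q + C powr s"
proof -
  have pos: "0 < 1 / q" "0 < 1 / s" "0 < \<alpha>"
    using assms by (auto simp: assms(5)[symmetric] intro!: add_pos_pos)
  define m where "m = max (A powr q) (C powr s)"
  have m: "0 < m" using assms by (simp add: m_def less_max_iff_disj)
  have "A = (A powr q) powr (1 / q)" "C = (C powr s) powr (1 / s)"
    using assms by (simp_all add: powr_powr)
  then have "A \<le> m powr (1 / q)" "C \<le> m powr (1 / s)"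
    using pos by (metis m_def max.cobounded1 max.cobounded2 powr_ge_zero powr_mono2 less_imp_le)+
  then have "A * C \<le> m powr (1 / q) * m powr (1 / s)"
    using assms by (intro mult_mono) auto
  also have "\<dots> = m powr \<alpha>"
    by (simp add: powr_add[symmetric] assms(5))
  finally have "(A * C) powr (1 / \<alpha>) \<le> (m powr \<alpha>) powr (1 / \<alpha>)"
    using pos assms by (intro powr_mono2) auto
  also have "\<dots> = m" using pos m by (simp add: powr_powr)
  also have "m \<le> A powr q + C powr s" by (simp add: m_def)
  finally show ?thesis .
qed

lemma powr_eventually_small:
  fixes P \<beta> :: real
  assumes "1 < P" "0 < \<beta>" "\<beta> < 1"
  shows "\<exists>\<epsilon>>0. P powr \<epsilon> * \<beta> < 1"
proof (intro exI conjI)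
  \<comment> \<open>With this exponent the product is the square root of \<beta>.\<close>
  let ?e = "- ln \<beta> / (2 * ln P)"
  show "0 < ?e" using assms by (intro divide_pos_pos) auto
  have "P powr ?e * \<beta> = exp (- ln \<beta> / 2) * exp (ln \<beta>)"
    using assms by (simp add: powr_def)
  also have "\<dots> = exp (ln \<beta> / 2)" by (simp add: exp_add[symmetric])
  also have "\<dots> < 1" using assms by simp
  finally show "P powr ?e * \<beta> < 1" .
qed

section \<open>Norms of a weight and of its inverse on cubes\<close>

text \<open>\<open>N Q\<close> and \<open>M Q\<close> stand for the norm of w on Q with exponent
  \<open>q\<close> and of 1/w on Q with exponent \<open>s\<close>. The norms enter only through
  these axioms: positivity, unit balls attained, minimality of \<open>N\<close>, and the weight
  condition \<open>NM_le\<close>. Log-Hoelder regularity is a single constant \<open>H\<close>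
  bounding products, which avoids division by logarithms.\<close>

locale dual_weight_pair =
  fixes q s w :: "'a::euclidean_space \<Rightarrow> real" and N M :: "'a set \<Rightarrow> real" and \<alpha> K B H :: real
  assumes q_measurable [measurable]: "q \<in> borel_measurable lebesgue"
    and s_measurable [measurable]: "s \<in> borel_measurable lebesgue"
    and w_measurable [measurable]: "w \<in> borel_measurable lebesgue"
    and w_pos: "0 < w x"
    and q_ge: "1 \<le> q x" and q_le: "q x \<le> B"
    and s_ge: "1 \<le> s x"
    and dual: "1 / q x + 1 / s x = \<alpha>"
    and N_pos: "0 < r \<Longrightarrow> 0 < N (cube c r)"
    and M_pos: "0 < r \<Longrightarrow> 0 < M (cube c r)"
    and N_ball: "0 < r \<Longrightarrow> density_on (\<lambda>x. (w x / N (cube c r)) powr q x) (cube c r) \<le> 1"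
    and M_ball: "0 < r \<Longrightarrow> density_on (\<lambda>x. (1 / (w x * M (cube c r))) powr s x) (cube c r) \<le> 1"
    and N_least: "\<lbrakk>0 < r; 0 < t; density_on (\<lambda>x. (w x / t) powr q x) (cube c r) \<le> 1\<rbrakk>
      \<Longrightarrow> N (cube c r) \<le> t"
    and NM_le: "0 < r \<Longrightarrow> N (cube c r) * M (cube c r) \<le> K * (r ^ DIM('a)) powr \<alpha>"
    and osc_near: "\<lbrakk>0 < norm (x - y); norm (x - y) < 1 / 2\<rbrakk> \<Longrightarrow> \<bar>q x - q y\<bar> * - ln (norm (x - y)) \<le> H"
    and osc_far: "norm x \<le> norm y \<Longrightarrow> \<bar>q x - q y\<bar> * ln (exp 1 + norm x) \<le> H"
begin

lemma alpha_pos: "0 < \<alpha>"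
  using q_ge[of undefined] s_ge[of undefined] unfolding dual[of undefined, symmetric]
  by (intro add_pos_pos) auto

lemma B_ge: "1 \<le> B"
  using q_ge[of undefined] q_le[of undefined] by linarith

lemma K_pos: "0 < K"
proof -
  have "0 < N (cube 0 1) * M (cube 0 1)" by (intro mult_pos_pos N_pos M_pos) simp_all
  then have "0 < K * (1 ^ DIM('a)) powr \<alpha>" using NM_le[of 1 0] by linarith
  then show ?thesis by simp
qed

text \<open>Pointwise Young for 1 / (n m) written as (w / (n t)) (t / (w m)). A small
  \<open>t\<close> suppresses the dual term, since \<open>s\<close> is at least 1, and costs at most
  \<open>t powr (- B)\<close> on the other, since \<open>q\<close> is at most
  \<open>B\<close>.\<close>

lemma mass_lower:
  assumes E: "E \<in> sets lebesgue" and "0 < n" "0 < m" "0 < t" "t \<le> 1"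
  shows "ennreal ((n * m) powr (- 1 / \<alpha>)) * emeasure lebesgue E
    \<le> ennreal (t powr (- B)) * density_on (\<lambda>x. (w x / n) powr q x) E
      + ennreal t * density_on (\<lambda>x. (1 / (w x * m)) powr s x) E"
proof -
  have pw: "(n * m) powr (- 1 / \<alpha>)
      \<le> t powr (- B) * (w x / n) powr q x + t * (1 / (w x * m)) powr s x" for x
  proof -
    have "(w x / n / t) * (t * (1 / (w x * m))) = inverse (n * m)"
      using assms w_pos[of x] by (simp add: field_simps)
    moreover have "(n * m) powr (- 1 / \<alpha>) = inverse (n * m) powr (1 / \<alpha>)"
      using assms by (simp only: inverse_powr minus_divide_left[symmetric] powr_minus)
    ultimately have "(n * m) powr (- 1 / \<alpha>) = ((w x / n / t) * (t * (1 / (w x * m)))) powr (1 / \<alpha>)"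
      by simp
    also have "\<dots> \<le> (w x / n / t) powr q x + (t * (1 / (w x * m))) powr s x"
      using assms w_pos q_ge s_ge dual by (intro young_powr) auto
    also have "(w x / n / t) powr q x = (w x / n) powr q x * t powr (- q x)"
      using assms w_pos[of x] by (simp add: powr_divide powr_mult powr_minus_divide)
    also have "t powr (- q x) \<le> t powr (- B)"
      using assms q_le[of x] by (intro powr_mono') auto
    also have "(t * (1 / (w x * m))) powr s x = t powr s x * (1 / (w x * m)) powr s x"
      using assms w_pos[of x] by (intro powr_mult)
    also have "t powr s x \<le> t"
      using powr_mono'[of 1 "s x" t] assms s_ge[of x] by simp
    finally show ?thesis
      by (simp add: mult_right_mono mult_left_mono mult.commute)
  qed
  have "ennreal ((n * m) powr (- 1 / \<alpha>)) * emeasure lebesgue E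
      = density_on (\<lambda>_. (n * m) powr (- 1 / \<alpha>)) E"
    by (rule density_on_const[OF E, symmetric])
  also have "\<dots> \<le> density_on (\<lambda>x. t powr (- B) * (w x / n) powr q x + t * (1 / (w x * m)) powr s x) E"
    using pw by (rule density_on_mono_fun)
  also have "\<dots> = density_on (\<lambda>x. t powr (- B) * (w x / n) powr q x) E
      + density_on (\<lambda>x. t * (1 / (w x * m)) powr s x) E"
    using E assms by (intro density_on_add) auto
  also have "\<dots> = ennreal (t powr (- B)) * density_on (\<lambda>x. (w x / n) powr q x) E
      + ennreal t * density_on (\<lambda>x. (1 / (w x * m)) powr s x) E"
    using E assms by (simp add: density_on_cmult)
  finally show ?thesis .
qed

lemma N_mono:
  assumes "0 < r" "0 < l" "cube c r \<subseteq> cube a l"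
  shows "N (cube c r) \<le> N (cube a l)"
  using assms by (intro N_least N_pos order_trans[OF density_on_mono N_ball]) auto

text \<open>Doubling for the norms. \<open>mass_lower\<close> at \<open>t = 1\<close> on the small
  cube, with \<open>N\<close> of the small and \<open>M\<close> of the large cube, bounds r^d by 2
  (N M)^(1/\<alpha>); the weight condition on the large cube then eliminates
  \<open>M\<close>.\<close>

lemma N_lower:
  assumes "0 < r" "0 < l" "cube c r \<subseteq> cube a l"
  shows "N (cube a l) \<le> K * (2 * (l / r) ^ DIM('a)) powr \<alpha> * N (cube c r)"
proof -
  let ?n = "N (cube c r)" and ?m = "M (cube a l)"
  have nm: "0 < ?n" "0 < ?m" using assms N_pos M_pos by auto
  have "ennreal ((?n * ?m) powr (- 1 / \<alpha>)) * ennreal (r ^ DIM('a)) \<le>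
     ennreal (1 powr (- B)) * density_on (\<lambda>x. (w x / ?n) powr q x) (cube c r)
      + ennreal 1 * density_on (\<lambda>x. (1 / (w x * ?m)) powr s x) (cube c r)"
    using mass_lower[of "cube c r" ?n ?m 1] nm by (simp add: emeasure_cube[OF assms(1)])
  also have "\<dots> \<le> 1 + 1"
    using order_trans[OF density_on_mono[OF assms(3)] M_ball[OF assms(2)]] N_ball[OF assms(1)]
    by (intro add_mono) auto
  finally have "ennreal ((?n * ?m) powr (- 1 / \<alpha>) * r ^ DIM('a)) \<le> ennreal 2"
    using assms by (simp add: ennreal_mult)
  then have "(?n * ?m) powr (- 1 / \<alpha>) * r ^ DIM('a) \<le> 2"
    by (simp only: ennreal_le_iff)
  then have "r ^ DIM('a) \<le> 2 * (?n * ?m) powr (1 / \<alpha>)"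
    using nm by (simp add: powr_minus_divide field_simps)
  then have "(r ^ DIM('a)) powr \<alpha> \<le> (2 * (?n * ?m) powr (1 / \<alpha>)) powr \<alpha>"
    using alpha_pos assms by (intro powr_mono2) auto
  also have "\<dots> = 2 powr \<alpha> * (?n * ?m)"
    using alpha_pos nm by (simp add: powr_mult powr_powr)
  finally have 1: "(r ^ DIM('a)) powr \<alpha> \<le> 2 powr \<alpha> * (?n * ?m)" .
  have "N (cube a l) * ?m * (r ^ DIM('a)) powr \<alpha> \<le> K * (l ^ DIM('a)) powr \<alpha> * (2 powr \<alpha> * (?n * ?m))"
    using K_pos by (intro mult_mono[OF NM_le[OF assms(2), of a] 1]) auto
  then have "N (cube a l) * (r ^ DIM('a)) powr \<alpha> \<le> K * (l ^ DIM('a)) powr \<alpha> * 2 powr \<alpha> * ?n"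
    using nm by (simp add: mult_ac)
  then show ?thesis
    using assms by (simp add: powr_mult powr_divide power_divide field_simps)
qed

text \<open>On a set of half measure the weight condition makes the left side of
  \<open>mass_lower\<close> at least \<open>2 * t\<^sub>1\<close>, while at
  \<open>t = t\<^sub>1\<close> the dual term absorbs only \<open>t\<^sub>1\<close>. What remains
  forces mass \<open>t\<^sub>1 powr (B + 1)\<close>, which is \<open>c\<^sub>1\<close>.\<close>

definition "t\<^sub>1 = K powr (- 1 / \<alpha>) / 4"

definition "c\<^sub>1 = t\<^sub>1 powr (B + 1)"

lemma t1: "0 < t\<^sub>1" "t\<^sub>1 \<le> 1 / 2"
proof -
  show "0 < t\<^sub>1" using K_pos by (simp add: t\<^sub>1_def)
  \<comment> \<open>Comparing the unit cube with itself in \<open>N_lower\<close> bounds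
    \<open>K\<close> from below.\<close>
  have "1 \<le> K * 2 powr \<alpha>"
    using N_lower[of 1 1 0 0] N_pos[of 1 0] by simp
  then have "1 powr (1 / \<alpha>) \<le> (K * 2 powr \<alpha>) powr (1 / \<alpha>)"
    using alpha_pos by (intro powr_mono2) auto
  also have "\<dots> = 2 * K powr (1 / \<alpha>)"
    using alpha_pos K_pos by (simp add: powr_mult powr_powr)
  finally have "K powr (- 1 / \<alpha>) \<le> 2"
    using K_pos by (simp add: powr_minus_divide field_simps)
  then show "t\<^sub>1 \<le> 1 / 2" by (simp add: t\<^sub>1_def)
qed

lemma c1: "0 < c\<^sub>1" "c\<^sub>1 \<le> 1 / 2"
proof -
  show "0 < c\<^sub>1" using t1 by (simp add: c\<^sub>1_def)
  have "c\<^sub>1 \<le> t\<^sub>1 powr 1"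
    unfolding c\<^sub>1_def using t1 B_ge by (intro powr_mono') auto
  then show "c\<^sub>1 \<le> 1 / 2" using t1 by simp
qed

lemma mass_half:
  assumes "0 < l" "E \<in> sets lebesgue" "E \<subseteq> cube a l" "ennreal (l ^ DIM('a)) \<le> 2 * emeasure lebesgue E"
  shows "ennreal c\<^sub>1 \<le> density_on (\<lambda>x. (w x / N (cube a l)) powr q x) E"
proof -
  let ?n = "N (cube a l)" and ?m = "M (cube a l)"
  let ?v = "density_on (\<lambda>x. (w x / ?n) powr q x) E"
  have nm: "0 < ?n" "0 < ?m" using assms N_pos M_pos by auto
  have v1: "?v \<le> 1"
    by (rule order_trans[OF density_on_mono[OF assms(3)] N_ball[OF assms(1)]])
  then have "?v < \<infinity>" by (rule order.strict_trans1) simp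
  then obtain v where v: "?v = ennreal v" "0 \<le> v"
    by (cases ?v) auto
  have "emeasure lebesgue E \<le> emeasure lebesgue (cube a l)"
    using assms by (intro emeasure_mono) auto
  then obtain e where e: "emeasure lebesgue E = ennreal e" "0 \<le> e"
    unfolding emeasure_cube[OF assms(1)] by (cases "emeasure lebesgue E") (auto simp: top_unique)
  have le: "l ^ DIM('a) \<le> 2 * e"
  proof -
    have "ennreal (l ^ DIM('a)) \<le> ennreal (2 * e)"
      using assms(4) e by (simp add: ennreal_mult)
    then show ?thesis using e by simp
  qed
  have "4 * t\<^sub>1 = (K * (l ^ DIM('a)) powr \<alpha>) powr (- 1 / \<alpha>) * l ^ DIM('a)"
    using alpha_pos assms K_pos
    by (simp add: t\<^sub>1_def powr_mult powr_powr powr_minus field_simps)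
  also have "\<dots> \<le> (?n * ?m) powr (- 1 / \<alpha>) * (2 * e)"
  proof (intro mult_mono)
    show "(K * (l ^ DIM('a)) powr \<alpha>) powr (- 1 / \<alpha>) \<le> (?n * ?m) powr (- 1 / \<alpha>)"
      using NM_le[OF assms(1), of a] nm alpha_pos by (intro powr_mono2') auto
  qed (use le assms in auto)
  finally have 1: "2 * t\<^sub>1 \<le> (?n * ?m) powr (- 1 / \<alpha>) * e" by (simp add: mult.commute)
  have "ennreal ((?n * ?m) powr (- 1 / \<alpha>)) * ennreal e
      \<le> ennreal (t\<^sub>1 powr (- B)) * ennreal v + ennreal t\<^sub>1 * density_on (\<lambda>x. (1 / (w x * ?m)) powr s x) E"
    using mass_lower[OF assms(2) nm t1(1)] t1 by (simp add: e v)
  also have "\<dots> \<le> ennreal (t\<^sub>1 powr (- B)) * ennreal v + ennreal t\<^sub>1 * 1"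
    by (intro add_left_mono mult_left_mono order_trans[OF density_on_mono[OF assms(3)] M_ball[OF assms(1)]]) auto
  also have "\<dots> = ennreal (t\<^sub>1 powr (- B) * v + t\<^sub>1)"
    using v t1 by (simp add: ennreal_mult)
  finally have "ennreal ((?n * ?m) powr (- 1 / \<alpha>) * e) \<le> ennreal (t\<^sub>1 powr (- B) * v + t\<^sub>1)"
    using e by (simp add: ennreal_mult)
  then have "(?n * ?m) powr (- 1 / \<alpha>) * e \<le> t\<^sub>1 powr (- B) * v + t\<^sub>1"
    using v t1 by (subst (asm) ennreal_le_iff) auto
  with 1 have "t\<^sub>1 \<le> t\<^sub>1 powr (- B) * v" by simp
  then have "t\<^sub>1 powr B * t\<^sub>1 \<le> t\<^sub>1 powr B * (t\<^sub>1 powr (- B) * v)"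
    by (intro mult_left_mono) auto
  then have "c\<^sub>1 \<le> v"
    using t1 by (simp add: c\<^sub>1_def powr_add powr_minus field_simps)
  then show ?thesis using v by (simp add: ennreal_leI)
qed

text \<open>The root of order \<open>B\<close> makes \<open>\<rho> powr q x\<close> at least
  \<open>1 - c\<^sub>1\<close> at every point.\<close>

definition "\<rho> = (1 - c\<^sub>1) powr (1 / B)"

lemma rho: "0 < \<rho>" "\<rho> < 1"
proof -
  show "0 < \<rho>" using c1 by (simp add: \<rho>_def)
  have "(1 - c\<^sub>1) powr (1 / B) < 1 powr (1 / B)"
    using c1 B_ge by (intro powr_less_mono2) auto
  then show "\<rho> < 1" by (simp add: \<rho>_def)
qed

text \<open>By \<open>mass_half\<close> the rest of the large cube keeps mass
  \<open>c\<^sub>1\<close>, so at most \<open>1 - c\<^sub>1\<close> is left on the small one.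
  Shrinking the norm by \<rho> raises this to at most 1, and \<open>N_least\<close> applies.\<close>

lemma N_contract:
  assumes "0 < r" "0 < l" "cube c r \<subseteq> cube a l" "2 * r ^ DIM('a) \<le> l ^ DIM('a)"
  shows "N (cube c r) \<le> \<rho> * N (cube a l)"
proof (rule N_least[OF assms(1)])
  let ?V = "\<lambda>x. (w x / N (cube a l)) powr q x"
  have N: "0 < N (cube a l)" by (rule N_pos[OF assms(2)])
  show "0 < \<rho> * N (cube a l)" using N rho by simp
  let ?E = "cube a l - cube c r"
  have "2 * emeasure lebesgue (cube c r) \<le> ennreal (l ^ DIM('a))"
    unfolding emeasure_cube[OF assms(1)]
    using ennreal_leI[OF assms(4)] assms(1) by (simp add: ennreal_mult)
  then have "ennreal (l ^ DIM('a)) \<le> 2 * emeasure lebesgue ?E"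
    using assms(2,3) by (intro cube_complement_half) auto
  then have "ennreal c\<^sub>1 \<le> density_on ?V ?E"
    using assms by (intro mass_half) auto
  then have "ennreal c\<^sub>1 + density_on ?V (cube c r) \<le> density_on ?V ?E + density_on ?V (cube c r)"
    by (rule add_right_mono)
  also have "\<dots> = density_on ?V (?E \<union> cube c r)"
    by (intro density_on_Un[symmetric]) auto
  also have "?E \<union> cube c r = cube a l" using assms(3) by blast
  also have "density_on ?V (cube a l) \<le> 1" by (rule N_ball[OF assms(2)])
  also have "1 = ennreal c\<^sub>1 + ennreal (1 - c\<^sub>1)"
    using c1 by (simp add: ennreal_plus[symmetric] del: ennreal_plus)
  finally have 1: "density_on ?V (cube c r) \<le> ennreal (1 - c\<^sub>1)"
    by (simp add: ennreal_add_left_cancel_le)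
  have pw: "(w x / (\<rho> * N (cube a l))) powr q x \<le> 1 / (1 - c\<^sub>1) * ?V x" for x
  proof -
    have "(w x / (\<rho> * N (cube a l))) powr q x = ?V x / \<rho> powr q x"
      using N w_pos[of x] rho by (simp add: powr_divide powr_mult field_simps)
    also have "\<dots> \<le> ?V x / \<rho> powr B"
      using rho q_le[of x] by (intro divide_left_mono powr_mono') auto
    also have "\<rho> powr B = 1 - c\<^sub>1"
      using c1 B_ge by (simp add: \<rho>_def powr_powr)
    finally show ?thesis by simp
  qed
  have "density_on (\<lambda>x. (w x / (\<rho> * N (cube a l))) powr q x) (cube c r)
      \<le> density_on (\<lambda>x. 1 / (1 - c\<^sub>1) * ?V x) (cube c r)"
    using pw by (rule density_on_mono_fun)
  also have "\<dots> = ennreal (1 / (1 - c\<^sub>1)) * density_on ?V (cube c r)"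
    using c1 by (intro density_on_cmult) auto
  also have "\<dots> \<le> ennreal (1 / (1 - c\<^sub>1)) * ennreal (1 - c\<^sub>1)"
    using 1 by (rule mult_left_mono) simp
  also have "\<dots> = 1"
    using c1 by (subst ennreal_mult[symmetric]) auto
  finally show "density_on (\<lambda>x. (w x / (\<rho> * N (cube a l))) powr q x) (cube c r) \<le> 1" .
qed

section \<open>Cubes on which the oscillation of the exponent is controlled\<close>

text \<open>The distance \<open>l / 2\<close> is exactly what the non-central cubes of a ternary
  subdivision of a cube centred at 0 attain.\<close>

definition "good a l \<longleftrightarrow> 0 < l \<and> (l \<le> 1 \<or> (\<forall>x\<in>cube a l. l / 2 \<le> norm x))"

definition "H' = 2 * \<bar>H\<bar> + 3 * B * ln (2 * DIM('a))"

text \<open>Split ln (l / r) into ln l and - ln r. The first is nonpositive or paid for by decay at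
  infinity, the second by the local condition, as points of the subcube are within d r of each
  other. In \<open>H'\<close> the first part accounts for one term
  \<open>B * ln (2 * DIM('a))\<close> and the second for two, besides \<open>\<bar>H\<bar>\<close>
  each.\<close>

lemma good_osc:
  assumes "good a l" "0 < r" "cube c r \<subseteq> cube a l" "x \<in> cube c r" "y \<in> cube c r"
  shows "\<bar>q x - q y\<bar> * ln (l / r) \<le> H'"
proof -
  let ?o = "\<bar>q x - q y\<bar>" and ?d = "real DIM('a)"
  have l: "0 < l" using assms(1) by (simp add: good_def)
  have d: "1 \<le> ?d" using DIM_positive[where 'a='a] by linarith
  have o: "?o \<le> B" using q_ge[of x] q_ge[of y] q_le[of x] q_le[of y] by linarith
  have ln2d: "ln 2 \<le> ln (2 * ?d)" "ln ?d \<le> ln (2 * ?d)" "0 \<le> ln ?d" "0 \<le> ln (2::real)"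
    using d by auto
  have nonneg: "0 \<le> B * ln (2 * ?d)" using B_ge ln2d by (intro mult_nonneg_nonneg) linarith+
  have 1: "?o * ln l \<le> \<bar>H\<bar> + B * ln (2 * ?d)"
  proof (cases "l \<le> 1")
    case True
    then have "?o * ln l \<le> 0" using l by (intro mult_nonneg_nonpos) auto
    then show ?thesis using nonneg by linarith
  next
    case False
    then have far: "l / 2 \<le> norm x" "l / 2 \<le> norm y"
      using assms by (auto simp: good_def)
    have *: "\<bar>q x' - q y'\<bar> * ln (exp 1 + l / 2) \<le> H"
      if "norm x' \<le> norm y'" "l / 2 \<le> norm x'" for x' y'
    proof -
      have "\<bar>q x' - q y'\<bar> * ln (exp 1 + l / 2) \<le> \<bar>q x' - q y'\<bar> * ln (exp 1 + norm x')"
        using that l by (intro mult_left_mono ln_mono add_mono) (auto intro: add_pos_pos)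
      then show ?thesis using osc_far[OF that(1)] by linarith
    qed
    have **: "?o * ln (exp 1 + l / 2) \<le> H"
      using *[of x y] *[of y x] far by (cases "norm x \<le> norm y") (auto simp: abs_minus_commute)
    have "ln l \<le> ln (2 * (exp 1 + l / 2))"
      using l by (intro ln_mono) (auto intro: add_pos_pos)
    also have "\<dots> = ln 2 + ln (exp 1 + l / 2)"
      using l add_pos_pos[of "exp 1" "l / 2"] by (subst ln_mult) auto
    finally have "?o * ln l \<le> ?o * (ln 2 + ln (exp 1 + l / 2))"
      by (intro mult_left_mono) auto
    also have "\<dots> = ?o * ln 2 + ?o * ln (exp 1 + l / 2)" by (simp add: distrib_left)
    also have "?o * ln 2 \<le> B * ln (2 * ?d)"
      using o ln2d B_ge by (intro mult_mono) auto
    finally show ?thesis using ** by linarith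
  qed
  have 2: "?o * - ln r \<le> \<bar>H\<bar> + 2 * (B * ln (2 * ?d))"
  proof (cases "x = y")
    case True
    then show ?thesis using nonneg by simp
  next
    case ne: False
    have nr: "norm (x - y) \<le> ?d * r" by (rule cube_dist[OF assms(4,5)])
    show ?thesis
    proof (cases "norm (x - y) < 1 / 2")
      case True
      have "ln (norm (x - y)) \<le> ln (?d * r)" using nr ne by (intro ln_mono) auto
      then have "- ln r \<le> - ln (norm (x - y)) + ln ?d"
        using d assms(2) by (simp add: ln_mult)
      then have "?o * - ln r \<le> ?o * (- ln (norm (x - y)) + ln ?d)"
        by (intro mult_left_mono) auto
      also have "\<dots> = ?o * - ln (norm (x - y)) + ?o * ln ?d" by (simp add: algebra_simps)
      also have "?o * - ln (norm (x - y)) \<le> H"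
        using osc_near[of x y] ne True by simp
      also have "?o * ln ?d \<le> B * ln (2 * ?d)"
        using o ln2d B_ge by (intro mult_mono) auto
      finally show ?thesis using nonneg by linarith
    next
      case False
      \<comment> \<open>Points at distance at least 1/2 force \<open>r\<close> to be bounded below,
        so the trivial bound \<open>B\<close> on the oscillation suffices.\<close>
      then have "1 / (2 * ?d) \<le> r" using nr d by (simp add: field_simps)
      then have "ln (1 / (2 * ?d)) \<le> ln r" using d assms(2) by (intro ln_mono) auto
      then have "- ln r \<le> ln (2 * ?d)" using d by (simp add: ln_div)
      then have "?o * - ln r \<le> ?o * ln (2 * ?d)" by (intro mult_left_mono) auto
      also have "\<dots> \<le> B * ln (2 * ?d)" using o ln2d by (intro mult_right_mono) linarith+
      finally show ?thesis using nonneg by linarith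
    qed
  qed
  have "?o * ln (l / r) = ?o * ln l + ?o * - ln r"
    using l assms(2) by (simp add: ln_div algebra_simps)
  then show ?thesis using 1 2 by (simp add: H'_def)
qed

definition "D = exp (B * \<bar>ln K + \<alpha> * ln 2\<bar> + \<alpha> * DIM('a) * H')"

text \<open>\<open>N_lower\<close> bounds - ln \<tau> by a constant plus \<alpha> d ln (l / r).
  Times the oscillation of \<open>q\<close>, the constant is paid for by \<open>B\<close> and the
  logarithm by \<open>good_osc\<close>; \<open>D\<close> is the exponential of the sum.\<close>

lemma ratio_osc:
  assumes "good a l" "0 < r" "cube c r \<subseteq> cube a l" "x \<in> cube c r" "y \<in> cube c r"
  defines "\<tau> \<equiv> N (cube c r) / N (cube a l)"
  shows "\<tau> powr q x \<le> D * \<tau> powr q y"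
proof -
  let ?o = "\<bar>q x - q y\<bar>"
  have l: "0 < l" using assms(1) by (simp add: good_def)
  have rl: "r \<le> l" by (rule cube_subset_side[OF assms(2,3)])
  have Np: "0 < N (cube c r)" "0 < N (cube a l)" using N_pos l assms(2) by auto
  then have tau: "0 < \<tau>" by (simp add: \<tau>_def)
  have "1 / \<tau> \<le> K * (2 * (l / r) ^ DIM('a)) powr \<alpha>"
    using N_lower[OF assms(2) l assms(3)] Np by (simp add: \<tau>_def field_simps)
  then have "ln (1 / \<tau>) \<le> ln (K * (2 * (l / r) ^ DIM('a)) powr \<alpha>)"
    using tau by (intro ln_mono) auto
  also have "\<dots> = ln K + \<alpha> * (ln 2 + DIM('a) * ln (l / r))"
    using K_pos l assms(2) by (simp add: ln_mult ln_powr ln_realpow)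
  finally have lnt: "- ln \<tau> \<le> (ln K + \<alpha> * ln 2) + \<alpha> * DIM('a) * ln (l / r)"
    using tau by (simp add: ln_div algebra_simps)
  have "\<tau> \<le> 1" using N_mono[OF assms(2) l assms(3)] Np by (simp add: \<tau>_def)
  then have lnt0: "ln \<tau> \<le> 0" using tau by simp
  have o: "?o \<le> B" using q_ge[of x] q_ge[of y] q_le[of x] q_le[of y] by linarith
  have "(q x - q y) * ln \<tau> = - (q x - q y) * - ln \<tau>" by (simp add: algebra_simps)
  also have "\<dots> \<le> ?o * - ln \<tau>"
    using lnt0 by (intro mult_right_mono) auto
  also have "\<dots> \<le> ?o * (\<bar>ln K + \<alpha> * ln 2\<bar> + \<alpha> * DIM('a) * ln (l / r))"
    using lnt by (intro mult_left_mono) auto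
  also have "\<dots> = ?o * \<bar>ln K + \<alpha> * ln 2\<bar> + \<alpha> * DIM('a) * (?o * ln (l / r))"
    by (simp add: algebra_simps)
  also have "\<dots> \<le> B * \<bar>ln K + \<alpha> * ln 2\<bar> + \<alpha> * DIM('a) * H'"
    using good_osc[OF assms(1-5)] o alpha_pos by (intro add_mono mult_right_mono mult_left_mono) auto
  finally have "exp ((q x - q y) * ln \<tau>) \<le> D" by (simp add: D_def)
  then have "exp ((q x - q y) * ln \<tau>) * exp (q y * ln \<tau>) \<le> D * exp (q y * ln \<tau>)"
    by (intro mult_right_mono) auto
  then show ?thesis
    using tau by (simp add: powr_def exp_add[symmetric] algebra_simps)
qed


definition "V Q x = (w x / N Q) powr q x"

lemma V_measurable [measurable]: "V Q \<in> borel_measurable lebesgue"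
  unfolding V_def by measurable

lemma V_nonneg: "0 \<le> V Q x"
  by (simp add: V_def)

lemma D_ge: "1 \<le> D"
proof -
  have "0 \<le> ln (2 * real DIM('a))" using DIM_positive[where 'a='a] by (intro ln_ge_zero) linarith
  then have "0 \<le> H'" using B_ge by (simp add: H'_def)
  then show ?thesis using B_ge alpha_pos by (simp add: D_def)
qed

definition "b\<^sub>1 = 1 - c\<^sub>1 / D\<^sup>2"

lemma b1: "1 / 2 \<le> b\<^sub>1" "b\<^sub>1 < 1"
proof -
  have "c\<^sub>1 / D\<^sup>2 \<le> c\<^sub>1 / 1" using c1 D_ge by (intro divide_left_mono) auto
  then show "1 / 2 \<le> b\<^sub>1" unfolding b\<^sub>1_def using c1 by linarith
  show "b\<^sub>1 < 1" using c1 D_ge by (simp add: b\<^sub>1_def)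
qed

text \<open>On the subcube R the density \<open>V\<close> of Q equals \<tau>^q(x) times that of R,
  hence T times it up to a factor \<open>D\<close> either way, T being the value at the corner. The
  complement of \<open>E\<close> in R has at least half the measure, so it keeps T c / D out of a
  total of at most D T, where c is \<open>c\<^sub>1\<close>: a fraction
  \<open>c\<^sub>1 / D\<^sup>2\<close>.\<close>

lemma V_small_sets:
  assumes "good a l" "0 < r" "cube c r \<subseteq> cube a l"
    and E: "E \<in> sets lebesgue" "E \<subseteq> cube c r" "2 * emeasure lebesgue E \<le> ennreal (r ^ DIM('a))"
  shows "density_on (V (cube a l)) E \<le> ennreal b\<^sub>1 * density_on (V (cube a l)) (cube c r)"
proof -
  let ?R = "cube c r" and ?Q = "cube a l"
  let ?F = "?R - E"
  define \<tau> where "\<tau> = N ?R / N ?Q"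
  define T where "T = \<tau> powr q c"
  have l: "0 < l" using assms(1) by (simp add: good_def)
  have Np: "0 < N ?R" "0 < N ?Q" using N_pos l assms(2) by auto
  have tau: "0 < \<tau>" using Np by (simp add: \<tau>_def)
  have T: "0 < T" using tau by (simp add: T_def)
  have c: "c \<in> ?R" using assms(2) by (auto simp: mem_box inner_add_left)
  have VQ: "V ?Q x = \<tau> powr q x * V ?R x" for x
    using Np w_pos[of x] by (simp add: V_def \<tau>_def powr_mult[symmetric])
  have up: "V ?Q x \<le> (D * T) * V ?R x" if "x \<in> ?R" for x
    unfolding VQ T_def using ratio_osc[OF assms(1-3) that c]
    by (intro mult_right_mono V_nonneg) (simp add: \<tau>_def)
  have lo: "(T / D) * V ?R x \<le> V ?Q x" if "x \<in> ?R" for x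
    unfolding VQ T_def using ratio_osc[OF assms(1-3) c that] D_ge
    by (intro mult_right_mono V_nonneg) (simp add: \<tau>_def field_simps)
  have "ennreal c\<^sub>1 \<le> density_on (V ?R) ?F"
    unfolding V_def[abs_def]
    by (rule mass_half[OF assms(2) _ _ cube_complement_half[OF assms(2) E]]) (use E in auto)
  then have "ennreal (T / D) * ennreal c\<^sub>1 \<le> ennreal (T / D) * density_on (V ?R) ?F"
    by (rule mult_left_mono) simp
  also have "\<dots> = density_on (\<lambda>x. (T / D) * V ?R x) ?F"
    using E T D_ge by (intro density_on_cmult[symmetric] V_nonneg) auto
  also have "\<dots> \<le> density_on (V ?Q) ?F"
    using lo by (intro density_on_mono_fun) auto
  finally have F: "ennreal (T / D * c\<^sub>1) \<le> density_on (V ?Q) ?F"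
    using T D_ge c1 by (subst ennreal_mult) auto
  have "density_on (V ?Q) ?R \<le> density_on (\<lambda>x. (D * T) * V ?R x) ?R"
    using up by (rule density_on_mono_fun)
  also have "\<dots> = ennreal (D * T) * density_on (V ?R) ?R"
    using T D_ge by (intro density_on_cmult V_nonneg) auto
  also have "\<dots> \<le> ennreal (D * T) * 1"
    unfolding V_def[abs_def] by (intro mult_left_mono N_ball assms(2)) simp
  finally have R: "density_on (V ?Q) ?R \<le> ennreal (D * T)" by simp
  then obtain v where v: "density_on (V ?Q) ?R = ennreal v" "0 \<le> v"
    by (cases "density_on (V ?Q) ?R") (auto simp: top_unique)
  have split: "density_on (V ?Q) ?R = density_on (V ?Q) E + density_on (V ?Q) ?F"
    using E by (subst density_on_Un[symmetric]) (auto intro!: arg_cong[of _ _ "density_on _"])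
  obtain e where e: "density_on (V ?Q) E = ennreal e" "0 \<le> e"
    using split v by (cases "density_on (V ?Q) E") auto
  obtain f where f: "density_on (V ?Q) ?F = ennreal f" "0 \<le> f"
    using split v by (cases "density_on (V ?Q) ?F") auto
  have "ennreal v = ennreal (e + f)" using split v e f by simp
  then have sum: "v = e + f" using v e f by (subst (asm) ennreal_inj) auto
  have "v \<le> D * T" using R v T D_ge by simp
  then have "c\<^sub>1 / D\<^sup>2 * v \<le> c\<^sub>1 / D\<^sup>2 * (D * T)" using c1 D_ge by (intro mult_left_mono) auto
  also have "\<dots> = T / D * c\<^sub>1" using D_ge by (simp add: power2_eq_square)
  also have "\<dots> \<le> f" using F f T D_ge c1 by simp
  finally have "e \<le> b\<^sub>1 * v" using sum by (simp add: b\<^sub>1_def algebra_simps)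
  then show ?thesis
    using e v b1 by (simp add: ennreal_mult[symmetric] ennreal_leI)
qed

lemma V_ball: "0 < l \<Longrightarrow> density_on (V (cube a l)) (cube a l) \<le> 1"
  unfolding V_def[abs_def] by (rule N_ball)

lemma good_cube_density:
  assumes "good a l"
  shows "small_sets_small_density a l (\<lambda>x. l ^ DIM('a) * V (cube a l) x) b\<^sub>1"
proof
  show l: "0 < l" using assms by (simp add: good_def)
  have scale: "density_on (\<lambda>x. l ^ DIM('a) * V (cube a l) x) E
      = ennreal (l ^ DIM('a)) * density_on (V (cube a l)) E" if "E \<in> sets lebesgue" for E
    using that l by (intro density_on_cmult V_nonneg) auto
  show "density_on (\<lambda>x. l ^ DIM('a) * V (cube a l) x) (cube a l) \<le> ennreal (l ^ DIM('a))"
    using mult_left_mono[OF V_ball[OF l], of "ennreal (l ^ DIM('a))" a] by (simp add: scale)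
  show "0 \<le> b\<^sub>1" using b1 by simp
  show "0 \<le> l ^ DIM('a) * V (cube a l) x" for x
    using l by (simp add: V_nonneg)
  fix r c E
  assume *: "0 < r" "cube c r \<subseteq> cube a l" "E \<in> sets lebesgue" "E \<subseteq> cube c r"
    "2 * emeasure lebesgue E \<le> ennreal (r ^ DIM('a))"
  have "ennreal (l ^ DIM('a)) * density_on (V (cube a l)) E
      \<le> ennreal (l ^ DIM('a)) * (ennreal b\<^sub>1 * density_on (V (cube a l)) (cube c r))"
    using V_small_sets[OF assms *] by (rule mult_left_mono) simp
  then show "density_on (\<lambda>x. l ^ DIM('a) * V (cube a l) x) E
      \<le> ennreal b\<^sub>1 * density_on (\<lambda>x. l ^ DIM('a) * V (cube a l) x) (cube c r)"
    using * by (simp add: scale mult_ac)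
qed measurable

definition "RH \<epsilon> C a l \<longleftrightarrow>
  density_on (\<lambda>x. (l ^ DIM('a) * V (cube a l) x) powr (1 + \<epsilon>)) (cube a l) \<le> ennreal (C * l ^ DIM('a))"

lemma RH_mono: "RH \<epsilon> C a l \<Longrightarrow> C \<le> C' \<Longrightarrow> 0 < l \<Longrightarrow> RH \<epsilon> C' a l"
  unfolding RH_def by (erule order_trans) (auto intro!: ennreal_leI mult_right_mono)

lemma good_RH:
  fixes \<epsilon> :: real
  defines "P \<equiv> (2 * 2 ^ DIM('a)) powr \<epsilon> :: real"
  assumes "0 < \<epsilon>" "P * b\<^sub>1 < 1" "good a l"
  shows "RH \<epsilon> (1 + P / (1 - P * b\<^sub>1)) a l"
proof -
  interpret small_sets_small_density a l "\<lambda>x. l ^ DIM('a) * V (cube a l) x" b\<^sub>1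
    by (rule good_cube_density[OF assms(4)])
  have "0 \<le> 1 + P / (1 - P * b\<^sub>1)" using assms(3) by (simp add: P_def)
  then show ?thesis
    using reverse_Hoelder[OF assms(2)] assms(3) side_pos
    unfolding RH_def P_def by (subst ennreal_mult) auto
qed

text \<open>Changing the normalising cube costs \<tau>^q(x) in the density and the volume ratio in
  the prefactor. It serves from the parts to the whole, with \<tau> equal to 1 or \<rho>, and from a
  large centred cube down to a cube inside it, with \<tau> from \<open>N_lower\<close>.\<close>

lemma density_transfer:
  assumes "0 < r" "0 < L" "N (cube c r) \<le> \<tau> * N (cube a L)" "\<And>x. \<tau> powr q x \<le> Y"
    and "RH \<epsilon> C c r" "0 \<le> C" "E \<subseteq> cube c r" "0 < \<epsilon>"
  shows "density_on (\<lambda>x. (L ^ DIM('a) * V (cube a L) x) powr (1 + \<epsilon>)) E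
    \<le> ennreal (((L / r) ^ DIM('a) * Y) powr (1 + \<epsilon>) * (C * r ^ DIM('a)))"
proof -
  let ?R = "cube c r" and ?Q = "cube a L"
  define Z where "Z = ((L / r) ^ DIM('a) * Y) powr (1 + \<epsilon>)"
  have Np: "0 < N ?R" "0 < N ?Q" using N_pos assms by auto
  have tau: "0 < \<tau>" using assms(3) Np by (smt (verit) zero_less_mult_pos2)
  have Y: "0 < Y" using tau assms(4)[of undefined] by (smt (verit) powr_gt_zero)
  have VQ: "V ?Q x \<le> Y * V ?R x" for x
  proof -
    have "w x / N ?Q \<le> \<tau> * (w x / N ?R)"
      using Np assms(3) w_pos[of x] by (simp add: field_simps)
    then have "V ?Q x \<le> (\<tau> * (w x / N ?R)) powr q x"
      unfolding V_def using Np w_pos[of x] q_ge[of x] by (intro powr_mono2) auto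
    also have "\<dots> = \<tau> powr q x * V ?R x" unfolding V_def by (rule powr_mult)
    also have "\<dots> \<le> Y * V ?R x" using assms(4) V_nonneg by (rule mult_right_mono)
    finally show ?thesis .
  qed
  have pw: "(L ^ DIM('a) * V ?Q x) powr (1 + \<epsilon>) \<le> Z * (r ^ DIM('a) * V ?R x) powr (1 + \<epsilon>)" for x
  proof -
    have "(L ^ DIM('a) * V ?Q x) powr (1 + \<epsilon>) \<le> (L ^ DIM('a) * (Y * V ?R x)) powr (1 + \<epsilon>)"
      using VQ[of x] assms V_nonneg by (intro powr_mono2 mult_left_mono) auto
    also have "L ^ DIM('a) * (Y * V ?R x) = ((L / r) ^ DIM('a) * Y) * (r ^ DIM('a) * V ?R x)"
      using assms by (simp add: power_divide)
    finally show ?thesis by (simp only: Z_def powr_mult)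
  qed
  have "density_on (\<lambda>x. (L ^ DIM('a) * V ?Q x) powr (1 + \<epsilon>)) E
      \<le> density_on (\<lambda>x. (L ^ DIM('a) * V ?Q x) powr (1 + \<epsilon>)) ?R"
    by (rule density_on_mono[OF assms(7)])
  also have "\<dots> \<le> density_on (\<lambda>x. Z * (r ^ DIM('a) * V ?R x) powr (1 + \<epsilon>)) ?R"
    using pw by (rule density_on_mono_fun)
  also have "\<dots> = ennreal Z * density_on (\<lambda>x. (r ^ DIM('a) * V ?R x) powr (1 + \<epsilon>)) ?R"
    by (intro density_on_cmult) (auto simp: Z_def)
  also have "\<dots> \<le> ennreal Z * ennreal (C * r ^ DIM('a))"
    using assms(5) unfolding RH_def by (rule mult_left_mono) simp
  also have "\<dots> = ennreal (Z * (C * r ^ DIM('a)))"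
    using assms by (intro ennreal_mult[symmetric]) (auto simp: Z_def)
  finally show ?thesis by (simp add: Z_def)
qed

section \<open>Large cubes near the origin: ternary induction\<close>

definition "centred L = cube (- (L / 2) *\<^sub>R One :: 'a) L"

lemma mem_centred: "x \<in> centred L \<longleftrightarrow> (\<forall>i\<in>Basis. \<bar>x \<bullet> i\<bar> \<le> L / 2)"
proof -
  have "(- (L / 2) *\<^sub>R One :: 'a) \<bullet> i \<le> x \<bullet> i \<and> x \<bullet> i \<le> (- (L / 2) *\<^sub>R One :: 'a) \<bullet> i + L
      \<longleftrightarrow> \<bar>x \<bullet> i\<bar> \<le> L / 2" if "i \<in> Basis" for i :: 'a
    using that by (simp add: abs_le_iff) argo
  then show ?thesis unfolding centred_def mem_cube by blast
qed

text \<open>The ternary subdivision is indexed by \<open>f\<close> with values in -1, 0, 1, and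
  \<open>pt f\<close> is the lower corner of the cube with centre r f. A nonzero \<open>f i\<close>
  keeps the i-th coordinate at least \<open>r / 2\<close> in absolute value, which makes the cube
  \<open>good\<close>.\<close>

lemma centred_shell:
  assumes "0 < r"
  obtains G :: "'a set" where "finite G" "card G \<le> 3 ^ DIM('a)"
    "\<And>c. c \<in> G \<Longrightarrow> cube c r \<subseteq> centred (3 * r)"
    "\<And>c. c \<in> G \<Longrightarrow> good c r"
    "centred (3 * r) \<subseteq> centred r \<union> (\<Union>c\<in>G. cube c r)"
proof -
  define pt :: "('a \<Rightarrow> real) \<Rightarrow> 'a" where "pt f = (\<Sum>i\<in>Basis. (r * (f i - 1 / 2)) *\<^sub>R i)" for f
  have pt: "pt f \<bullet> i = r * (f i - 1 / 2)" if "i \<in> Basis" for f i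
    using that by (simp add: pt_def inner_sum_left inner_Basis if_distrib sum.If_cases)
  have mem_pt: "x \<in> cube (pt f) r \<longleftrightarrow> (\<forall>i\<in>Basis. \<bar>x \<bullet> i - r * f i\<bar> \<le> r / 2)" for x f
  proof -
    have "pt f \<bullet> i \<le> x \<bullet> i \<and> x \<bullet> i \<le> pt f \<bullet> i + r \<longleftrightarrow> \<bar>x \<bullet> i - r * f i\<bar> \<le> r / 2"
      if "i \<in> Basis" for i
      unfolding pt[OF that] abs_le_iff right_diff_distrib by argo
    then show ?thesis unfolding mem_cube by blast
  qed
  let ?A = "PiE (Basis::'a set) (\<lambda>_. {-1, 0, 1::real})"
  define G where "G = pt ` {f \<in> ?A. \<exists>i\<in>Basis. f i \<noteq> 0}"
  have fin: "finite ?A" by (intro finite_PiE) auto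
  show thesis
  proof
    show "finite G" unfolding G_def using fin by auto
    have "card G \<le> card {f \<in> ?A. \<exists>i\<in>Basis. f i \<noteq> 0}"
      unfolding G_def using fin by (intro card_image_le) auto
    also have "\<dots> \<le> card ?A" using fin by (intro card_mono) auto
    also have "card ?A = 3 ^ DIM('a)" by (simp add: card_PiE numeral_3_eq_3)
    finally show "card G \<le> 3 ^ DIM('a)" .
  next
    fix c assume "c \<in> G"
    then obtain f where f: "c = pt f" "f \<in> ?A" "\<exists>i\<in>Basis. f i \<noteq> 0"
      unfolding G_def by auto
    have fi: "f i \<in> {-1, 0, 1}" if "i \<in> Basis" for i using f(2) that by auto
    show "cube c r \<subseteq> centred (3 * r)"
    proof
      fix x assume x: "x \<in> cube c r"
      have "\<bar>x \<bullet> i\<bar> \<le> 3 * r / 2" if "i \<in> Basis" for i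
      proof -
        have "\<bar>x \<bullet> i - r * f i\<bar> \<le> r / 2" using x that unfolding f(1) mem_pt by blast
        moreover have "r * f i = - r \<or> r * f i = 0 \<or> r * f i = r" using fi[OF that] by auto
        ultimately show ?thesis using assms by argo
      qed
      then show "x \<in> centred (3 * r)" by (simp add: mem_centred)
    qed
    have "r / 2 \<le> norm x" if x: "x \<in> cube c r" for x
    proof -
      obtain i where i: "i \<in> Basis" "f i \<noteq> 0" using f(3) by auto
      have "r / 2 \<le> \<bar>x \<bullet> i\<bar>"
      proof -
        have "\<bar>x \<bullet> i - r * f i\<bar> \<le> r / 2" using x i(1) unfolding f(1) mem_pt by blast
        moreover have "r * f i = - r \<or> r * f i = r" using fi[OF i(1)] i(2) by auto
        ultimately show ?thesis using assms by argo
      qed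
      then show ?thesis using Basis_le_norm[OF i(1), of x] by linarith
    qed
    then show "good c r" using assms by (auto simp: good_def)
  next
    show "centred (3 * r) \<subseteq> centred r \<union> (\<Union>c\<in>G. cube c r)"
    proof
      fix x :: 'a assume x: "x \<in> centred (3 * r)"
      define f where "f = restrict (\<lambda>i. if x \<bullet> i < - r / 2 then -1 else if x \<bullet> i \<le> r / 2 then 0 else (1::real)) Basis"
      have "f \<in> ?A" by (auto simp: f_def)
      have "x \<in> cube (pt f) r"
        unfolding mem_pt
      proof
        fix i :: 'a assume i: "i \<in> Basis"
        have "\<bar>x \<bullet> i\<bar> \<le> 3 * r / 2" using x i by (simp add: mem_centred)
        moreover have "(x \<bullet> i < - r / 2 \<and> r * f i = - r) \<or> (- r / 2 \<le> x \<bullet> i \<and> x \<bullet> i \<le> r / 2 \<and> r * f i = 0)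
            \<or> (r / 2 < x \<bullet> i \<and> r * f i = r)"
          using i by (auto simp: f_def)
        ultimately show "\<bar>x \<bullet> i - r * f i\<bar> \<le> r / 2" by argo
      qed
      show "x \<in> centred r \<union> (\<Union>c\<in>G. cube c r)"
      proof (cases "\<exists>i\<in>Basis. f i \<noteq> 0")
        case True
        then show ?thesis using \<open>f \<in> ?A\<close> \<open>x \<in> cube (pt f) r\<close> unfolding G_def by blast
      next
        case False
        then have "x \<in> centred r"
          by (auto simp: mem_centred f_def abs_le_iff split: if_splits)
        then show ?thesis by blast
      qed
    qed
  qed
qed

text \<open>Tripling the side costs the central third a factor (3^d)^\<epsilon> beyond the change of
  volume, and the contraction of the norm gains \<rho>. The product is below 1, so the constant
  inherited from the previous step shrinks while the outer cubes add a fixed amount.\<close>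

lemma centred_RH:
  assumes eps: "0 < \<epsilon>" and C0: "0 \<le> C\<^sub>0" and good: "\<And>a l. good a l \<Longrightarrow> RH \<epsilon> C\<^sub>0 a l"
    and small: "(3 ^ DIM('a)) powr \<epsilon> * \<rho> < 1"
  shows "\<exists>C\<ge>0. \<forall>k. RH \<epsilon> C (- (3 ^ k / 2) *\<^sub>R One) (3 ^ k)"
proof -
  define d where "d = DIM('a)"
  define p where "p = (3 ^ d) powr \<epsilon>"
  \<comment> \<open>The second entry is the fixed point of C = 3^d p C_0 + p \<rho> C, with C_0 for
    \<open>C\<^sub>0\<close>; the first covers the unit cube at \<open>k = 0\<close>.\<close>
  define C where "C = max C\<^sub>0 (3 ^ d * p * C\<^sub>0 / (1 - p * \<rho>))"
  have p: "0 < p" by (simp add: p_def)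
  have small': "0 < 1 - p * \<rho>" using small by (simp add: p_def d_def)
  have C: "C\<^sub>0 \<le> C" "0 \<le> C" using C0 by (auto simp: C_def)
  have "3 ^ d * p * C\<^sub>0 / (1 - p * \<rho>) \<le> C" by (simp add: C_def)
  then have C': "3 ^ d * p * C\<^sub>0 + p * \<rho> * C \<le> C"
    using small' by (simp add: field_simps)
  have "RH \<epsilon> C (- (3 ^ k / 2) *\<^sub>R One) (3 ^ k)" for k
  proof (induction k)
    case 0
    have "good (- (1 / 2) *\<^sub>R One :: 'a) 1" by (simp add: good_def)
    then show ?case using RH_mono[OF good C(1)] by simp
  next
    case (Suc k)
    define r :: real where "r = 3 ^ k"
    have r: "0 < r" by (simp add: r_def)
    define Q where "Q = centred (3 * r)"
    define W where "W x = ((3 * r) ^ d * V Q x) powr (1 + \<epsilon>)" for x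
    have W_meas [measurable]: "W \<in> borel_measurable lebesgue" unfolding W_def by measurable
    obtain G :: "'a set" where G: "finite G" "card G \<le> 3 ^ DIM('a)"
      "\<And>c. c \<in> G \<Longrightarrow> cube c r \<subseteq> centred (3 * r)" "\<And>c. c \<in> G \<Longrightarrow> good c r"
      "centred (3 * r) \<subseteq> centred r \<union> (\<Union>c\<in>G. cube c r)"
      by (rule centred_shell[OF r]) blast
    have rat: "(3 * r / r) ^ DIM('a) = 3 ^ d" using r by (simp add: d_def)
    have pw: "(3 ^ d * Y) powr (1 + \<epsilon>) = 3 ^ d * p * Y powr (1 + \<epsilon>)" if "0 < Y" for Y
      using that by (simp add: powr_mult powr_add p_def)
    have outer: "density_on W (cube c r) \<le> ennreal (p * C\<^sub>0 * (3 * r) ^ d)" if "c \<in> G" for c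
    proof -
      have "density_on W (cube c r) \<le> ennreal (((3 * r / r) ^ DIM('a) * 1) powr (1 + \<epsilon>) * (C\<^sub>0 * r ^ DIM('a)))"
        unfolding W_def Q_def centred_def d_def
      proof (rule density_transfer[OF r _ _ _ good[OF G(4)[OF that]] C0 order_refl eps])
        show "N (cube c r) \<le> 1 * N (cube (- (3 * r / 2) *\<^sub>R One) (3 * r))"
          using N_mono[OF r _ G(3)[OF that, unfolded centred_def]] r by simp
      qed (use r in auto)
      also have "((3 * r / r) ^ DIM('a) * 1) powr (1 + \<epsilon>) * (C\<^sub>0 * r ^ DIM('a)) = p * C\<^sub>0 * (3 * r) ^ d"
        unfolding rat pw[OF zero_less_one] by (simp add: power_mult_distrib d_def)
      finally show ?thesis .
    qed
    have inner: "density_on W (centred r) \<le> ennreal (p * \<rho> * C * (3 * r) ^ d)"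
    proof -
      have sub: "centred r \<subseteq> centred (3 * r)"
        using r by (force simp: mem_centred)
      have "2 * r ^ d \<le> 3 ^ d * r ^ d"
        using r power_increasing[of 1 d "3::real"] DIM_positive[where 'a='a]
        by (intro mult_right_mono) (auto simp: d_def Suc_le_eq)
      then have contract: "N (centred r) \<le> \<rho> * N (centred (3 * r))"
        unfolding centred_def using r sub
        by (intro N_contract) (auto simp: centred_def d_def power_mult_distrib)
      have rho_pow: "\<rho> powr q x \<le> \<rho>" for x
        using powr_mono'[of 1 "q x" \<rho>] rho q_ge[of x] by simp
      have "RH \<epsilon> C (- (r / 2) *\<^sub>R One) r"
        using Suc.IH by (simp add: r_def)
      then have "density_on W (centred r) \<le> ennreal (((3 * r / r) ^ DIM('a) * \<rho>) powr (1 + \<epsilon>) * (C * r ^ DIM('a)))"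
        unfolding W_def Q_def d_def using contract r rho_pow C eps unfolding centred_def
        by (intro density_transfer[where \<tau> = \<rho>]) auto
      also have "\<dots> \<le> ennreal (p * \<rho> * C * (3 * r) ^ d)"
      proof (rule ennreal_leI)
        have "\<rho> powr (1 + \<epsilon>) \<le> \<rho>"
          using powr_mono'[of 1 "1 + \<epsilon>" \<rho>] rho eps by simp
        then have "3 ^ d * p * \<rho> powr (1 + \<epsilon>) * (C * r ^ d) \<le> 3 ^ d * p * \<rho> * (C * r ^ d)"
          using p C r by (intro mult_right_mono mult_left_mono) auto
        then show "((3 * r / r) ^ DIM('a) * \<rho>) powr (1 + \<epsilon>) * (C * r ^ DIM('a)) \<le> p * \<rho> * C * (3 * r) ^ d"
          unfolding rat pw[OF rho(1)] by (simp add: power_mult_distrib d_def mult_ac)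
      qed
      finally show ?thesis .
    qed
    have "density_on W Q \<le> density_on W (centred r \<union> (\<Union>c\<in>G. cube c r))"
      unfolding Q_def by (rule density_on_mono[OF G(5)])
    also have "\<dots> = density_on W (\<Union>A\<in>insert (centred r) ((\<lambda>c. cube c r) ` G). A)"
      by simp
    also have "\<dots> \<le> (\<Sum>A\<in>insert (centred r) ((\<lambda>c. cube c r) ` G). density_on W A)"
      using G(1) by (intro density_on_UN_le) (auto simp: centred_def)
    also have "\<dots> \<le> density_on W (centred r) + (\<Sum>A\<in>(\<lambda>c. cube c r) ` G. density_on W A)"
      using G(1) by (cases "centred r \<in> (\<lambda>c. cube c r) ` G") (auto simp: insert_absorb)
    also have "(\<Sum>A\<in>(\<lambda>c. cube c r) ` G. density_on W A) \<le> (\<Sum>A\<in>(\<lambda>c. cube c r) ` G. ennreal (p * C\<^sub>0 * (3 * r) ^ d))"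
      using outer by (intro sum_mono) auto
    also have "\<dots> = ennreal (card ((\<lambda>c. cube c r) ` G) * (p * C\<^sub>0 * (3 * r) ^ d))"
      using p C0 r by (simp add: ennreal_mult ennreal_of_nat_eq_real_of_nat)
    also have "\<dots> \<le> ennreal (3 ^ d * (p * C\<^sub>0 * (3 * r) ^ d))"
    proof (intro ennreal_leI mult_right_mono)
      have "card ((\<lambda>c. cube c r) ` G) \<le> 3 ^ d"
        using card_image_le[OF G(1)] G(2) d_def order_trans by metis
      then show "real (card ((\<lambda>c. cube c r) ` G)) \<le> 3 ^ d"
        by (metis of_nat_le_iff of_nat_numeral of_nat_power)
    qed (use p C0 r in auto)
    also note inner
    finally have "density_on W Q
        \<le> ennreal (p * \<rho> * C * (3 * r) ^ d) + ennreal (3 ^ d * (p * C\<^sub>0 * (3 * r) ^ d))"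
      by (simp add: add_mono)
    also have "\<dots> = ennreal ((3 ^ d * p * C\<^sub>0 + p * \<rho> * C) * (3 * r) ^ d)"
      using p C C0 r rho by (subst ennreal_plus[symmetric]) (auto simp: algebra_simps)
    also have "\<dots> \<le> ennreal (C * (3 * r) ^ d)"
      using C' r by (intro ennreal_leI mult_right_mono) auto
    finally show ?case
      unfolding RH_def W_def Q_def centred_def d_def r_def by simp
  qed
  then show ?thesis using C by blast
qed

text \<open>Such a cube has side above 1 and a point within \<open>l / 2\<close> of the origin, so
  all its coordinates are at most 3 l / 2 in absolute value. The least power of three that is at
  least 3 l is below 9 l.\<close>

lemma bad_subset_centred:
  assumes "0 < l" "\<not> good a l"
  obtains k where "cube a l \<subseteq> centred (3 ^ k)" "l \<le> 3 ^ k" "3 ^ k \<le> 9 * l"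
proof -
  obtain x where x: "x \<in> cube a l" "norm x < l / 2" and l1: "1 < l"
    using assms by (force simp: good_def)
  define k where "k = (LEAST k. 3 * l \<le> 3 ^ k)"
  have "\<exists>k. 3 * l \<le> 3 ^ k"
    using real_arch_pow[of 3 "3 * l"] by (auto intro: less_imp_le)
  then have k: "3 * l \<le> 3 ^ k" unfolding k_def by (rule LeastI_ex)
  moreover have "k \<noteq> 0" using k l1 by (intro notI) simp
  ultimately obtain j where j: "k = Suc j" by (cases k) auto
  have "\<not> 3 * l \<le> 3 ^ j"
    using not_less_Least[of j "\<lambda>k. 3 * l \<le> 3 ^ k"] j by (simp add: k_def)
  then have up: "3 ^ k \<le> 9 * l" by (simp add: j)
  have "y \<in> centred (3 ^ k)" if y: "y \<in> cube a l" for y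
    unfolding mem_centred
  proof
    fix i :: 'a assume i: "i \<in> Basis"
    have "\<bar>x \<bullet> i\<bar> < l / 2" using Basis_le_norm[OF i, of x] x(2) by linarith
    moreover have "a \<bullet> i \<le> x \<bullet> i" "x \<bullet> i \<le> a \<bullet> i + l" "a \<bullet> i \<le> y \<bullet> i" "y \<bullet> i \<le> a \<bullet> i + l"
      using x(1) y i unfolding mem_cube by auto
    ultimately show "\<bar>y \<bullet> i\<bar> \<le> 3 ^ k / 2" using k by linarith
  qed
  then show thesis using that[of k] k up assms(1) by auto
qed

text \<open>One \<epsilon> has to serve both geometric decays, that of the stopping argument and
  that of the ternary induction; hence the maxima in \<open>P\<close> and \<beta>. The remaining
  cubes inherit the estimate from a centred cube of at most nine times their side.\<close>

lemma RH_all: "\<exists>\<epsilon>>0. \<exists>C\<ge>0. \<forall>a l. 0 < l \<longrightarrow> RH \<epsilon> C a l"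
proof -
  define P :: real where "P = max (2 * 2 ^ DIM('a)) (3 ^ DIM('a))"
  define \<beta> where "\<beta> = max b\<^sub>1 \<rho>"
  have P1: "1 < P" unfolding P_def by (rule less_max_iff_disj[THEN iffD2, OF disjI1], rule less_le_trans[of _ 2]) auto
  have "0 < \<beta>" "\<beta> < 1" using b1 rho by (auto simp: \<beta>_def less_max_iff_disj)
  then obtain \<epsilon> where eps: "0 < \<epsilon>" "P powr \<epsilon> * \<beta> < 1"
    using powr_eventually_small[OF P1] by blast
  have le: "X powr \<epsilon> * y < 1" if "0 \<le> X" "X \<le> P" "0 \<le> y" "y \<le> \<beta>" for X y
  proof -
    have "X powr \<epsilon> * y \<le> P powr \<epsilon> * \<beta>"
      using that eps by (intro mult_mono powr_mono2) auto
    then show ?thesis using eps by linarith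
  qed
  have s1: "(2 * 2 ^ DIM('a)) powr \<epsilon> * b\<^sub>1 < 1"
    using b1 by (intro le) (auto simp: P_def \<beta>_def)
  have s2: "(3 ^ DIM('a)) powr \<epsilon> * \<rho> < 1"
    using rho by (intro le) (auto simp: P_def \<beta>_def)
  obtain C\<^sub>0 where C0: "0 \<le> C\<^sub>0" "\<And>a l. good a l \<Longrightarrow> RH \<epsilon> C\<^sub>0 a l"
  proof
    let ?P = "(2 * 2 ^ DIM('a)) powr \<epsilon> :: real"
    show "0 \<le> 1 + ?P / (1 - ?P * b\<^sub>1)" using s1 by simp
    show "RH \<epsilon> (1 + ?P / (1 - ?P * b\<^sub>1)) a l" if "good a l" for a l
      by (rule good_RH[OF eps(1) s1 that])
  qed
  obtain C where C: "0 \<le> C" "\<And>k. RH \<epsilon> C (- (3 ^ k / 2) *\<^sub>R One) (3 ^ k)"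
    using centred_RH[OF eps(1) C0 s2] by blast
  \<comment> \<open>The maximum with 1 permits replacing the exponent \<open>q x\<close> by its
    bound \<open>B\<close>.\<close>
  define Y where "Y = max 1 (K * (2 * 9 ^ DIM('a)) powr \<alpha>) powr B"
  define C' where "C' = C\<^sub>0 + Y powr (1 + \<epsilon>) * (C * 9 ^ DIM('a))"
  have C': "0 \<le> C'" "C\<^sub>0 \<le> C'" "Y powr (1 + \<epsilon>) * (C * 9 ^ DIM('a)) \<le> C'"
    using C0 C by (auto simp: C'_def)
  have "RH \<epsilon> C' a l" if l: "0 < l" for a l
  proof (cases "good a l")
    case True
    then show ?thesis using RH_mono[OF C0(2) C'(2) l] by blast
  next
    case False
    then obtain k where k: "cube a l \<subseteq> centred (3 ^ k)" "l \<le> 3 ^ k" "3 ^ k \<le> 9 * l"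
      using bad_subset_centred[OF l] by blast
    define L :: real where "L = 3 ^ k"
    have L: "0 < L" "l \<le> L" "L \<le> 9 * l" using k by (auto simp: L_def)
    define \<tau> where "\<tau> = K * (2 * 9 ^ DIM('a)) powr \<alpha>"
    let ?c = "- (L / 2) *\<^sub>R One :: 'a"
    have sub: "cube a l \<subseteq> cube ?c L" using k(1) unfolding centred_def L_def .
    have "N (cube ?c L) \<le> K * (2 * (L / l) ^ DIM('a)) powr \<alpha> * N (cube a l)"
      by (rule N_lower[OF l L(1) sub])
    also have "\<dots> \<le> \<tau> * N (cube a l)"
      unfolding \<tau>_def using L l K_pos alpha_pos N_pos[OF l, of a]
      by (intro mult_right_mono mult_left_mono powr_mono2 power_mono) (auto simp: field_simps)
    finally have tau: "N (cube ?c L) \<le> \<tau> * N (cube a l)" .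
    have Y: "\<tau> powr q x \<le> Y" for x
    proof -
      have "0 \<le> \<tau>" using K_pos by (simp add: \<tau>_def)
      then have "\<tau> powr q x \<le> max 1 \<tau> powr q x"
        using q_ge[of x] by (intro powr_mono2) auto
      also have "\<dots> \<le> Y"
        unfolding Y_def \<tau>_def[symmetric] using q_le[of x] by (intro powr_mono) auto
      finally show ?thesis .
    qed
    have Y0: "0 \<le> Y" by (simp add: Y_def)
    have "density_on (\<lambda>x. (l ^ DIM('a) * V (cube a l) x) powr (1 + \<epsilon>)) (cube a l)
        \<le> ennreal (((l / L) ^ DIM('a) * Y) powr (1 + \<epsilon>) * (C * L ^ DIM('a)))"
      using C(2)[of k] by (intro density_transfer[OF L(1) l tau Y _ C(1) sub eps(1)]) (simp add: L_def)
    also have "\<dots> \<le> ennreal (C' * l ^ DIM('a))"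
    proof (rule ennreal_leI)
      have "(l / L) ^ DIM('a) \<le> 1" using L l by (intro power_le_one) auto
      then have "(l / L) ^ DIM('a) * Y \<le> Y" using Y0 by (rule mult_left_le_one_le[rotated 2]) (use l L in auto)
      then have "((l / L) ^ DIM('a) * Y) powr (1 + \<epsilon>) \<le> Y powr (1 + \<epsilon>)"
        using Y0 eps l L by (intro powr_mono2) auto
      moreover have "C * L ^ DIM('a) \<le> C * (9 * l) ^ DIM('a)"
        using C L by (intro mult_left_mono power_mono) auto
      ultimately have "((l / L) ^ DIM('a) * Y) powr (1 + \<epsilon>) * (C * L ^ DIM('a))
          \<le> Y powr (1 + \<epsilon>) * (C * (9 * l) ^ DIM('a))"
        by (rule mult_mono) (use C L in auto)
      also have "\<dots> = Y powr (1 + \<epsilon>) * (C * 9 ^ DIM('a)) * l ^ DIM('a)"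
        by (simp add: power_mult_distrib)
      also have "\<dots> \<le> C' * l ^ DIM('a)"
        using C'(3) l by (intro mult_right_mono) auto
      finally show "((l / L) ^ DIM('a) * Y) powr (1 + \<epsilon>) * (C * L ^ DIM('a)) \<le> C' * l ^ DIM('a)" .
    qed
    finally show ?thesis unfolding RH_def .
  qed
  then show ?thesis using eps(1) C'(1) by blast
qed

text \<open>In norms: |w 1_Q|_u is at most C |Q|^(-\<delta>) |w 1_Q|_q for 1/u = 1/q - \<delta>.
  Writing u = q (1 + e) one finds \<delta> u = e, so that the modular becomes, up to the factor from
  \<open>C\<close>, the average of (|Q| V_Q)^(1+e), which the reverse Hoelder estimate bounds
  although e varies with the point.\<close>

lemma exponent_self_improvement:
  obtains \<delta>\<^sub>0 C where "0 < \<delta>\<^sub>0" "0 < C" "\<And>\<delta> x. \<lbrakk>0 < \<delta>; \<delta> \<le> \<delta>\<^sub>0\<rbrakk> \<Longrightarrow> \<delta> * q x < 1"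
    "\<And>\<delta> a l. \<lbrakk>0 < \<delta>; \<delta> \<le> \<delta>\<^sub>0; 0 < l\<rbrakk> \<Longrightarrow> density_on
      (\<lambda>x. (w x / (C * N (cube a l) * (l ^ DIM('a)) powr (- \<delta>))) powr (1 / (1 / q x - \<delta>))) (cube a l) \<le> 1"
proof -
  obtain \<epsilon> C\<^sub>1 where eps: "0 < \<epsilon>" and C1: "0 \<le> C\<^sub>1" and RH: "\<And>a l. 0 < l \<Longrightarrow> RH \<epsilon> C\<^sub>1 a l"
    using RH_all by blast
  \<comment> \<open>The summand 1 pays for bounding a power with exponent 1 + e by 1 plus the power
    with exponent \<open>1 + \<epsilon>\<close>.\<close>
  define C where "C = 1 + C\<^sub>1"
  \<comment> \<open>This gives \<delta> q at most \<epsilon> / (1 + \<epsilon>), which says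
    precisely that e is at most \<epsilon>.\<close>
  define \<delta>\<^sub>0 where "\<delta>\<^sub>0 = \<epsilon> / ((1 + \<epsilon>) * B)"
  have C: "1 \<le> C" using C1 by (simp add: C_def)
  have d0: "0 < \<delta>\<^sub>0" using eps B_ge by (simp add: \<delta>\<^sub>0_def)
  have main: "\<delta> * q x < 1" "0 < l \<Longrightarrow> density_on
      (\<lambda>x. (w x / (C * N (cube a l) * (l ^ DIM('a)) powr (- \<delta>))) powr (1 / (1 / q x - \<delta>))) (cube a l) \<le> 1"
    if \<delta>: "0 < \<delta>" "\<delta> \<le> \<delta>\<^sub>0" for \<delta> x a l
  proof -
    have dq: "\<delta> * q x \<le> \<epsilon> / (1 + \<epsilon>)" for x
    proof -
      have "\<delta> * q x \<le> \<delta>\<^sub>0 * B" using \<delta> d0 q_ge[of x] q_le[of x] by (intro mult_mono) auto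
      then show ?thesis using B_ge by (simp add: \<delta>\<^sub>0_def)
    qed
    have lt1: "\<delta> * q x < 1" for x
    proof -
      have "\<epsilon> / (1 + \<epsilon>) < 1" using eps by simp
      then show ?thesis using dq[of x] by linarith
    qed
    show "\<delta> * q x < 1" by (rule lt1)
    show "density_on (\<lambda>x. (w x / (C * N (cube a l) * (l ^ DIM('a)) powr (- \<delta>))) powr (1 / (1 / q x - \<delta>)))
        (cube a l) \<le> 1" if l: "0 < l"
    proof -
      define m where "m = l ^ DIM('a)"
      define n where "n = N (cube a l)"
      have m: "0 < m" using l by (simp add: m_def)
      have n: "0 < n" using N_pos[OF l] by (simp add: n_def)
      have pw: "(w x / (C * n * m powr (- \<delta>))) powr (1 / (1 / q x - \<delta>))
          \<le> 1 / (C * m) * (1 + (m * V (cube a l) x) powr (1 + \<epsilon>))" for x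
      proof -
        define e where "e = \<delta> * q x / (1 - \<delta> * q x)"
        have qx: "1 \<le> q x" by (rule q_ge)
        have e: "0 \<le> e" "1 + e = 1 / (1 - \<delta> * q x)"
          using lt1[of x] \<delta> qx by (auto simp: e_def field_simps)
        have "1 / (1 + \<epsilon>) \<le> 1 - \<delta> * q x" using dq[of x] eps by (simp add: field_simps)
        then have "1 / (1 - \<delta> * q x) \<le> 1 / (1 / (1 + \<epsilon>))"
          using eps lt1[of x] by (intro divide_left_mono) auto
        then have "1 + e \<le> 1 + \<epsilon>" using e(2) by simp
        then have ee: "e \<le> \<epsilon>" by simp
        have u: "1 / (1 / q x - \<delta>) = q x * (1 + e)"
          using qx lt1[of x] by (simp add: e field_simps)
        have du: "\<delta> * (q x * (1 + e)) = e"
          unfolding e(2) by (simp add: e_def)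
        have u1: "1 \<le> q x * (1 + e)"
          using mult_mono[of 1 "q x" 1 "1 + e"] qx e by simp
        have mVm: "(m powr \<delta>) powr (q x * (1 + e)) = m powr (1 + e) / m"
          using m by (simp add: powr_powr du powr_add)
        have wn: "(w x / n) powr (q x * (1 + e)) = V (cube a l) x powr (1 + e)"
          by (simp add: V_def n_def powr_powr)
        have "w x / (C * n * m powr (- \<delta>)) = (1 / C) * ((w x / n) * m powr \<delta>)"
          using C n m by (simp add: powr_minus field_simps)
        then have "(w x / (C * n * m powr (- \<delta>))) powr (1 / (1 / q x - \<delta>))
            = (1 / C) powr (q x * (1 + e)) * (V (cube a l) x powr (1 + e) * (m powr (1 + e) / m))"
          unfolding u by (simp only: powr_mult wn mVm)
        also have "\<dots> = (1 / C) powr (q x * (1 + e)) * ((m * V (cube a l) x) powr (1 + e) / m)"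
          by (simp add: powr_mult)
        also have "\<dots> \<le> (1 / C) * ((1 + (m * V (cube a l) x) powr (1 + \<epsilon>)) / m)"
        proof (intro mult_mono divide_right_mono)
          show "(1 / C) powr (q x * (1 + e)) \<le> 1 / C"
            using powr_mono'[of 1 "q x * (1 + e)" "1 / C"] u1 C by simp
          show "(m * V (cube a l) x) powr (1 + e) \<le> 1 + (m * V (cube a l) x) powr (1 + \<epsilon>)"
          proof (cases "m * V (cube a l) x \<le> 1")
            case True
            then have "(m * V (cube a l) x) powr (1 + e) \<le> 1"
              using m e(1) V_nonneg by (intro powr_le1) auto
            then show ?thesis by (simp add: add_increasing2)
          next
            case False
            then have "(m * V (cube a l) x) powr (1 + e) \<le> (m * V (cube a l) x) powr (1 + \<epsilon>)"
              using ee by (intro powr_mono) auto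
            then show ?thesis by linarith
          qed
        qed (use C m in auto)
        finally show ?thesis by simp
      qed
      have "density_on (\<lambda>x. (w x / (C * n * m powr (- \<delta>))) powr (1 / (1 / q x - \<delta>))) (cube a l)
          \<le> density_on (\<lambda>x. 1 / (C * m) * (1 + (m * V (cube a l) x) powr (1 + \<epsilon>))) (cube a l)"
        using pw by (rule density_on_mono_fun)
      also have "\<dots> = ennreal (1 / (C * m)) * (density_on (\<lambda>_. 1) (cube a l)
          + density_on (\<lambda>x. (m * V (cube a l) x) powr (1 + \<epsilon>)) (cube a l))"
      proof -
        have "density_on (\<lambda>x. 1 / (C * m) * (1 + (m * V (cube a l) x) powr (1 + \<epsilon>))) (cube a l)
            = ennreal (1 / (C * m)) * density_on (\<lambda>x. 1 + (m * V (cube a l) x) powr (1 + \<epsilon>)) (cube a l)"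
          using C m by (intro density_on_cmult) auto
        then show ?thesis by (simp add: density_on_add)
      qed
      also have "\<dots> \<le> ennreal (1 / (C * m)) * (ennreal m + ennreal (C\<^sub>1 * m))"
        using RH[OF l, of a] unfolding RH_def m_def[symmetric]
        by (intro mult_left_mono add_mono) (auto simp: density_on_const emeasure_cube[OF l] m_def)
      also have "ennreal m + ennreal (C\<^sub>1 * m) = ennreal (C * m)"
        using C1 m by (subst ennreal_plus[symmetric]) (auto simp: C_def algebra_simps)
      also have "ennreal (1 / (C * m)) * ennreal (C * m) = 1"
        using C m by (subst ennreal_mult[symmetric]) auto
      finally show ?thesis by (simp add: n_def m_def)
    qed
  qed
  have "0 < C" using C by simp
  then show thesis using that d0 main by blast
qed

end

section \<open>Log-Hoelder exponents and variable Lebesgue norms\<close>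

text \<open>
  The decay at infinity is stated without its limit value, so that it passes to functions of
  several exponents at once; the limit is recovered in \<open>log_hoelder_imp_LH\<close>.
\<close>

definition log_hoelder :: "('a::euclidean_space \<Rightarrow> real) \<Rightarrow> bool" where
  "log_hoelder f \<longleftrightarrow> (\<exists>H.
     (\<forall>x y. 0 < norm (x - y) \<and> norm (x - y) < 1 / 2 \<longrightarrow> \<bar>f x - f y\<bar> * - ln (norm (x - y)) \<le> H) \<and>
     (\<forall>x y. norm x \<le> norm y \<longrightarrow> \<bar>f x - f y\<bar> * ln (exp 1 + norm x) \<le> H))"

lemma ln_exp_norm: "1 \<le> ln (exp 1 + norm x)" for x :: "'a::real_normed_vector"
  by (subst ln_ge_iff) (auto intro: add_pos_nonneg)

text \<open>Used for conjugate exponents and for the endpoint exponents, whose increments are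
  bounded by those of the given exponents.\<close>

lemma log_hoelder_dominated:
  assumes "log_hoelder f" "log_hoelder g" "0 \<le> c"
    and le: "\<And>x y. \<bar>h x - h y\<bar> \<le> c * (\<bar>f x - f y\<bar> + \<bar>g x - g y\<bar>)"
  shows "log_hoelder h"
proof -
  obtain F where F: "\<And>x y. 0 < norm (x - y) \<Longrightarrow> norm (x - y) < 1 / 2 \<Longrightarrow> \<bar>f x - f y\<bar> * - ln (norm (x - y)) \<le> F"
      "\<And>x y. norm x \<le> norm y \<Longrightarrow> \<bar>f x - f y\<bar> * ln (exp 1 + norm x) \<le> F"
    using assms(1) unfolding log_hoelder_def by blast
  obtain G where G: "\<And>x y. 0 < norm (x - y) \<Longrightarrow> norm (x - y) < 1 / 2 \<Longrightarrow> \<bar>g x - g y\<bar> * - ln (norm (x - y)) \<le> G"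
      "\<And>x y. norm x \<le> norm y \<Longrightarrow> \<bar>g x - g y\<bar> * ln (exp 1 + norm x) \<le> G"
    using assms(2) unfolding log_hoelder_def by blast
  have *: "\<bar>h x - h y\<bar> * t \<le> c * (F + G)"
    if "0 \<le> t" "\<bar>f x - f y\<bar> * t \<le> F" "\<bar>g x - g y\<bar> * t \<le> G" for x y t
  proof -
    have "\<bar>h x - h y\<bar> * t \<le> c * (\<bar>f x - f y\<bar> + \<bar>g x - g y\<bar>) * t"
      using le that(1) by (rule mult_right_mono)
    also have "\<dots> = c * (\<bar>f x - f y\<bar> * t + \<bar>g x - g y\<bar> * t)"
      by (simp add: algebra_simps)
    also have "\<dots> \<le> c * (F + G)"
      using that assms(3) by (intro mult_left_mono add_mono)
    finally show ?thesis .
  qed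
  have "\<bar>h x - h y\<bar> * - ln (norm (x - y)) \<le> c * (F + G)" if "0 < norm (x - y)" "norm (x - y) < 1 / 2" for x y
    using F(1)[OF that] G(1)[OF that] that by (intro *) auto
  moreover have "\<bar>h x - h y\<bar> * ln (exp 1 + norm x) \<le> c * (F + G)" if "norm x \<le> norm y" for x y
    using F(2)[OF that] G(2)[OF that] ln_exp_norm[of x] by (intro *) auto
  ultimately show ?thesis unfolding log_hoelder_def by blast
qed

lemma LH_imp_log_hoelder:
  assumes "(\<lambda>x. ereal (P x)) \<in> LH"
  shows "log_hoelder P"
proof -
  obtain C where C: "\<And>x y. norm (x - y) < 1 / 2 \<Longrightarrow> \<bar>P x - P y\<bar> \<le> C / - ln (norm (x - y))"
    using assms unfolding LH_def LH0_def by auto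
  obtain L C' where C': "0 < C'" "\<And>x. \<bar>P x - L\<bar> \<le> C' / ln (exp 1 + norm x)"
    using assms unfolding LH_def LH_infty_def by auto
  define H where "H = max C (2 * C')"
  have "\<bar>P x - P y\<bar> * - ln (norm (x - y)) \<le> H" if "0 < norm (x - y)" "norm (x - y) < 1 / 2" for x y
  proof -
    have "0 < - ln (norm (x - y))" using that by auto
    then have "\<bar>P x - P y\<bar> * - ln (norm (x - y)) \<le> C"
      using C[OF that(2)] by (simp only: pos_le_divide_eq)
    then show ?thesis by (simp add: H_def)
  qed
  moreover have "\<bar>P x - P y\<bar> * ln (exp 1 + norm x) \<le> H" if "norm x \<le> norm y" for x y
  proof -
    have l: "0 < ln (exp 1 + norm x)" using ln_exp_norm[of x] by linarith
    have "ln (exp 1 + norm x) \<le> ln (exp 1 + norm y)"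
      using that by (intro ln_mono) (auto intro: add_pos_nonneg)
    then have "C' / ln (exp 1 + norm y) \<le> C' / ln (exp 1 + norm x)"
      using l C'(1) by (intro divide_left_mono) auto
    then have "\<bar>P x - P y\<bar> \<le> 2 * C' / ln (exp 1 + norm x)"
      using C'(2)[of x] C'(2)[of y] by argo
    then have "\<bar>P x - P y\<bar> * ln (exp 1 + norm x) \<le> 2 * C'"
      using l by (simp only: pos_le_divide_eq)
    then show ?thesis by (simp add: H_def)
  qed
  ultimately show ?thesis unfolding log_hoelder_def by blast
qed

lemma log_hoelder_imp_LH:
  fixes P :: "'a::euclidean_space \<Rightarrow> real"
  assumes "log_hoelder P"
  shows "(\<lambda>x. ereal (P x)) \<in> LH"
proof -
  obtain H\<^sub>0 where H0: "\<And>x y. 0 < norm (x - y) \<Longrightarrow> norm (x - y) < 1 / 2 \<Longrightarrow> \<bar>P x - P y\<bar> * - ln (norm (x - y)) \<le> H\<^sub>0"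
      "\<And>x y. norm x \<le> norm y \<Longrightarrow> \<bar>P x - P y\<bar> * ln (exp 1 + norm x) \<le> H\<^sub>0"
    using assms unfolding log_hoelder_def by blast
  define H where "H = max 1 H\<^sub>0"
  have H: "0 < H" by (simp add: H_def)
  have near: "\<bar>P x - P y\<bar> \<le> H / - ln (norm (x - y))" if "norm (x - y) < 1 / 2" for x y
  proof (cases "x = y")
    case False
    then have "0 < - ln (norm (x - y))" using that by auto
    moreover have "\<bar>P x - P y\<bar> * - ln (norm (x - y)) \<le> H"
      using H0(1)[of x y] that False by (simp add: H_def)
    ultimately show ?thesis by (simp only: pos_le_divide_eq)
  qed simp
  have far: "\<bar>P x - P y\<bar> \<le> H / ln (exp 1 + norm x)" if "norm x \<le> norm y" for x y
  proof -
    have "0 < ln (exp 1 + norm x)" using ln_exp_norm[of x] by linarith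
    moreover have "\<bar>P x - P y\<bar> * ln (exp 1 + norm x) \<le> H"
      using H0(2)[OF that] by (simp add: H_def)
    ultimately show ?thesis by (simp only: pos_le_divide_eq)
  qed
  obtain b :: 'a where b: "b \<in> Basis" using nonempty_Basis by blast
  \<comment> \<open>The values along a ray are bounded, so a subsequence converges; its limit is the
    value at infinity.\<close>
  define Y where "Y n = P (real n *\<^sub>R b)" for n :: nat
  have "bounded (range Y)"
  proof (rule boundedI)
    fix z assume "z \<in> range Y"
    then obtain n where n: "z = Y n" by auto
    have "\<bar>P 0 - Y n\<bar> \<le> H" using far[of 0 "real n *\<^sub>R b"] by (simp add: Y_def)
    then show "norm z \<le> \<bar>P 0\<bar> + H" using n by auto
  qed
  then obtain L r where r: "strict_mono r" "(Y \<circ> r) \<longlonglongrightarrow> L"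
    using bounded_imp_convergent_subsequence by blast
  have "\<bar>P x - L\<bar> \<le> H / ln (exp 1 + norm x)" for x
  proof (rule tendsto_upperbound)
    show "(\<lambda>n. \<bar>P x - (Y \<circ> r) n\<bar>) \<longlonglongrightarrow> \<bar>P x - L\<bar>"
      using r(2) by (intro tendsto_intros)
    have "\<forall>\<^sub>F n in sequentially. norm x \<le> real n"
      by (meson eventually_sequentiallyI nat_ceiling_le_eq)
    then show "\<forall>\<^sub>F n in sequentially. \<bar>P x - (Y \<circ> r) n\<bar> \<le> H / ln (exp 1 + norm x)"
    proof eventually_elim
      fix n assume "norm x \<le> real n"
      then have "norm x \<le> real (r n)" using seq_suble[OF r(1), of n] by linarith
      then show "\<bar>P x - (Y \<circ> r) n\<bar> \<le> H / ln (exp 1 + norm x)"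
        using far[of x "real (r n) *\<^sub>R b"] b by (simp add: Y_def)
    qed
  qed simp
  then show ?thesis
    unfolding LH_def LH0_def LH_infty_def using near H by auto
qed

text \<open>A punctured ball is open and nonempty, hence not negligible. The puncture matters
  because the local log-Hoelder bound is stated for distinct points.\<close>

lemma AE_lebesgue_dense:
  fixes x :: "'a::euclidean_space"
  assumes "AE x in lebesgue. R x" "0 < e"
  obtains y where "R y" "0 < norm (x - y)" "norm (x - y) < e"
proof -
  let ?B = "ball x e - {x}"
  obtain b :: 'a where b: "b \<in> Basis" using nonempty_Basis by blast
  have "open ?B" by (intro open_delete open_ball)
  moreover have "x + (e / 2) *\<^sub>R b \<in> ?B" using b assms(2) by (auto simp: dist_norm)
  ultimately have "\<not> negligible ?B" using open_not_negligible by blast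
  moreover obtain Z where Z: "Z \<in> null_sets lebesgue" "{x. \<not> R x} \<subseteq> Z"
    using AE_E3[OF assms(1)] by (metis DiffI UNIV_I mem_Collect_eq space_completion space_lborel space_borel subsetI)
  ultimately have "\<not> ?B \<subseteq> {x. \<not> R x}"
    using negligible_iff_null_sets negligible_subset by (metis order_trans)
  then obtain y where "y \<in> ?B" "R y" by blast
  then show thesis using that[of y] by (auto simp: dist_norm)
qed

text \<open>Log-Hoelder functions are continuous, so an almost everywhere bound holds
  everywhere.\<close>

lemma log_hoelder_AE_ge:
  fixes P :: "'a::euclidean_space \<Rightarrow> real"
  assumes "log_hoelder P" "AE x in lebesgue. c \<le> P x"
  shows "c \<le> P x"
proof (rule ccontr)
  assume "\<not> c \<le> P x"
  then have g: "0 < c - P x" by simp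
  obtain H where H: "\<And>x y. 0 < norm (x - y) \<Longrightarrow> norm (x - y) < 1 / 2 \<Longrightarrow> \<bar>P x - P y\<bar> * - ln (norm (x - y)) \<le> H"
    using assms(1) unfolding log_hoelder_def by blast
  \<comment> \<open>Within this radius minus the logarithm of the distance exceeds (|H| + 1) / (c -
    P x), too much for the oscillation bound \<open>H\<close>.\<close>
  define e where "e = min (1 / 2) (exp (- (\<bar>H\<bar> + 1) / (c - P x)))"
  have "0 < e" by (simp add: e_def)
  then obtain y where y: "c \<le> P y" "0 < norm (x - y)" "norm (x - y) < e"
    using AE_lebesgue_dense[OF assms(2)] by metis
  have "ln (norm (x - y)) < ln (exp (- (\<bar>H\<bar> + 1) / (c - P x)))"
    using y by (subst ln_less_cancel_iff) (auto simp: e_def)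
  then have "(\<bar>H\<bar> + 1) / (c - P x) < - ln (norm (x - y))"
    unfolding ln_exp minus_divide_left[symmetric] by linarith
  then have "\<bar>H\<bar> + 1 < (c - P x) * - ln (norm (x - y))"
    using g by (simp only: pos_divide_less_eq mult.commute)
  also have "\<dots> \<le> \<bar>P x - P y\<bar> * - ln (norm (x - y))"
    using y by (intro mult_right_mono) (auto simp: e_def)
  also have "\<dots> \<le> H" using y by (intro H) (auto simp: e_def)
  finally show False by simp
qed

text \<open>The real-valued form of an exponent in \<open>E0_class\<close>, with bounds at every
  point instead of almost every point.\<close>

definition "real_exponent P c B \<longleftrightarrow>
  P \<in> borel_measurable lebesgue \<and> 1 < c \<and> (\<forall>x. c \<le> P x \<and> P x \<le> B) \<and> log_hoelder P"
  for P :: "'a::euclidean_space \<Rightarrow> real"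

text \<open>Decay at infinity gives finiteness and the upper bound; the lower bound comes from
  \<open>p_minus\<close> and holds everywhere by continuity.\<close>

lemma E0_classE:
  assumes "p \<in> E0_class"
  obtains P c B where "p = (\<lambda>x. ereal (P x))" "real_exponent P c B"
proof -
  have p: "p \<in> borel_measurable lebesgue" "\<And>x. 1 \<le> p x" "p \<in> LH" "1 < p_minus p"
    using assms by (auto simp: E0_class_def exponents_def)
  obtain L C where LC: "0 < C" "\<And>x. \<bar>p x - ereal L\<bar> \<le> ereal (C / ln (exp 1 + norm x))"
    using p(3) unfolding LH_def LH_infty_def by auto
  define P where "P x = real_of_ereal (p x)" for x
  have fin: "p x = ereal (P x)" for x
    using LC(2)[of x] p(2)[of x] by (cases "p x") (auto simp: P_def)
  then have pP: "p = (\<lambda>x. ereal (P x))" by auto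
  have meas: "P \<in> borel_measurable lebesgue"
    unfolding P_def using p(1) by measurable
  have lh: "log_hoelder P" using p(3) unfolding pP by (rule LH_imp_log_hoelder)
  have B: "P x \<le> L + C" for x
  proof -
    have "P x - L \<le> C / ln (exp 1 + norm x)" using LC(2)[of x] by (simp add: fin)
    also have "\<dots> \<le> C / 1" using LC(1) ln_exp_norm[of x] by (intro divide_left_mono) auto
    finally show ?thesis by simp
  qed
  obtain c' where c': "1 < c'" "AE x in lebesgue. c' \<le> p x"
    using p(4) unfolding p_minus_def less_Sup_iff by auto
  obtain c where c: "1 < c" "ereal c < c'"
    using ereal_dense2[OF c'(1)] by auto
  have "AE x in lebesgue. c \<le> P x"
    using c'(2)
  proof eventually_elim
    fix x assume "c' \<le> p x"
    then have "ereal c \<le> ereal (P x)" using c(2) fin[of x] by (metis order.strict_implies_order order_trans)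
    then show "c \<le> P x" by simp
  qed
  then have "c \<le> P x" for x by (rule log_hoelder_AE_ge[OF lh])
  then show thesis using that[OF pP] meas c B lh unfolding real_exponent_def by blast
qed

lemma E0_classI:
  fixes P :: "'a::euclidean_space \<Rightarrow> real"
  assumes "real_exponent P c B"
  shows "(\<lambda>x. ereal (P x)) \<in> E0_class"
proof -
  let ?p = "\<lambda>x. ereal (P x)"
  have P [measurable]: "P \<in> borel_measurable lebesgue" and c: "1 < c" "\<And>x. c \<le> P x" "\<And>x. P x \<le> B"
    and lh: "log_hoelder P"
    using assms by (auto simp: real_exponent_def)
  have 1: "1 \<le> P x" for x using c(1) c(2)[of x] by linarith
  have "ereal c \<le> p_minus ?p"
    unfolding p_minus_def using c by (intro Sup_upper) auto
  moreover have "1 < ereal c" using c(1) by simp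
  ultimately have minus: "1 < p_minus ?p" by (rule less_le_trans[rotated])
  have "p_plus ?p \<le> ereal B"
    unfolding p_plus_def using c by (intro esssup_I) auto
  then have plus: "p_plus ?p < \<infinity>" by (rule order.strict_trans1) simp
  have "p_minus ?p \<le> p_plus ?p"
    unfolding p_minus_def p_plus_def
  proof (rule Sup_least)
    fix z assume "z \<in> {c. AE x in lebesgue. c \<le> ?p x}"
    then have "AE x in lebesgue. z \<le> ?p x" by simp
    from eventually_conj[OF this esssup_AE[of ?p lebesgue]]
    have "AE x::'a in lebesgue. z \<le> esssup lebesgue ?p"
      by (rule eventually_mono) (erule conjE, erule order_trans)
    then show "z \<le> esssup lebesgue ?p"
      by (rule AE_lebesgue_dense[OF _ zero_less_one])
  qed
  then show ?thesis
    using minus plus 1 log_hoelder_imp_LH[OF lh] by (auto simp: E0_class_def exponents_def)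
qed

section \<open>Norms on sets for finite exponents\<close>

lemma modular_real:
  "modular (\<lambda>x. ereal (Q x)) f = (\<integral>\<^sup>+x. ennreal (\<bar>f x\<bar> powr Q x) \<partial>lebesgue)"
proof -
  have "esssup (restrict_space lebesgue {}) (\<lambda>x. ennreal \<bar>f x\<bar>) \<le> 0"
    by (intro esssup_I AE_I2) (auto simp: measurable_def space_restrict_space sets_restrict_space)
  then show ?thesis
    by (simp add: modular_def)
qed

definition norm_on :: "('a::euclidean_space \<Rightarrow> real) \<Rightarrow> ('a \<Rightarrow> real) \<Rightarrow> 'a set \<Rightarrow> ennreal" where
  "norm_on Q f A = Inf {ennreal t |t. 0 < t \<and> density_on (\<lambda>x. (f x / t) powr Q x) A \<le> 1}"

text \<open>Outside \<open>A\<close> the function vanishes and \<open>0 powr Q x = 0\<close>, so the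
  modular over the whole space is an integral over \<open>A\<close>. The norm ignores null sets,
  which allows a weight to be replaced by an everywhere positive version.\<close>

lemma Lp_norm_eq_norm_on:
  assumes "\<And>x. 0 < f x" "AE x in lebesgue. g x = f x"
  shows "Lp_norm (\<lambda>x. ereal (Q x)) (\<lambda>x. g x * indicator A x) = norm_on Q f A"
proof -
  have "modular (\<lambda>x. ereal (Q x)) (\<lambda>x. g x * indicator A x / t) = density_on (\<lambda>x. (f x / t) powr Q x) A"
    if "0 < t" for t
    unfolding modular_real density_on_def
  proof (rule nn_integral_cong_AE)
    show "AE x in lebesgue. ennreal (\<bar>g x * indicator A x / t\<bar> powr Q x) = ennreal ((f x / t) powr Q x) * indicator A x"
      using assms(2)
    proof eventually_elim
      fix x assume "g x = f x"
      then show "ennreal (\<bar>g x * indicator A x / t\<bar> powr Q x) = ennreal ((f x / t) powr Q x) * indicator A x"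
        using assms(1)[of x] that by (auto simp: indicator_def)
    qed
  qed
  then show ?thesis
    unfolding Lp_norm_def norm_on_def by (intro arg_cong[of _ _ Inf]) auto
qed

lemma norm_on_le:
  "0 < t \<Longrightarrow> density_on (\<lambda>x. (f x / t) powr Q x) A \<le> 1 \<Longrightarrow> norm_on Q f A \<le> ennreal t"
  unfolding norm_on_def by (intro Inf_lower) auto

text \<open>Every admissible \<open>t\<close> is bounded below by a positive quantity: either
  \<open>t > 1\<close>, or \<open>t\<close> is at least the integral of
  \<open>min 1 (f x) powr B\<close>, which is positive because \<open>f\<close> is.\<close>

lemma norm_on_pos:
  fixes Q f :: "'a::euclidean_space \<Rightarrow> real"
  assumes [measurable]: "Q \<in> borel_measurable lebesgue" "f \<in> borel_measurable lebesgue"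
    and f: "\<And>x. 0 < f x" and Q: "\<And>x. 1 \<le> Q x" "\<And>x. Q x \<le> B" and l: "0 < l"
  shows "0 < norm_on Q f (cube a l)"
proof -
  define I where "I = density_on (\<lambda>x. min 1 (f x) powr B) (cube a l)"
  have [measurable]: "(\<lambda>x. min 1 (f x) powr B) \<in> borel_measurable lebesgue"
    by measurable
  have min_pos: "min 1 (f x) \<noteq> 0" for x
    using f[of x] by (simp add: min_def)
  have I0: "I \<noteq> 0"
  proof
    assume "I = 0"
    moreover have "(\<lambda>x. ennreal (min 1 (f x) powr B) * indicator (cube a l) x) \<in> borel_measurable lebesgue"
      by (intro borel_measurable_times_ennreal borel_measurable_indicator measurable_compose[OF _ measurable_ennreal]) auto
    ultimately have "AE x in lebesgue. ennreal (min 1 (f x) powr B) * indicator (cube a l) x = 0"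
      unfolding I_def density_on_def by (simp only: nn_integral_0_iff_AE)
    then have "AE x in lebesgue. x \<notin> cube a l"
      by eventually_elim (auto simp: indicator_def min_pos split: if_splits)
    then have "cube a l \<in> null_sets lebesgue"
      by (subst (asm) AE_iff_null_sets[symmetric]) auto
    then have "emeasure lebesgue (cube a l) = 0" by (rule null_setsD1)
    then show False unfolding emeasure_cube[OF l] using l by simp
  qed
  have "min 1 I \<le> ennreal t" if t: "0 < t" "density_on (\<lambda>x. (f x / t) powr Q x) (cube a l) \<le> 1" for t
  proof (cases "t \<le> 1")
    case False
    then show ?thesis by (auto simp: min_le_iff_disj)
  next
    case True
    have pw: "min 1 (f x) powr B \<le> t * (f x / t) powr Q x" for x
    proof -
      have "min 1 (f x) powr B \<le> min 1 (f x) powr Q x"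
        using f[of x] Q by (intro powr_mono') auto
      also have "\<dots> \<le> f x powr Q x"
        using f[of x] Q(1)[of x] by (intro powr_mono2) auto
      also have "\<dots> = t powr Q x * (f x / t) powr Q x"
        using t by (simp add: powr_mult[symmetric])
      also have "\<dots> \<le> t * (f x / t) powr Q x"
        using powr_mono'[of 1 "Q x" t] t True Q(1)[of x] by (intro mult_right_mono) auto
      finally show ?thesis .
    qed
    have "I \<le> density_on (\<lambda>x. t * (f x / t) powr Q x) (cube a l)"
      unfolding I_def using pw by (rule density_on_mono_fun)
    also have "\<dots> = ennreal t * density_on (\<lambda>x. (f x / t) powr Q x) (cube a l)"
      using t by (intro density_on_cmult) auto
    also have "\<dots> \<le> ennreal t * 1" by (intro mult_left_mono t) simp
    finally show ?thesis by (simp add: min_le_iff_disj)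
  qed
  then have "min 1 I \<le> norm_on Q f (cube a l)"
    unfolding norm_on_def by (intro Inf_greatest) auto
  moreover have "0 < min 1 I" using I0 by (simp add: min_def zero_less_iff_neq_zero)
  ultimately show ?thesis by (rule less_le_trans[rotated])
qed

text \<open>The infimum is attained. For each \<open>u > 1\<close> some admissible \<open>t\<close>
  lies below \<open>n * u\<close>, which bounds the modular at \<open>n\<close> by
  \<open>u powr B\<close>; then \<open>u\<close> tends to 1.\<close>

lemma norm_on_ball:
  fixes Q f :: "'a::euclidean_space \<Rightarrow> real"
  assumes [measurable]: "Q \<in> borel_measurable lebesgue" "f \<in> borel_measurable lebesgue" "A \<in> sets lebesgue"
    and f: "\<And>x. 0 < f x" and Q: "\<And>x. 1 \<le> Q x" "\<And>x. Q x \<le> B"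
    and n: "norm_on Q f A = ennreal n" "0 < n"
  shows "density_on (\<lambda>x. (f x / n) powr Q x) A \<le> 1"
proof -
  have bound: "density_on (\<lambda>x. (f x / n) powr Q x) A \<le> ennreal (u powr B)" if u: "1 < u" for u
  proof -
    have "norm_on Q f A < ennreal (n * u)" using n u by (simp add: ennreal_lessI)
    then obtain t where t: "0 < t" "t < n * u" "density_on (\<lambda>x. (f x / t) powr Q x) A \<le> 1"
      unfolding norm_on_def Inf_less_iff using n by (auto simp: ennreal_less_iff)
    have pw: "(f x / n) powr Q x \<le> u powr B * (f x / t) powr Q x" for x
    proof -
      have "f x / n \<le> u * (f x / t)" using t f[of x] n by (simp add: field_simps)
      then have "(f x / n) powr Q x \<le> (u * (f x / t)) powr Q x"
        using f[of x] n Q(1)[of x] by (intro powr_mono2) auto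
      also have "\<dots> = u powr Q x * (f x / t) powr Q x" by (rule powr_mult)
      also have "\<dots> \<le> u powr B * (f x / t) powr Q x"
        using u Q by (intro mult_right_mono powr_mono) auto
      finally show ?thesis .
    qed
    have "density_on (\<lambda>x. (f x / n) powr Q x) A \<le> density_on (\<lambda>x. u powr B * (f x / t) powr Q x) A"
      using pw by (rule density_on_mono_fun)
    also have "\<dots> = ennreal (u powr B) * density_on (\<lambda>x. (f x / t) powr Q x) A"
      by (intro density_on_cmult) auto
    also have "\<dots> \<le> ennreal (u powr B) * 1" by (intro mult_left_mono t) simp
    finally show ?thesis by simp
  qed
  show ?thesis
  proof (rule tendsto_lowerbound)
    have "((\<lambda>u. u powr B) \<longlongrightarrow> 1 powr B) (at_right (1::real))"
      by (intro tendsto_intros) auto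
    then show "((\<lambda>u. ennreal (u powr B)) \<longlongrightarrow> 1) (at_right (1::real))"
      using tendsto_ennrealI by fastforce
    show "\<forall>\<^sub>F u in at_right 1. density_on (\<lambda>x. (f x / n) powr Q x) A \<le> ennreal (u powr B)"
      using bound by (auto simp: eventually_at_filter)
  qed simp
qed

section \<open>The endpoint exponents and weight\<close>

lemma conj_exponent_real:
  assumes "\<And>x. 1 < P x"
  shows "conj_exponent (\<lambda>x. ereal (P x)) = (\<lambda>x. ereal (1 / (1 - 1 / P x)))"
proof
  fix x
  have "1 / ereal (P x) = ereal (1 / P x)" "P x \<noteq> 0" "1 - 1 / P x \<noteq> 0"
    using assms[of x] by (auto simp: one_ereal_def)
  then show "conj_exponent (\<lambda>x. ereal (P x)) x = ereal (1 / (1 - 1 / P x))"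
    by (simp add: conj_exponent_def one_ereal_def)
qed

lemma ereal_exponent_diff:
  assumes "0 < P" "0 < Q"
  shows "1 / ereal P - 1 / ereal Q = ereal \<gamma> \<longleftrightarrow> 1 / P - 1 / Q = \<gamma>"
  using assms by (simp add: one_ereal_def)

lemma weighted_Lp_norm_pair:
  fixes Q w :: "'a::euclidean_space \<Rightarrow> real"
  assumes Q: "Q \<in> borel_measurable lebesgue" "\<And>x. 1 \<le> Q x" "\<And>x. Q x \<le> B"
    and w: "w \<in> borel_measurable lebesgue" "\<And>x. 0 < w x"
    and l: "0 < l" and fin: "norm_on Q w (cube a l) < \<infinity>"
  defines "N A \<equiv> enn2real (norm_on Q w A)"
  shows "norm_on Q w (cube a l) = ennreal (N (cube a l))" "0 < N (cube a l)"
    "density_on (\<lambda>x. (w x / N (cube a l)) powr Q x) (cube a l) \<le> 1"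
    "0 < t \<Longrightarrow> density_on (\<lambda>x. (w x / t) powr Q x) (cube a l) \<le> 1 \<Longrightarrow> N (cube a l) \<le> t"
proof -
  show 1: "norm_on Q w (cube a l) = ennreal (N (cube a l))"
    using fin by (simp add: N_def)
  have "0 < norm_on Q w (cube a l)" by (rule norm_on_pos[OF Q(1) w Q(2,3) l])
  then show 2: "0 < N (cube a l)" using 1 by simp
  show "density_on (\<lambda>x. (w x / N (cube a l)) powr Q x) (cube a l) \<le> 1"
    by (rule norm_on_ball[OF Q(1) w(1) _ w(2) Q(2,3) 1 2]) simp
  show "N (cube a l) \<le> t" if "0 < t" "density_on (\<lambda>x. (w x / t) powr Q x) (cube a l) \<le> 1"
    using norm_on_le[OF that] that(1) by (simp add: 1)
qed

text \<open>
  Both orders of the pair satisfy the locale, so that the self-improvement applies to \<open>w\<close> and to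
  its inverse.
\<close>

lemma dual_weight_pair_of_A_class:
  fixes P Q w :: "'a::euclidean_space \<Rightarrow> real"
  assumes P: "real_exponent P c\<^sub>P B\<^sub>P" and Q: "real_exponent Q c\<^sub>Q B\<^sub>Q"
    and PQ: "\<And>x. 1 / P x - 1 / Q x = \<gamma>"
    and w: "w \<in> A_class \<gamma> (\<lambda>x. ereal (P x)) (\<lambda>x. ereal (Q x))"
  defines "S \<equiv> \<lambda>x. 1 / (1 - 1 / P x)"
  obtains w' N M K B H where
    "dual_weight_pair Q S w' N M (1 - \<gamma>) K B H"
    "dual_weight_pair S Q (\<lambda>x. 1 / w' x) M N (1 - \<gamma>) K B H"
    "AE x in lebesgue. w x = w' x"
proof -
  have P' [measurable]: "P \<in> borel_measurable lebesgue" and cP: "1 < c\<^sub>P" "\<And>x. c\<^sub>P \<le> P x" "\<And>x. P x \<le> B\<^sub>P"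
    and lhP: "log_hoelder P" using P by (auto simp: real_exponent_def)
  have Q' [measurable]: "Q \<in> borel_measurable lebesgue" and cQ: "1 < c\<^sub>Q" "\<And>x. c\<^sub>Q \<le> Q x" "\<And>x. Q x \<le> B\<^sub>Q"
    and lhQ: "log_hoelder Q" using Q by (auto simp: real_exponent_def)
  have P1: "1 < P x" for x using cP(1) cP(2)[of x] by linarith
  have Q1: "1 \<le> Q x" for x using cQ(1) cQ(2)[of x] by linarith
  have S_meas [measurable]: "S \<in> borel_measurable lebesgue" unfolding S_def by measurable
  have S_eq: "S x = P x / (P x - 1)" for x using P1[of x] by (simp add: S_def field_simps)
  have S1: "1 \<le> S x" for x using P1[of x] by (simp add: S_eq)
  have S_eq': "S x = 1 + 1 / (P x - 1)" for x using P1[of x] by (simp add: S_eq field_simps)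
  have SB: "S x \<le> 1 + 1 / (c\<^sub>P - 1)" for x
    unfolding S_eq' using P1[of x] cP(1) cP(2)[of x] by (intro add_left_mono divide_left_mono) auto
  have lhS: "log_hoelder S"
  proof (rule log_hoelder_dominated[OF lhP lhP])
    show "0 \<le> 1 / (c\<^sub>P - 1)\<^sup>2" by simp
    fix x y
    have px: "0 < P x - 1" "0 < P y - 1" using P1 by auto
    have "S x - S y = (P y - P x) / ((P x - 1) * (P y - 1))"
      unfolding S_eq' using px by (simp add: field_simps)
    then have "\<bar>S x - S y\<bar> = \<bar>P x - P y\<bar> / ((P x - 1) * (P y - 1))"
      using px by (simp add: abs_mult abs_minus_commute)
    also have "\<dots> \<le> \<bar>P x - P y\<bar> / ((c\<^sub>P - 1) * (c\<^sub>P - 1))"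
      using px cP by (intro divide_left_mono mult_mono mult_pos_pos) auto
    also have "\<dots> \<le> 1 / (c\<^sub>P - 1)\<^sup>2 * (\<bar>P x - P y\<bar> + \<bar>P x - P y\<bar>)"
      using cP(1) by (simp add: power2_eq_square divide_right_mono)
    finally show "\<bar>S x - S y\<bar> \<le> 1 / (c\<^sub>P - 1)\<^sup>2 * (\<bar>P x - P y\<bar> + \<bar>P x - P y\<bar>)" .
  qed
  have dual: "1 / Q x + 1 / S x = 1 - \<gamma>" for x
    using PQ[of x] by (simp add: S_def)
  obtain H\<^sub>1 where H1: "\<And>x y. 0 < norm (x - y) \<Longrightarrow> norm (x - y) < 1 / 2 \<Longrightarrow> \<bar>Q x - Q y\<bar> * - ln (norm (x - y)) \<le> H\<^sub>1"
      "\<And>x y. norm x \<le> norm y \<Longrightarrow> \<bar>Q x - Q y\<bar> * ln (exp 1 + norm x) \<le> H\<^sub>1"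
    using lhQ unfolding log_hoelder_def by blast
  obtain H\<^sub>2 where H2: "\<And>x y. 0 < norm (x - y) \<Longrightarrow> norm (x - y) < 1 / 2 \<Longrightarrow> \<bar>S x - S y\<bar> * - ln (norm (x - y)) \<le> H\<^sub>2"
      "\<And>x y. norm x \<le> norm y \<Longrightarrow> \<bar>S x - S y\<bar> * ln (exp 1 + norm x) \<le> H\<^sub>2"
    using lhS unfolding log_hoelder_def by blast
  define B where "B = max B\<^sub>Q (1 + 1 / (c\<^sub>P - 1))"
  define H where "H = max H\<^sub>1 H\<^sub>2"
  have w_meas [measurable]: "w \<in> borel_measurable lebesgue" and w_pos: "AE x in lebesgue. 0 < w x"
    and A: "A_const \<gamma> (\<lambda>x. ereal (P x)) (\<lambda>x. ereal (Q x)) w < \<infinity>"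
    using w by (auto simp: A_class_def weight_def)
  \<comment> \<open>An everywhere positive version of the weight, changed only on a null
    set.\<close>
  define w' where "w' x = (if 0 < w x then w x else 1)" for x
  have w'_meas [measurable]: "w' \<in> borel_measurable lebesgue" unfolding w'_def by measurable
  have w'_pos: "0 < w' x" for x by (simp add: w'_def)
  have ae: "AE x in lebesgue. w x = w' x"
    using w_pos by eventually_elim (simp add: w'_def)
  let ?n = "\<lambda>A. norm_on Q w' A" and ?m = "\<lambda>A. norm_on S (\<lambda>x. 1 / w' x) A"
  have Lq: "Lp_norm (\<lambda>x. ereal (Q x)) (\<lambda>x. w x * indicator A x) = ?n A" for A
    by (rule Lp_norm_eq_norm_on[OF w'_pos ae])
  have Ls: "Lp_norm (conj_exponent (\<lambda>x. ereal (P x))) (\<lambda>x. inverse (w x) * indicator A x) = ?m A" for A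
    unfolding conj_exponent_real[OF P1] S_def
    by (rule Lp_norm_eq_norm_on) (use ae w'_pos in \<open>auto simp: inverse_eq_divide elim: eventually_mono\<close>)
  obtain K where K: "A_const \<gamma> (\<lambda>x. ereal (P x)) (\<lambda>x. ereal (Q x)) w = ennreal K" "0 \<le> K"
    using A by (cases "A_const \<gamma> (\<lambda>x. ereal (P x)) (\<lambda>x. ereal (Q x)) w") auto
  have bound: "ennreal ((l ^ DIM('a)) powr (\<gamma> - 1)) * ?n (cube a l) * ?m (cube a l) \<le> ennreal K"
    if l: "0 < l" for a l
  proof -
    have "cube a l \<in> cubes" using l unfolding cubes_def by blast
    then have "ennreal (measure lebesgue (cube a l) powr (\<gamma> - 1))
        * Lp_norm (\<lambda>x. ereal (Q x)) (\<lambda>x. w x * indicator (cube a l) x)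
        * Lp_norm (conj_exponent (\<lambda>x. ereal (P x))) (\<lambda>x. inverse (w x) * indicator (cube a l) x) \<le> ennreal K"
      unfolding K(1)[symmetric] A_const_def by (rule SUP_upper)
    then show ?thesis
      unfolding Lq Ls using l by (simp only: cube_measure less_imp_le)
  qed
  have npos: "0 < ?n (cube a l)" if "0 < l" for a l
    by (rule norm_on_pos[OF Q' w'_meas w'_pos Q1 cQ(3) that])
  have mpos: "0 < ?m (cube a l)" if "0 < l" for a l
    by (rule norm_on_pos[OF S_meas _ _ S1 SB that]) (use w'_pos in auto)
  \<comment> \<open>The product of the norms is finite and both factors are positive, so neither can
    be infinite.\<close>
  have nfin: "?n (cube a l) < \<infinity>" and mfin: "?m (cube a l) < \<infinity>" if l: "0 < l" for a l
  proof -
    have "ennreal ((l ^ DIM('a)) powr (\<gamma> - 1)) * ?n (cube a l) * ?m (cube a l) < \<infinity>"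
      by (rule order.strict_trans1[OF bound[OF l]]) simp
    moreover have "0 < (l ^ DIM('a)) powr (\<gamma> - 1)" using l by simp
    ultimately show "?n (cube a l) < \<infinity>" "?m (cube a l) < \<infinity>"
      using npos[OF l, of a] mpos[OF l, of a]
      by (auto simp: ennreal_mult_less_top ennreal_eq_0_iff less_top[symmetric] ennreal_mult_eq_top_iff)
  qed
  define N where "N A = enn2real (?n A)" for A
  define M where "M A = enn2real (?m A)" for A
  note Nprops = weighted_Lp_norm_pair[OF Q' Q1 cQ(3) w'_meas w'_pos _ nfin, folded N_def]
  have inv: "(\<lambda>x. 1 / w' x) \<in> borel_measurable lebesgue" "\<And>x. 0 < 1 / w' x" using w'_pos by auto
  note Mprops = weighted_Lp_norm_pair[OF S_meas S1 SB inv _ mfin, folded M_def]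
  have NM: "N (cube a l) * M (cube a l) \<le> K * (l ^ DIM('a)) powr (1 - \<gamma>)" if l: "0 < l" for a l
  proof -
    have "ennreal ((l ^ DIM('a)) powr (\<gamma> - 1) * N (cube a l) * M (cube a l)) \<le> ennreal K"
      using bound[OF l, of a] Nprops(2)[OF l l, of a] Mprops(2)[OF l l, of a]
      unfolding Nprops(1)[OF l l] Mprops(1)[OF l l] by (simp add: ennreal_mult)
    then have "(l ^ DIM('a)) powr (\<gamma> - 1) * N (cube a l) * M (cube a l) \<le> K"
      using K(2) by simp
    then have "(l ^ DIM('a)) powr (1 - \<gamma>) * ((l ^ DIM('a)) powr (\<gamma> - 1) * N (cube a l) * M (cube a l))
        \<le> (l ^ DIM('a)) powr (1 - \<gamma>) * K"
      by (intro mult_left_mono) auto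
    moreover have "(l ^ DIM('a)) powr (1 - \<gamma>) * (l ^ DIM('a)) powr (\<gamma> - 1) = 1"
      using l by (simp add: powr_add[symmetric])
    ultimately show ?thesis by (simp add: mult.assoc[symmetric] mult.commute[of K])
  qed
  have div: "1 / w' x / t = 1 / (w' x * t)" for x t by simp
  show thesis
  proof (rule that[of w' N M K B H])
    show "dual_weight_pair Q S w' N M (1 - \<gamma>) K B H"
    proof (unfold_locales, goal_cases)
      case 9 then show ?case using Nprops by blast
    qed (use Q1 cQ(3) S1 dual w'_pos Nprops Mprops[unfolded div] NM H1 H2 in
        \<open>auto simp: B_def H_def le_max_iff_disj\<close>)
    show "dual_weight_pair S Q (\<lambda>x. 1 / w' x) M N (1 - \<gamma>) K B H"
      by unfold_locales (use Q1 SB S1 dual w'_pos Nprops Mprops NM H1 H2 in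
        \<open>auto simp: B_def H_def le_max_iff_disj add.commute mult.commute\<close>)
    show "AE x in lebesgue. w x = w' x" by (rule ae)
  qed
qed

text \<open>Hoelder's inequality in modular form. Up to (1/2)^Q the integrand is X^\<mu> Y^\<kappa>
  with \<mu> + \<kappa> = 1, hence at most X + Y; the 2 in the denominator pays for the two unit
  balls.\<close>

lemma density_on_interpolation:
  fixes f g Q u s :: "'a::euclidean_space \<Rightarrow> real"
  assumes \<theta>: "0 < \<theta>" "\<theta> < 1"
    and f: "f \<in> borel_measurable lebesgue" "\<And>x. 0 < f x"
    and g: "g \<in> borel_measurable lebesgue" "\<And>x. 0 < g x"
    and meas: "u \<in> borel_measurable lebesgue" "s \<in> borel_measurable lebesgue" "A \<in> sets lebesgue"
    and Q: "\<And>x. 1 \<le> Q x" and us: "\<And>x. 0 < u x" "\<And>x. 0 < s x"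
    and rel: "\<And>x. (1 - \<theta>) / Q x = 1 / u x + \<theta> / s x"
    and U: "0 < U" "density_on (\<lambda>x. (f x / U) powr u x) A \<le> 1"
    and m: "0 < m" "density_on (\<lambda>x. (g x / m) powr s x) A \<le> 1"
  shows "density_on (\<lambda>x. (f x powr (1 / (1 - \<theta>)) * g x powr (\<theta> / (1 - \<theta>))
      / (2 * (U powr (1 / (1 - \<theta>)) * m powr (\<theta> / (1 - \<theta>))))) powr Q x) A \<le> 1"
proof -
  note [measurable] = f(1) g(1) meas
  have pw: "(f x powr (1 / (1 - \<theta>)) * g x powr (\<theta> / (1 - \<theta>))
      / (2 * (U powr (1 / (1 - \<theta>)) * m powr (\<theta> / (1 - \<theta>))))) powr Q x
      \<le> 1 / 2 * ((f x / U) powr u x + (g x / m) powr s x)" for x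
  proof -
    define X where "X = (f x / U) powr u x"
    define Y where "Y = (g x / m) powr s x"
    define \<mu> where "\<mu> = Q x / ((1 - \<theta>) * u x)"
    define \<kappa> where "\<kappa> = \<theta> * Q x / ((1 - \<theta>) * s x)"
    define Z where "Z = max X Y"
    have XY: "0 < X" "0 < Y" using f(2)[of x] g(2)[of x] U m by (auto simp: X_def Y_def)
    have Qx: "1 \<le> Q x" "0 < u x" "0 < s x" using Q us by auto
    have sum: "\<mu> + \<kappa> = 1"
    proof -
      have "\<mu> + \<kappa> = Q x / (1 - \<theta>) * (1 / u x + \<theta> / s x)"
        by (simp add: \<mu>_def \<kappa>_def algebra_simps)
      also have "\<dots> = 1" unfolding rel[symmetric] using Qx \<theta> by simp
      finally show ?thesis .
    qed
    have lk: "0 \<le> \<mu>" "0 \<le> \<kappa>" using Qx \<theta> by (auto simp: \<mu>_def \<kappa>_def)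
    have X: "X powr \<mu> = (f x / U) powr (1 / (1 - \<theta>) * Q x)"
    proof -
      have "u x * \<mu> = 1 / (1 - \<theta>) * Q x" using Qx by (simp add: \<mu>_def)
      then show ?thesis unfolding X_def powr_powr by simp
    qed
    have Y: "Y powr \<kappa> = (g x / m) powr (\<theta> / (1 - \<theta>) * Q x)"
    proof -
      have "s x * \<kappa> = \<theta> / (1 - \<theta>) * Q x" using Qx by (simp add: \<kappa>_def)
      then show ?thesis unfolding Y_def powr_powr by simp
    qed
    have "f x powr (1 / (1 - \<theta>)) * g x powr (\<theta> / (1 - \<theta>))
      / (2 * (U powr (1 / (1 - \<theta>)) * m powr (\<theta> / (1 - \<theta>))))
      = 1 / 2 * ((f x / U) powr (1 / (1 - \<theta>)) * (g x / m) powr (\<theta> / (1 - \<theta>)))"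
      by (simp add: powr_divide)
    then have "(f x powr (1 / (1 - \<theta>)) * g x powr (\<theta> / (1 - \<theta>))
      / (2 * (U powr (1 / (1 - \<theta>)) * m powr (\<theta> / (1 - \<theta>))))) powr Q x
      = (1 / 2) powr Q x * (X powr \<mu> * Y powr \<kappa>)"
      unfolding X Y by (simp only: powr_mult powr_powr)
    also have "\<dots> \<le> (1 / 2) powr Q x * (Z powr \<mu> * Z powr \<kappa>)"
      using XY lk by (intro mult_left_mono mult_mono powr_mono2) (auto simp: Z_def)
    also have "Z powr \<mu> * Z powr \<kappa> = Z"
      using XY by (simp add: powr_add[symmetric] sum Z_def)
    also have "(1 / 2) powr Q x * Z \<le> 1 / 2 * (X + Y)"
      using powr_mono'[of 1 "Q x" "1 / 2 :: real"] Qx XY by (intro mult_mono) (auto simp: Z_def)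
    finally show ?thesis by (simp add: X_def Y_def)
  qed
  have "density_on (\<lambda>x. (f x powr (1 / (1 - \<theta>)) * g x powr (\<theta> / (1 - \<theta>))
      / (2 * (U powr (1 / (1 - \<theta>)) * m powr (\<theta> / (1 - \<theta>))))) powr Q x) A
      \<le> density_on (\<lambda>x. 1 / 2 * ((f x / U) powr u x + (g x / m) powr s x)) A"
    using pw by (rule density_on_mono_fun)
  also have "\<dots> = ennreal (1 / 2) * density_on (\<lambda>x. (f x / U) powr u x + (g x / m) powr s x) A"
    by (intro density_on_cmult) auto
  also have "density_on (\<lambda>x. (f x / U) powr u x + (g x / m) powr s x) A
      = density_on (\<lambda>x. (f x / U) powr u x) A + density_on (\<lambda>x. (g x / m) powr s x) A"
    by (intro density_on_add) auto
  also have "ennreal (1 / 2) * \<dots> \<le> ennreal (1 / 2) * (1 + 1)"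
    by (intro mult_left_mono add_mono U m) simp
  also have "\<dots> = 1"
  proof -
    have "ennreal (1 / 2) * (1 + 1) = ennreal (1 / 2) * ennreal 2" by simp
    also have "\<dots> = ennreal (1 / 2 * 2)" by (rule ennreal_mult[symmetric]) auto
    finally show ?thesis by simp
  qed
  finally show ?thesis .
qed

section \<open>Endpoint exponents and the weight condition at the endpoint\<close>

definition "endpoint_exponent \<theta> P P\<^sub>1 = (\<lambda>x. (1 - \<theta>) / (1 / P x - \<theta> / P\<^sub>1 x) :: real)"

text \<open>As \<theta> B is below 1, the difference 1/P - \<theta>/P_1 is positive (P_1 being
  \<open>P\<^sub>1\<close>). This excludes infinite \<open>z\<close>, for which the term with
  \<open>z\<close> would vanish.\<close>

lemma endpoint_exponent_iff:
  fixes z :: ereal and P P\<^sub>1 \<theta> B :: real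
  assumes "1 < P" "P \<le> B" "1 < P\<^sub>1" "0 < \<theta>" "\<theta> < 1" "\<theta> * B < 1"
  shows "1 / ereal P = ereal (1 - \<theta>) / z + ereal \<theta> / ereal P\<^sub>1
    \<longleftrightarrow> z = ereal ((1 - \<theta>) / (1 / P - \<theta> / P\<^sub>1))"
proof -
  have "\<theta> * P < 1" using assms mult_left_mono[of P B \<theta>] by linarith
  then have "\<theta> < 1 / P" using assms by (simp add: field_simps)
  moreover have "\<theta> / P\<^sub>1 < \<theta>" using assms by (simp add: field_simps)
  ultimately have pos: "0 < 1 / P - \<theta> / P\<^sub>1" by linarith
  show ?thesis
  proof (cases z)
    case (real r)
    show ?thesis
    proof (cases "r = 0")
      \<comment> \<open>In \<open>ereal\<close> a positive number divided by 0 is \<infinity>, so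
        the right side is infinite and cannot equal \<open>1 / P\<close>.\<close>
      case True
      then show ?thesis using real assms pos by (simp add: one_ereal_def)
    next
      case False
      have "1 / P = (1 - \<theta>) / r + \<theta> / P\<^sub>1 \<longleftrightarrow> (1 - \<theta>) / r = 1 / P - \<theta> / P\<^sub>1" by auto
      also have "\<dots> \<longleftrightarrow> r = (1 - \<theta>) / (1 / P - \<theta> / P\<^sub>1)"
        using pos False by (metis (no_types, lifting) divide_divide_eq_left' divide_eq_eq less_irrefl mult.commute nonzero_eq_divide_eq)
      finally show ?thesis using real assms False by (simp add: one_ereal_def)
    qed
  qed (use assms pos in \<open>auto simp: one_ereal_def\<close>)
qed

text \<open>The bound by \<open>1 / (2 * B)\<close> keeps the denominator at least
  \<open>1 / (2 * B)\<close>. The other bound keeps 1 - \<theta> at least (1 + 1/c) / 2, so the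
  quotient stays above (c + 1) / 2, which is larger than 1.\<close>

lemma real_exponent_endpoint:
  fixes P P\<^sub>1 :: "'a::euclidean_space \<Rightarrow> real"
  assumes P: "real_exponent P c B" and P1: "real_exponent P\<^sub>1 c\<^sub>1 B\<^sub>1"
    and \<theta>: "0 < \<theta>" "\<theta> \<le> (1 - 1 / c) / 2" "\<theta> \<le> 1 / (2 * B)"
  shows "real_exponent (endpoint_exponent \<theta> P P\<^sub>1) ((c + 1) / 2) (2 * B)"
proof -
  let ?E = "endpoint_exponent \<theta> P P\<^sub>1"
  have [measurable]: "P \<in> borel_measurable lebesgue" "P\<^sub>1 \<in> borel_measurable lebesgue"
    and c: "1 < c" "\<And>x. c \<le> P x" "\<And>x. P x \<le> B" "log_hoelder P"
    and c1: "1 < c\<^sub>1" "\<And>x. c\<^sub>1 \<le> P\<^sub>1 x" "log_hoelder P\<^sub>1"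
    using P P1 by (auto simp: real_exponent_def)
  have B: "1 < B" using c(1) c(2,3)[of undefined] by linarith
  have gt: "1 < P x" "1 < P\<^sub>1 x" for x using c(1) c(2)[of x] c1(1) c1(2)[of x] by auto
  have "0 < 1 / c" using c(1) by simp
  then have th: "\<theta> \<le> 1 / 2" using \<theta>(2) by argo
  have den: "1 / (2 * B) \<le> 1 / P x - \<theta> / P\<^sub>1 x" "1 / P x - \<theta> / P\<^sub>1 x \<le> 1 / c" for x
  proof -
    have "\<theta> / P\<^sub>1 x \<le> \<theta>" using \<theta>(1) gt[of x] by (simp add: field_simps)
    moreover have "1 / B \<le> 1 / P x" using c(3)[of x] gt[of x] by (intro divide_left_mono) auto
    moreover have "1 / B - 1 / (2 * B) = 1 / (2 * B)" using B by (simp add: field_simps)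
    ultimately show "1 / (2 * B) \<le> 1 / P x - \<theta> / P\<^sub>1 x" using \<theta>(3) by linarith
    have "1 / P x \<le> 1 / c" using c gt[of x] by (intro divide_left_mono) auto
    moreover have "0 \<le> \<theta> / P\<^sub>1 x" using \<theta>(1) gt[of x] by simp
    ultimately show "1 / P x - \<theta> / P\<^sub>1 x \<le> 1 / c" by linarith
  qed
  have den_pos: "0 < 1 / P x - \<theta> / P\<^sub>1 x" for x
    using den(1)[of x] B by (meson less_le_trans divide_pos_pos mult_pos_pos zero_less_one zero_less_numeral order.strict_trans)
  have up: "?E x \<le> 2 * B" for x
  proof -
    have "?E x \<le> 1 / (1 / (2 * B))"
      unfolding endpoint_exponent_def using den(1)[of x] \<theta>(1) th B by (intro frac_le) auto
    then show ?thesis by simp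
  qed
  have lo: "(c + 1) / 2 \<le> ?E x" for x
  proof -
    have "(1 + 1 / c) / 2 / (1 / c) \<le> ?E x"
      unfolding endpoint_exponent_def using den(2)[of x] den_pos[of x] \<theta>(2) th c(1)
      by (intro frac_le) (auto simp: field_simps)
    moreover have "(1 + 1 / c) / 2 / (1 / c) = (c + 1) / 2" using c(1) by (simp add: field_simps)
    ultimately show ?thesis by simp
  qed
  have lip: "\<bar>1 / X - 1 / Y\<bar> \<le> \<bar>X - Y\<bar>" if "1 < X" "1 < Y" for X Y :: real
  proof -
    have "1 / X - 1 / Y = (Y - X) / (X * Y)" using that by (simp add: field_simps)
    then have "\<bar>1 / X - 1 / Y\<bar> = \<bar>X - Y\<bar> / (X * Y)"
      using that by (simp add: abs_mult abs_minus_commute)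
    also have "\<dots> \<le> \<bar>X - Y\<bar> / 1"
      using that mult_mono[of 1 X 1 Y] by (intro divide_left_mono) auto
    finally show ?thesis by simp
  qed
  have "log_hoelder ?E"
  proof (rule log_hoelder_dominated[OF c(4) c1(3)])
    show "0 \<le> (2 * B) * (2 * B)" using B by simp
    fix x y
    let ?X = "1 / P x - \<theta> / P\<^sub>1 x" and ?Y = "1 / P y - \<theta> / P\<^sub>1 y"
    have "?E x - ?E y = (1 - \<theta>) * (?Y - ?X) * (1 / ?X * (1 / ?Y))"
      unfolding endpoint_exponent_def using den_pos[of x] den_pos[of y] by (simp add: divide_simps) (simp add: algebra_simps)
    then have "\<bar>?E x - ?E y\<bar> = (1 - \<theta>) * \<bar>?Y - ?X\<bar> * (1 / ?X * (1 / ?Y))"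
      using den_pos[of x] den_pos[of y] th by (simp only: abs_mult) simp
    also have "\<dots> \<le> 1 * (\<bar>P x - P y\<bar> + \<bar>P\<^sub>1 x - P\<^sub>1 y\<bar>) * ((2 * B) * (2 * B))"
    proof (intro mult_mono)
      have "?Y - ?X = (1 / P y - 1 / P x) - \<theta> * (1 / P\<^sub>1 y - 1 / P\<^sub>1 x)" by (simp add: algebra_simps)
      then have "\<bar>?Y - ?X\<bar> \<le> \<bar>1 / P y - 1 / P x\<bar> + \<bar>\<theta> * (1 / P\<^sub>1 y - 1 / P\<^sub>1 x)\<bar>" by linarith
      also have "\<bar>\<theta> * (1 / P\<^sub>1 y - 1 / P\<^sub>1 x)\<bar> \<le> 1 * \<bar>1 / P\<^sub>1 y - 1 / P\<^sub>1 x\<bar>"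
        unfolding abs_mult using \<theta>(1) th by (intro mult_right_mono) auto
      finally show "\<bar>?Y - ?X\<bar> \<le> \<bar>P x - P y\<bar> + \<bar>P\<^sub>1 x - P\<^sub>1 y\<bar>"
        using lip[OF gt(1)[of y] gt(1)[of x]] lip[OF gt(2)[of y] gt(2)[of x]] by (simp add: abs_minus_commute)
      have inv: "1 / (1 / P z - \<theta> / P\<^sub>1 z) \<le> 2 * B" for z
      proof -
        have "1 / (1 / P z - \<theta> / P\<^sub>1 z) \<le> 1 / (1 / (2 * B))"
          using den(1)[of z] B by (intro divide_left_mono mult_pos_pos den_pos) auto
        then show ?thesis by simp
      qed
      show "1 / ?X \<le> 2 * B" "1 / ?Y \<le> 2 * B" by (rule inv)+
    qed (use \<theta>(1) th B den_pos[of x] den_pos[of y] in auto)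
    finally show "\<bar>?E x - ?E y\<bar> \<le> (2 * B) * (2 * B) * (\<bar>P x - P y\<bar> + \<bar>P\<^sub>1 x - P\<^sub>1 y\<bar>)"
      by (simp add: mult.commute)
  qed
  moreover have "?E \<in> borel_measurable lebesgue" unfolding endpoint_exponent_def by measurable
  ultimately show ?thesis
    using up lo c(1) unfolding real_exponent_def by auto
qed

lemma real_exponent_gt: "real_exponent P c B \<Longrightarrow> 1 < P x"
  unfolding real_exponent_def by (meson less_le_trans)

lemma E_classE:
  assumes "(p, q) \<in> E_class \<gamma>"
  obtains P Q c B c' B' where "p = (\<lambda>x. ereal (P x))" "q = (\<lambda>x. ereal (Q x))"
    "real_exponent P c B" "real_exponent Q c' B'" "\<And>x. 1 / P x - 1 / Q x = \<gamma>"
proof -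
  have pq: "p \<in> E0_class" "q \<in> E0_class" "\<And>x. 1 / p x - 1 / q x = ereal \<gamma>"
    using assms by (auto simp: E_class_def)
  obtain P c B where P: "p = (\<lambda>x. ereal (P x))" "real_exponent P c B" by (rule E0_classE[OF pq(1)])
  obtain Q c' B' where Q: "q = (\<lambda>x. ereal (Q x))" "real_exponent Q c' B'" by (rule E0_classE[OF pq(2)])
  have "1 / P x - 1 / Q x = \<gamma>" for x
  proof -
    have "0 < P x" "0 < Q x" using real_exponent_gt[OF P(2), of x] real_exponent_gt[OF Q(2), of x] by auto
    then show ?thesis using pq(3)[of x] ereal_exponent_diff unfolding P(1) Q(1) by blast
  qed
  then show thesis using that P Q by blast
qed

text \<open>Stated for abstract dual pairs: applied to the swapped pairs, it bounds the norm of the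
  inverse weight in the conjugate exponent.\<close>

lemma endpoint_norm_bound:
  fixes q s w q\<^sub>1 s\<^sub>1 w\<^sub>1 q\<^sub>0 :: "'a::euclidean_space \<Rightarrow> real"
  assumes D: "dual_weight_pair q s w N M \<alpha> K B H" and D1: "dual_weight_pair q\<^sub>1 s\<^sub>1 w\<^sub>1 N\<^sub>1 M\<^sub>1 \<alpha> K\<^sub>1 B\<^sub>1 H\<^sub>1"
    and \<theta>: "0 < \<theta>" "\<theta> < 1" and C: "0 < C" and lt: "\<And>x. \<theta> * \<alpha> * q x < 1"
    and improved: "density_on (\<lambda>x. (w x / (C * N (cube a l) * (l ^ DIM('a)) powr (- (\<theta> * \<alpha>))))
        powr (1 / (1 / q x - \<theta> * \<alpha>))) (cube a l) \<le> 1"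
    and q0: "\<And>x. 1 \<le> q\<^sub>0 x" "\<And>x. (1 - \<theta>) / q\<^sub>0 x = 1 / q x - \<theta> / q\<^sub>1 x"
    and l: "0 < l"
  shows "norm_on q\<^sub>0 (\<lambda>x. w x powr (1 / (1 - \<theta>)) * (1 / w\<^sub>1 x) powr (\<theta> / (1 - \<theta>))) (cube a l)
    \<le> ennreal (2 * ((C * N (cube a l) * (l ^ DIM('a)) powr (- (\<theta> * \<alpha>))) powr (1 / (1 - \<theta>))
        * M\<^sub>1 (cube a l) powr (\<theta> / (1 - \<theta>))))"
proof -
  interpret D: dual_weight_pair q s w N M \<alpha> K B H by (rule D)
  interpret D1: dual_weight_pair q\<^sub>1 s\<^sub>1 w\<^sub>1 N\<^sub>1 M\<^sub>1 \<alpha> K\<^sub>1 B\<^sub>1 H\<^sub>1 by (rule D1)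
  let ?U = "C * N (cube a l) * (l ^ DIM('a)) powr (- (\<theta> * \<alpha>))"
  let ?u = "\<lambda>x. 1 / (1 / q x - \<theta> * \<alpha>)"
  have U: "0 < ?U" using C D.N_pos[OF l, of a] l by simp
  have m: "0 < M\<^sub>1 (cube a l)" by (rule D1.M_pos[OF l])
  have qpos: "0 < q x" "0 < q\<^sub>1 x" "0 < s\<^sub>1 x" for x
    using D.q_ge[of x] D1.q_ge[of x] D1.s_ge[of x] by auto
  have u: "0 < ?u x" for x
    using lt[of x] qpos(1)[of x] by (simp add: field_simps)
  have rel: "(1 - \<theta>) / q\<^sub>0 x = 1 / ?u x + \<theta> / s\<^sub>1 x" for x
  proof -
    have "\<theta> / s\<^sub>1 x = \<theta> * (1 / s\<^sub>1 x)" by simp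
    also have "1 / s\<^sub>1 x = \<alpha> - 1 / q\<^sub>1 x" using D1.dual[of x] by linarith
    finally have "\<theta> / s\<^sub>1 x = \<theta> * (\<alpha> - 1 / q\<^sub>1 x)" .
    then show ?thesis by (simp add: q0(2) algebra_simps)
  qed
  have ball: "density_on (\<lambda>x. (1 / w\<^sub>1 x / M\<^sub>1 (cube a l)) powr s\<^sub>1 x) (cube a l) \<le> 1"
    using D1.M_ball[OF l, of a] by simp
  show ?thesis
  proof (rule norm_on_le)
    show "0 < 2 * (?U powr (1 / (1 - \<theta>)) * M\<^sub>1 (cube a l) powr (\<theta> / (1 - \<theta>)))"
      using U m by (intro mult_pos_pos) (auto simp only: powr_gt_zero zero_less_numeral)
    show "density_on (\<lambda>x. (w x powr (1 / (1 - \<theta>)) * (1 / w\<^sub>1 x) powr (\<theta> / (1 - \<theta>))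
        / (2 * (?U powr (1 / (1 - \<theta>)) * M\<^sub>1 (cube a l) powr (\<theta> / (1 - \<theta>))))) powr q\<^sub>0 x) (cube a l) \<le> 1"
      using D.w_pos D1.w_pos
      by (intro density_on_interpolation[OF \<theta> _ _ _ _ _ _ _ q0(1) u qpos(3) rel U improved m ball]) auto
  qed
qed

text \<open>The total power of \<open>m\<close> is - \<alpha> + (\<alpha> - 2 \<theta> \<alpha>) /
  (1 - \<theta>) + \<theta> \<alpha> / (1 - \<theta>) = 0: the gain from both self-improvements
  exactly balances the two weight conditions, and the bound is uniform over cubes.\<close>

lemma endpoint_product_bound:
  fixes m :: real
  assumes \<theta>: "0 < \<theta>" "\<theta> < 1" and pos: "0 < m" "0 < N" "0 < M" "0 < N\<^sub>1" "0 < M\<^sub>1" "0 < C" "0 < C'"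
    and K: "N * M \<le> K * m powr \<alpha>" "N\<^sub>1 * M\<^sub>1 \<le> K\<^sub>1 * m powr \<alpha>"
  shows "m powr (- \<alpha>) * (2 * ((C * N * m powr (- (\<theta> * \<alpha>))) powr (1 / (1 - \<theta>)) * M\<^sub>1 powr (\<theta> / (1 - \<theta>))))
      * (2 * ((C' * M * m powr (- (\<theta> * \<alpha>))) powr (1 / (1 - \<theta>)) * N\<^sub>1 powr (\<theta> / (1 - \<theta>))))
    \<le> 4 * ((C * C' * K) powr (1 / (1 - \<theta>)) * K\<^sub>1 powr (\<theta> / (1 - \<theta>)))"
proof -
  let ?a = "1 / (1 - \<theta>)" and ?b = "\<theta> / (1 - \<theta>)" and ?z = "m powr (- (\<theta> * \<alpha>))"
  have "m powr (- \<alpha>) * (2 * ((C * N * ?z) powr ?a * M\<^sub>1 powr ?b)) * (2 * ((C' * M * ?z) powr ?a * N\<^sub>1 powr ?b))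
      = 4 * m powr (- \<alpha>) * ((C * C' * (N * M) * (?z * ?z)) powr ?a * (N\<^sub>1 * M\<^sub>1) powr ?b)"
    by (simp add: powr_mult)
  also have "\<dots> \<le> 4 * m powr (- \<alpha>) * ((C * C' * (K * m powr \<alpha>) * (?z * ?z)) powr ?a * (K\<^sub>1 * m powr \<alpha>) powr ?b)"
    using \<theta> pos K by (intro mult_left_mono mult_mono[of "_ powr _"] powr_mono2 mult_right_mono) auto
  also have "\<dots> = 4 * ((C * C' * K) powr ?a * K\<^sub>1 powr ?b)
      * (m powr (- \<alpha>) * (m powr \<alpha> * (?z * ?z)) powr ?a * (m powr \<alpha>) powr ?b)"
    by (simp add: powr_mult)
  also have "m powr (- \<alpha>) * (m powr \<alpha> * (?z * ?z)) powr ?a * (m powr \<alpha>) powr ?b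
      = m powr (- \<alpha> + (\<alpha> - 2 * \<theta> * \<alpha>) * ?a + \<alpha> * ?b)"
    by (simp add: powr_add[symmetric] powr_powr algebra_simps)
  also have "- \<alpha> + (\<alpha> - 2 * \<theta> * \<alpha>) * ?a + \<alpha> * ?b = 0"
    using \<theta> by (simp add: field_simps)
  finally show ?thesis using pos by simp
qed

lemma endpoint_weight_iff:
  fixes w w\<^sub>0 w\<^sub>1 :: real
  assumes "0 < \<theta>" "\<theta> < 1" "0 < w" "0 < w\<^sub>0" "0 < w\<^sub>1"
  shows "w = w\<^sub>0 powr (1 - \<theta>) * w\<^sub>1 powr \<theta>
    \<longleftrightarrow> w\<^sub>0 = w powr (1 / (1 - \<theta>)) * (1 / w\<^sub>1) powr (\<theta> / (1 - \<theta>))"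
proof
  assume w: "w = w\<^sub>0 powr (1 - \<theta>) * w\<^sub>1 powr \<theta>"
  show "w\<^sub>0 = w powr (1 / (1 - \<theta>)) * (1 / w\<^sub>1) powr (\<theta> / (1 - \<theta>))"
    unfolding w using assms by (simp add: powr_mult powr_powr powr_divide)
next
  assume w0: "w\<^sub>0 = w powr (1 / (1 - \<theta>)) * (1 / w\<^sub>1) powr (\<theta> / (1 - \<theta>))"
  show "w = w\<^sub>0 powr (1 - \<theta>) * w\<^sub>1 powr \<theta>"
    unfolding w0 using assms by (simp add: powr_mult powr_powr powr_divide)
qed

text \<open>The existence clause keeps the universal one from being vacuous; the universal clause
  covers every version of the endpoint weight, which is determined only almost everywhere.\<close>

theorem theorem1p2:
  fixes \<gamma> :: real
    and p q p\<^sub>1 q\<^sub>1 :: "'a::euclidean_space \<Rightarrow> ereal"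
    and w w\<^sub>1 :: "'a \<Rightarrow> real"
  assumes "0 \<le> \<gamma>" and "\<gamma> < 1"
    and "(p\<^sub>1, q\<^sub>1) \<in> E_class \<gamma>" and "w\<^sub>1 \<in> A_class \<gamma> p\<^sub>1 q\<^sub>1"
    and "(p, q) \<in> E_class \<gamma>" and "w \<in> A_class \<gamma> p q"
  shows "\<exists>\<eta>. 0 < \<eta> \<and> \<eta> < 1 \<and>
    (\<forall>\<theta>. 0 < \<theta> \<and> \<theta> < \<eta> \<longrightarrow>
      (\<exists>p\<^sub>0 q\<^sub>0 w\<^sub>0. endpoint_data \<theta> p q w p\<^sub>1 q\<^sub>1 w\<^sub>1 p\<^sub>0 q\<^sub>0 w\<^sub>0) \<and>
      (\<forall>p\<^sub>0 q\<^sub>0 w\<^sub>0. endpoint_data \<theta> p q w p\<^sub>1 q\<^sub>1 w\<^sub>1 p\<^sub>0 q\<^sub>0 w\<^sub>0 \<longrightarrow>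
        (p\<^sub>0, q\<^sub>0) \<in> E_class \<gamma> \<and> w\<^sub>0 \<in> A_class \<gamma> p\<^sub>0 q\<^sub>0))"
proof -
  obtain P Q c\<^sub>P B\<^sub>P c\<^sub>Q B\<^sub>Q where p: "p = (\<lambda>x. ereal (P x))" and q: "q = (\<lambda>x. ereal (Q x))"
    and P: "real_exponent P c\<^sub>P B\<^sub>P" and Q: "real_exponent Q c\<^sub>Q B\<^sub>Q" and PQ: "\<And>x. 1 / P x - 1 / Q x = \<gamma>"
    by (rule E_classE[OF assms(5)], rule that)
  obtain P\<^sub>1 Q\<^sub>1 c\<^sub>1 B\<^sub>1 c\<^sub>2 B\<^sub>2 where p1: "p\<^sub>1 = (\<lambda>x. ereal (P\<^sub>1 x))" and q1: "q\<^sub>1 = (\<lambda>x. ereal (Q\<^sub>1 x))"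
    and P1: "real_exponent P\<^sub>1 c\<^sub>1 B\<^sub>1" and Q1: "real_exponent Q\<^sub>1 c\<^sub>2 B\<^sub>2" and PQ1: "\<And>x. 1 / P\<^sub>1 x - 1 / Q\<^sub>1 x = \<gamma>"
    by (rule E_classE[OF assms(3)], rule that)
  define \<alpha> where "\<alpha> = 1 - \<gamma>"
  have \<alpha>: "0 < \<alpha>" using assms(2) by (simp add: \<alpha>_def)
  define S where "S = (\<lambda>x. 1 / (1 - 1 / P x))"
  define S\<^sub>1 where "S\<^sub>1 = (\<lambda>x. 1 / (1 - 1 / P\<^sub>1 x))"
  obtain v N M K B H where D: "dual_weight_pair Q S v N M \<alpha> K B H"
    and D': "dual_weight_pair S Q (\<lambda>x. 1 / v x) M N \<alpha> K B H" and v: "AE x in lebesgue. w x = v x"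
    by (rule dual_weight_pair_of_A_class[OF P Q PQ assms(6)[unfolded p q], folded S_def \<alpha>_def], rule that)
  obtain v\<^sub>1 N\<^sub>1 M\<^sub>1 K\<^sub>1 B' H' where D1: "dual_weight_pair Q\<^sub>1 S\<^sub>1 v\<^sub>1 N\<^sub>1 M\<^sub>1 \<alpha> K\<^sub>1 B' H'"
    and D1': "dual_weight_pair S\<^sub>1 Q\<^sub>1 (\<lambda>x. 1 / v\<^sub>1 x) M\<^sub>1 N\<^sub>1 \<alpha> K\<^sub>1 B' H'" and v1: "AE x in lebesgue. w\<^sub>1 x = v\<^sub>1 x"
    by (rule dual_weight_pair_of_A_class[OF P1 Q1 PQ1 assms(4)[unfolded p1 q1], folded S\<^sub>1_def \<alpha>_def], rule that)
  interpret D: dual_weight_pair Q S v N M \<alpha> K B H by (rule D)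
  interpret D1: dual_weight_pair Q\<^sub>1 S\<^sub>1 v\<^sub>1 N\<^sub>1 M\<^sub>1 \<alpha> K\<^sub>1 B' H' by (rule D1)
  obtain \<delta> C where \<delta>: "0 < \<delta>" "0 < C" and small: "\<And>d x. \<lbrakk>0 < d; d \<le> \<delta>\<rbrakk> \<Longrightarrow> d * Q x < 1"
    and improved: "\<And>d a l. \<lbrakk>0 < d; d \<le> \<delta>; 0 < l\<rbrakk> \<Longrightarrow> density_on
      (\<lambda>x. (v x / (C * N (cube a l) * (l ^ DIM('a)) powr (- d))) powr (1 / (1 / Q x - d))) (cube a l) \<le> 1"
    by (rule D.exponent_self_improvement, rule that)
  obtain \<delta>' C' where \<delta>': "0 < \<delta>'" "0 < C'" and small': "\<And>d x. \<lbrakk>0 < d; d \<le> \<delta>'\<rbrakk> \<Longrightarrow> d * S x < 1"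
    and improved': "\<And>d a l. \<lbrakk>0 < d; d \<le> \<delta>'; 0 < l\<rbrakk> \<Longrightarrow> density_on
      (\<lambda>x. (1 / v x / (C' * M (cube a l) * (l ^ DIM('a)) powr (- d))) powr (1 / (1 / S x - d))) (cube a l) \<le> 1"
    by (rule dual_weight_pair.exponent_self_improvement[OF D'], rule that)
  have PB: "1 < c\<^sub>P" "1 < P x" "P x \<le> B\<^sub>P" "1 < P\<^sub>1 x" for x
    using P real_exponent_gt[OF P] real_exponent_gt[OF P1] by (auto simp: real_exponent_def)
  have QB: "1 < c\<^sub>Q" "1 < Q x" "Q x \<le> B\<^sub>Q" "1 < Q\<^sub>1 x" for x
    using Q real_exponent_gt[OF Q] real_exponent_gt[OF Q1] by (auto simp: real_exponent_def)
  have BPQ: "1 < B\<^sub>P" "1 < B\<^sub>Q"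
    using PB(2,3)[of undefined] QB(2,3)[of undefined] by auto
  \<comment> \<open>The bounds involving \<open>c\<^sub>P\<close>, \<open>B\<^sub>P\<close>,
    \<open>c\<^sub>Q\<close>, \<open>B\<^sub>Q\<close> make the endpoint exponents admissible. The
    last two allow the loss \<theta> \<alpha> in the self-improvement of the weight and of its
    inverse.\<close>
  define \<eta> where "\<eta> = Min {1 / 2, (1 - 1 / c\<^sub>P) / 2, 1 / (2 * B\<^sub>P), (1 - 1 / c\<^sub>Q) / 2, 1 / (2 * B\<^sub>Q), \<delta> / \<alpha>, \<delta>' / \<alpha>}"
  have "0 < \<eta>"
    unfolding \<eta>_def using PB(1) QB(1) BPQ \<delta> \<delta>' \<alpha> by simp
  moreover have "\<eta> \<le> 1 / 2" unfolding \<eta>_def by (rule Min_le) auto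
  then have "\<eta> < 1" by simp
  moreover have "(\<exists>p\<^sub>0 q\<^sub>0 w\<^sub>0. endpoint_data \<theta> p q w p\<^sub>1 q\<^sub>1 w\<^sub>1 p\<^sub>0 q\<^sub>0 w\<^sub>0) \<and>
      (\<forall>p\<^sub>0 q\<^sub>0 w\<^sub>0. endpoint_data \<theta> p q w p\<^sub>1 q\<^sub>1 w\<^sub>1 p\<^sub>0 q\<^sub>0 w\<^sub>0 \<longrightarrow>
        (p\<^sub>0, q\<^sub>0) \<in> E_class \<gamma> \<and> w\<^sub>0 \<in> A_class \<gamma> p\<^sub>0 q\<^sub>0)" if "0 < \<theta>" "\<theta> < \<eta>" for \<theta>
  proof -
    have \<theta>: "0 < \<theta>" "\<theta> < 1 / 2" "\<theta> < (1 - 1 / c\<^sub>P) / 2" "\<theta> < 1 / (2 * B\<^sub>P)" "\<theta> < (1 - 1 / c\<^sub>Q) / 2"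
      "\<theta> < 1 / (2 * B\<^sub>Q)" "\<theta> < \<delta> / \<alpha>" "\<theta> < \<delta>' / \<alpha>"
      using that by (simp_all add: \<eta>_def Min_gr_iff)
    have \<theta>1: "\<theta> < 1" using \<theta>(2) by simp
    have d: "0 < \<theta> * \<alpha>" "\<theta> * \<alpha> \<le> \<delta>" "\<theta> * \<alpha> \<le> \<delta>'"
      using \<theta> \<alpha> by (auto simp: pos_less_divide_eq)
    have \<theta>B: "\<theta> * B\<^sub>P < 1" "\<theta> * B\<^sub>Q < 1"
      using \<theta>(1,4,6) BPQ by (auto simp: pos_less_divide_eq)
    define P\<^sub>0 where "P\<^sub>0 = endpoint_exponent \<theta> P P\<^sub>1"
    define Q\<^sub>0 where "Q\<^sub>0 = endpoint_exponent \<theta> Q Q\<^sub>1"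
    define S\<^sub>0 where "S\<^sub>0 = (\<lambda>x. 1 / (1 - 1 / P\<^sub>0 x))"
    define W where "W = (\<lambda>x. v x powr (1 / (1 - \<theta>)) * (1 / v\<^sub>1 x) powr (\<theta> / (1 - \<theta>)))"
    \<comment> \<open>This is the inverse of \<open>W\<close>, written with a double reciprocal so
      that it is literally the endpoint weight of the swapped pairs.\<close>
    define W' where "W' = (\<lambda>x. (1 / v x) powr (1 / (1 - \<theta>)) * (1 / (1 / v\<^sub>1 x)) powr (\<theta> / (1 - \<theta>)))"
    have P0: "real_exponent P\<^sub>0 ((c\<^sub>P + 1) / 2) (2 * B\<^sub>P)"
      unfolding P\<^sub>0_def using \<theta> by (intro real_exponent_endpoint[OF P P1]) auto
    have Q0: "real_exponent Q\<^sub>0 ((c\<^sub>Q + 1) / 2) (2 * B\<^sub>Q)"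
      unfolding Q\<^sub>0_def using \<theta> by (intro real_exponent_endpoint[OF Q Q1]) auto
    have P0_gt: "1 < P\<^sub>0 x" and Q0_gt: "1 < Q\<^sub>0 x" for x
      by (rule real_exponent_gt[OF P0], rule real_exponent_gt[OF Q0])
    have invP: "(1 - \<theta>) / P\<^sub>0 x = 1 / P x - \<theta> / P\<^sub>1 x" and invQ: "(1 - \<theta>) / Q\<^sub>0 x = 1 / Q x - \<theta> / Q\<^sub>1 x" for x
      using \<theta>1 by (simp_all add: P\<^sub>0_def Q\<^sub>0_def endpoint_exponent_def)
    \<comment> \<open>Conjugation is affine in reciprocals, so the endpoint relation passes to the
      conjugate exponents.\<close>
    have invS: "(1 - \<theta>) / S\<^sub>0 x = 1 / S x - \<theta> / S\<^sub>1 x" for x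
    proof -
      have "(1 - \<theta>) / S\<^sub>0 x = (1 - \<theta>) - (1 - \<theta>) / P\<^sub>0 x"
        by (simp add: S\<^sub>0_def algebra_simps)
      then show ?thesis by (simp add: invP S_def S\<^sub>1_def algebra_simps)
    qed
    have S0: "1 \<le> S\<^sub>0 x" for x using P0_gt[of x] by (simp add: S\<^sub>0_def field_simps)
    have PQ0: "1 / P\<^sub>0 x - 1 / Q\<^sub>0 x = \<gamma>" for x
    proof -
      have "(1 - \<theta>) * (1 / P\<^sub>0 x - 1 / Q\<^sub>0 x) = (1 / P x - 1 / Q x) - \<theta> * (1 / P\<^sub>1 x - 1 / Q\<^sub>1 x)"
        using invP[of x] invQ[of x] by (simp add: algebra_simps)
      also have "\<dots> = (1 - \<theta>) * \<gamma>" by (simp add: PQ PQ1 algebra_simps)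
      finally show ?thesis using \<theta>1 by simp
    qed
    have E: "((\<lambda>x. ereal (P\<^sub>0 x)), (\<lambda>x. ereal (Q\<^sub>0 x))) \<in> E_class \<gamma>"
    proof -
      have "1 / ereal (P\<^sub>0 x) - 1 / ereal (Q\<^sub>0 x) = ereal \<gamma>" for x
        using P0_gt[of x] Q0_gt[of x] PQ0[of x] by (subst ereal_exponent_diff) auto
      then show ?thesis
        using E0_classI[OF P0] E0_classI[OF Q0] by (simp add: E_class_def)
    qed
    have W_pos: "0 < W x" "0 < W' x" for x
      using D.w_pos[of x] D1.w_pos[of x] by (auto simp: W_def W'_def)
    have W_inv: "inverse (W x) = W' x" for x
      using D.w_pos[of x] D1.w_pos[of x] by (simp add: W_def W'_def powr_divide field_simps)
    \<comment> \<open>The relations have exactly one solution, so arbitrary endpoint data carry the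
      exponents constructed here.\<close>
    have exps: "(\<forall>x. 1 / p x = ereal (1 - \<theta>) / p\<^sub>0 x + ereal \<theta> / p\<^sub>1 x) \<longleftrightarrow> p\<^sub>0 = (\<lambda>x. ereal (P\<^sub>0 x))"
      "(\<forall>x. 1 / q x = ereal (1 - \<theta>) / p\<^sub>0 x + ereal \<theta> / q\<^sub>1 x) \<longleftrightarrow> p\<^sub>0 = (\<lambda>x. ereal (Q\<^sub>0 x))" for p\<^sub>0
      unfolding p q p1 q1 fun_eq_iff P\<^sub>0_def Q\<^sub>0_def endpoint_exponent_def
      using endpoint_exponent_iff[OF PB(2,3,4) \<theta>(1) \<theta>1 \<theta>B(1)] endpoint_exponent_iff[OF QB(2,3,4) \<theta>(1) \<theta>1 \<theta>B(2)]
      by blast+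
    have w0: "AE x in lebesgue. w\<^sub>0 x = W x"
      if "weight w\<^sub>0" "AE x in lebesgue. w x = w\<^sub>0 x powr (1 - \<theta>) * w\<^sub>1 x powr \<theta>" for w\<^sub>0
    proof -
      have "AE x in lebesgue. 0 < w\<^sub>0 x" using that(1) by (simp add: weight_def)
      then show ?thesis using that(2) v v1
      proof eventually_elim
        case (elim x)
        then show ?case
          using endpoint_weight_iff[OF \<theta>(1) \<theta>1 D.w_pos[of x] elim(1) D1.w_pos[of x]] by (simp add: W_def)
      qed
    qed
    have "endpoint_data \<theta> p q w p\<^sub>1 q\<^sub>1 w\<^sub>1 (\<lambda>x. ereal (P\<^sub>0 x)) (\<lambda>x. ereal (Q\<^sub>0 x)) W"
      unfolding endpoint_data_def exps
    proof (intro conjI refl)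
      show "weight W" unfolding weight_def using W_pos by (auto simp: W_def)
      show "AE x in lebesgue. w x = W x powr (1 - \<theta>) * w\<^sub>1 x powr \<theta>"
        using v v1
      proof eventually_elim
        case (elim x)
        then show ?case
          using endpoint_weight_iff[OF \<theta>(1) \<theta>1 D.w_pos[of x] W_pos(1)[of x] D1.w_pos[of x]] by (simp add: W_def)
      qed
    qed
    moreover have "(p\<^sub>0, q\<^sub>0) \<in> E_class \<gamma> \<and> w\<^sub>0 \<in> A_class \<gamma> p\<^sub>0 q\<^sub>0"
      if data: "endpoint_data \<theta> p q w p\<^sub>1 q\<^sub>1 w\<^sub>1 p\<^sub>0 q\<^sub>0 w\<^sub>0" for p\<^sub>0 q\<^sub>0 w\<^sub>0
    proof -
      have p0: "p\<^sub>0 = (\<lambda>x. ereal (P\<^sub>0 x))" and q0: "q\<^sub>0 = (\<lambda>x. ereal (Q\<^sub>0 x))" and wt: "weight w\<^sub>0"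
        and ae: "AE x in lebesgue. w\<^sub>0 x = W x"
        using data w0 unfolding endpoint_data_def exps by auto
      define G where "G = 4 * ((C * C' * K) powr (1 / (1 - \<theta>)) * K\<^sub>1 powr (\<theta> / (1 - \<theta>)))"
      have "A_const \<gamma> p\<^sub>0 q\<^sub>0 w\<^sub>0 \<le> ennreal G"
        unfolding A_const_def
      proof (rule SUP_least)
        fix R :: "'a set" assume "R \<in> cubes"
        then obtain a l where R: "R = cube a l" and l: "0 < l" unfolding cubes_def by auto
        let ?m = "l ^ DIM('a)"
        let ?X = "2 * ((C * N R * ?m powr (- (\<theta> * \<alpha>))) powr (1 / (1 - \<theta>)) * M\<^sub>1 R powr (\<theta> / (1 - \<theta>)))"
        let ?Y = "2 * ((C' * M R * ?m powr (- (\<theta> * \<alpha>))) powr (1 / (1 - \<theta>)) * N\<^sub>1 R powr (\<theta> / (1 - \<theta>)))"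
        have "Lp_norm q\<^sub>0 (\<lambda>x. w\<^sub>0 x * indicator R x) = norm_on Q\<^sub>0 W R"
          unfolding q0 by (rule Lp_norm_eq_norm_on[OF W_pos(1) ae])
        also have "\<dots> \<le> ennreal ?X"
          unfolding W_def R by (rule endpoint_norm_bound[OF D D1 \<theta>(1) \<theta>1 \<delta>(2) small[OF d(1,2)] improved[OF d(1,2) l]
                less_imp_le[OF Q0_gt] invQ l])
        finally have X: "Lp_norm q\<^sub>0 (\<lambda>x. w\<^sub>0 x * indicator R x) \<le> ennreal ?X" .
        have ae': "AE x in lebesgue. inverse (w\<^sub>0 x) = W' x"
          using ae by eventually_elim (simp add: W_inv)
        have "Lp_norm (conj_exponent p\<^sub>0) (\<lambda>x. inverse (w\<^sub>0 x) * indicator R x) = norm_on S\<^sub>0 W' R"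
          unfolding p0 conj_exponent_real[OF P0_gt] S\<^sub>0_def by (rule Lp_norm_eq_norm_on[OF W_pos(2) ae'])
        also have "\<dots> \<le> ennreal ?Y"
          unfolding W'_def R by (rule endpoint_norm_bound[OF D' D1' \<theta>(1) \<theta>1 \<delta>'(2) small'[OF d(1,3)] improved'[OF d(1,3) l]
                S0 invS l])
        finally have Y: "Lp_norm (conj_exponent p\<^sub>0) (\<lambda>x. inverse (w\<^sub>0 x) * indicator R x) \<le> ennreal ?Y" .
        have meas: "measure lebesgue R powr (\<gamma> - 1) = ?m powr (- \<alpha>)"
          using l unfolding R by (simp only: cube_measure less_imp_le \<alpha>_def minus_diff_eq)
        have "ennreal (measure lebesgue R powr (\<gamma> - 1)) * Lp_norm q\<^sub>0 (\<lambda>x. w\<^sub>0 x * indicator R x)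
            * Lp_norm (conj_exponent p\<^sub>0) (\<lambda>x. inverse (w\<^sub>0 x) * indicator R x)
          \<le> ennreal (?m powr (- \<alpha>)) * ennreal ?X * ennreal ?Y"
          unfolding meas by (intro mult_mono X Y) auto
        also have "\<dots> = ennreal (?m powr (- \<alpha>) * ?X * ?Y)"
          by (simp only: ennreal_mult mult_nonneg_nonneg powr_ge_zero zero_le_numeral)
        also have "\<dots> \<le> ennreal G"
          unfolding G_def R using l \<delta> \<delta>' D.N_pos[OF l] D.M_pos[OF l] D1.N_pos[OF l] D1.M_pos[OF l]
            D.NM_le[OF l, of a] D1.NM_le[OF l, of a]
          by (intro ennreal_leI endpoint_product_bound[OF \<theta>(1) \<theta>1]) auto
        finally show "ennreal (measure lebesgue R powr (\<gamma> - 1)) * Lp_norm q\<^sub>0 (\<lambda>x. w\<^sub>0 x * indicator R x)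
            * Lp_norm (conj_exponent p\<^sub>0) (\<lambda>x. inverse (w\<^sub>0 x) * indicator R x) \<le> ennreal G" .
      qed
      then have "A_const \<gamma> p\<^sub>0 q\<^sub>0 w\<^sub>0 < \<infinity>" by (rule order.strict_trans1) simp
      then show ?thesis using E wt unfolding A_class_def p0 q0 by simp
    qed
    ultimately show ?thesis by blast
  qed
  ultimately show ?thesis by blast
qed

end
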